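(* For each $n\ge 1$ let $K_n$ be the number of short chords in a crystallized diagram chosen uniformly at random among all crystallized diagrams with $n$ chords. Then, as $n\to\infty$, the distribution of $K_n$ is asymptotically normal, i.e. $(K_n-\mathbb{E}[K_n])/\sqrt{\operatorname{Var}(K_n)}$ converges in distribution to the standard normal law, with mean $$\bar k=\mathbb{E}[K_n]\sim\sqrt{\frac{2n}{\log n}},$$ where $\sim$ means that the ratio of the two sides tends to $1$.
   Context: A linear chord diagram with $n$ chords is a perfect matching of the $2n$ vertices $1,2,\dots,2n$ arranged on a line; the matched pairs are called chords. A short chord is a chord joining two adjacent vertices $i,i+1$. A bubble is a non-empty set of consecutive vertices that is bounded on each side either by an end of the diagram or by a short chord, and which contains no vertex of a short chord (equivalently, a maximal run of consecutive vertices none of which belongs to a short chord). A bridge of a bubble is a chord joining a vertex of the bubble to a vertex outside it. A bubble is empty if no chord has both endpoints in the bubble. A diagram is crystallized if all of its bubbles are empty; equivalently, every chord is either short or joins two different bubbles. $\log$ is the natural logarithm. *)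

theory Defs
  imports "HOL-Probability.Probability" "HOL-Library.Landau_Symbols"
begin

definition chord_diagrams :: "nat \<Rightarrow> nat set set set" where
  "chord_diagrams n = {D. partition_on {1..2 * n} D \<and> (\<forall>c\<in>D. card c = 2)}"

definition short_chords :: "nat set set \<Rightarrow> nat set set" where
  "short_chords D = {c \<in> D. \<exists>i. c = {i, Suc i}}"

text \<open>A chord containing \<open>a - 1\<close> but avoiding \<open>{a..b}\<close> that is short must be
  \<open>{a - 2, a - 1}\<close>; so membership of the outer neighbour in a short chord expresses that
  the run is bounded by a short chord.\<close>

definition bubbles :: "nat \<Rightarrow> nat set set \<Rightarrow> nat set set" where
  "bubbles n D = {B. \<exists>a b. 1 \<le> a \<and> a \<le> b \<and> b \<le> 2 * n \<and> B = {a..b}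
      \<and> (a = 1 \<or> a - 1 \<in> \<Union>(short_chords D))
      \<and> (b = 2 * n \<or> b + 1 \<in> \<Union>(short_chords D))
      \<and> B \<inter> \<Union>(short_chords D) = {}}"

definition empty_bubble :: "nat set set \<Rightarrow> nat set \<Rightarrow> bool" where
  "empty_bubble D B \<longleftrightarrow> \<not> (\<exists>c\<in>D. c \<subseteq> B)"

definition crystallized_diagrams :: "nat \<Rightarrow> nat set set set" where
  "crystallized_diagrams n =
     {D \<in> chord_diagrams n. \<forall>B\<in>bubbles n D. empty_bubble D B}"

definition random_crystallized :: "nat \<Rightarrow> nat set set pmf" where
  "random_crystallized n = pmf_of_set (crystallized_diagrams n)"

definition num_short :: "nat set set \<Rightarrow> real" where
  "num_short D = real (card (short_chords D))"

definition mean_short :: "nat \<Rightarrow> real" where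
  "mean_short n = measure_pmf.expectation (random_crystallized n) num_short"

definition var_short :: "nat \<Rightarrow> real" where
  "var_short n = measure_pmf.variance (random_crystallized n) num_short"

definition standardized_short_law :: "nat \<Rightarrow> real measure" where
  "standardized_short_law n =
     distr (measure_pmf (random_crystallized n)) borel (\<lambda>D. (num_short D - mean_short n) / sqrt (var_short n))"

text \<open>The two facts below ensure that \<open>pmf_of_set\<close> really denotes the uniform distribution.\<close>

lemma finite_crystallized_diagrams: "finite (crystallized_diagrams n)"
proof (rule finite_subset)
  show "crystallized_diagrams n \<subseteq> Pow (Pow {1..2 * n})"
    by (auto simp: crystallized_diagrams_def chord_diagrams_def partition_on_def)
qed simp

lemma crystallized_diagrams_nonempty: "crystallized_diagrams n \<noteq> {}"
proof -
  define D where "D = (\<lambda>i. {2 * i + 1, Suc (2 * i + 1)}) ` {..<n}"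
  have cov: "\<Union>D = {1..2 * n}"
  proof
    show "\<Union>D \<subseteq> {1..2 * n}" by (auto simp: D_def)
    show "{1..2 * n} \<subseteq> \<Union>D"
    proof
      fix x assume "x \<in> {1..2 * n}"
      then have "(x - 1) div 2 < n" "x = 2 * ((x - 1) div 2) + 1 \<or> x = Suc (2 * ((x - 1) div 2) + 1)"
        by auto
      then show "x \<in> \<Union>D" unfolding D_def by blast
    qed
  qed
  have "disjoint D"
    unfolding D_def disjoint_def by (auto; presburger)
  with cov have D: "D \<in> chord_diagrams n"
    by (auto simp: chord_diagrams_def partition_on_def D_def)
  have "short_chords D = D"
    by (auto simp: short_chords_def D_def)
  with cov have "bubbles n D = {}"
    by (auto simp: bubbles_def)
  with D have "D \<in> crystallized_diagrams n"
    by (simp add: crystallized_diagrams_def)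
  then show ?thesis by blast
qed

end

theory Submission
  imports Defs "HOL-Real_Asymp.Real_Asymp"
begin

text \<open>
  A crystallized diagram with \<open>k\<close> short chords is a matching of \<open>2N\<close> vertices, \<open>N = n - k\<close>,
  distributed over the \<open>k + 1\<close> slots cut out by the short chords, without a pair inside one slot.
  Removing the first vertex of the first slot together with its partner, and averaging over the
  slots, gives for the number \<open>c(n, k)\<close> of these diagrams the linear recurrence
  \<open>c(n, k) = c(n - 1, k - 1) + k / (k + 1) * (2n - k - 1) * c(n - 1, k)\<close>.
  It preserves log-concavity in \<open>k\<close>, and in terms of the exponential generating function
  \<open>Y\<^sub>k x = (\<Sum>N. c(N + k, k) * x ^ (2N + k) / (2N + k)!)\<close> it is a first-order differential
  equation. The product of \<open>Y\<^sub>k x\<close> and \<open>exp (- x\<^sup>2 / 2)\<close> is therefore a \<open>(k + 1)\<close>-fold convolution of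
  half-Gaussians, which evaluates \<open>\<integral> Y\<^sub>k x * exp (- (k + 1) * x\<^sup>2 / (2 * (k + 2))) dx\<close> over
  the positive reals in closed form. Expanding this integral termwise shows that \<open>c(n, k)\<close> is at most
  \<open>E(n, k) = 2 ^ n * pi powr ((k - 1) / 2) * Gamma (n - (k - 1) / 2) * (k / (k + 1)) powr (n - k / 2) / sqrt (k + 1)\<close>
  and at least \<open>E(n, k) - k\<^sup>2 * E(n - 1, k - 1)\<close>.

  Up to terms that vary slowly, \<open>ln E(n, k)\<close> is \<open>k / 2 * ln (pi / n) - n / k\<close>. It is maximal at
  \<open>t = sqrt (2n / ln (n / pi))\<close> and has curvature \<open>- 1 / s\<^sup>2\<close> there with \<open>s\<^sup>2 = t ^ 3 / (2n)\<close>. In the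
  window \<open>k = t + s * x\<close> the lower-order term is negligible, so \<open>c(n, t + s * x) / c(n, t)\<close> tends
  to \<open>exp (- x\<^sup>2 / 2)\<close> for every \<open>x\<close>. Log-concavity upgrades this pointwise limit to exponential
  domination, and dominated convergence yields the mean, the variance and the distribution function.
\<close>

section \<open>Matchings without monochromatic pairs\<close>

text \<open>The typical number of short chords grows with \<open>n\<close>, so asymptotics for fixed
  \<open>k\<close> would not suffice: the estimates have to be uniform for \<open>k\<close> of order
  \<open>sqrt (n / ln n)\<close>. Hence the explicit two-sided inequality. Its source is a
  telescoping identity: multiplied by Gaussian moments, the recurrence exhibits
  \<open>c(n, k)\<close> as a partial sum of a nonnegative series whose total is known in closed
  form. \<open>E(n, k)\<close> replaces the partial sum by the total, and the loss is a tail whose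
  terms are controlled by the same upper bound for \<open>k - 1\<close>.

  The margin is thin. Near \<open>k = t\<close> the relative loss
  \<open>k^2 * E(n - 1, k - 1) / E(n, k)\<close> is bounded by a quantity of order
  \<open>1 / ln n\<close>: the exponential \<open>exp (- n / t^2)\<close> equals
  \<open>sqrt (pi / n)\<close>, the Gamma quotient yields another \<open>1 / sqrt n\<close>, and
  \<open>t^2 / n\<close> is \<open>2 / ln (n / pi)\<close>.

  Pointwise limits alone would not give moments. Log-concavity needs the values at only three
  points, the centre and one scale to each side, to produce an exponential bound on the whole
  line.\<close>

definition bichromatic_matchings :: "'a set \<Rightarrow> ('a \<Rightarrow> 'b) \<Rightarrow> 'a set set set" where
  "bichromatic_matchings V f = {D. partition_on V D \<and> (\<forall>c\<in>D. \<exists>p q. c = {p, q} \<and> f p \<noteq> f q)}"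

lemma finite_bichromatic_matchings:
  assumes "finite V" shows "finite (bichromatic_matchings V f)"
proof (rule finite_subset)
  show "bichromatic_matchings V f \<subseteq> Pow (Pow V)"
    by (auto simp: bichromatic_matchings_def partition_on_def)
qed (use assms in simp)

lemma bichromatic_matchings_empty: "bichromatic_matchings {} f = {{}}"
  by (auto simp: bichromatic_matchings_def partition_on_empty)

text \<open>Either side already forces \<open>{v, w}\<close> to be disjoint from the remaining
  blocks, which is the side condition of \<open>partition_on_insert\<close>.\<close>

lemma partition_on_insert_pair:
  assumes "v \<in> V" "w \<in> V" "{v, w} \<notin> D"
  shows "partition_on V (insert {v, w} D) \<longleftrightarrow> partition_on (V - {v, w}) D"
proof -
  have "disjnt {v, w} (\<Union>D)" if "disjoint (insert {v, w} D)"
  proof -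
    have "disjnt {v, w} c" if "c \<in> D" for c
      using \<open>disjoint (insert {v, w} D)\<close> that assms(3) by (auto simp: pairwise_insert)
    then show ?thesis by (simp add: disjnt_Union2)
  qed
  moreover have "disjnt {v, w} (\<Union>D)" if "partition_on (V - {v, w}) D"
    using that by (auto simp: partition_on_def disjnt_def)
  ultimately show ?thesis
    using assms partition_on_insert [of "{v, w}" D V] by (auto simp: partition_on_def)
qed

text \<open>Classification by the partner \<open>w\<close> of a fixed vertex \<open>v\<close>. Since
  a matching determines this partner, the union is disjoint and yields a recursion for the
  cardinality.\<close>

lemma bichromatic_matchings_decompose:
  assumes "v \<in> V"
  shows "bichromatic_matchings V f =
    (\<Union>w\<in>{w\<in>V. f w \<noteq> f v}. insert {v, w} ` bichromatic_matchings (V - {v, w}) f)" (is "?L = ?R")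
proof
  show "?L \<subseteq> ?R"
  proof
    fix D assume D: "D \<in> ?L"
    then have "v \<in> \<Union>D" using assms by (auto simp: bichromatic_matchings_def partition_on_def)
    then obtain c where c: "c \<in> D" "v \<in> c" by blast
    with D obtain p q where "c = {p, q}" "f p \<noteq> f q" by (auto simp: bichromatic_matchings_def)
    with c obtain w where w: "c = {v, w}" "f w \<noteq> f v" by (metis insert_commute insertE singletonD)
    have "w \<in> V" using D c w by (auto simp: bichromatic_matchings_def partition_on_def)
    have "D = insert {v, w} (D - {{v, w}})" using c w by auto
    moreover have "partition_on (V - {v, w}) (D - {{v, w}})"
      using D \<open>w \<in> V\<close> assms c w
      by (subst partition_on_insert_pair [symmetric]) (auto simp: bichromatic_matchings_def insert_absorb)
    then have "D - {{v, w}} \<in> bichromatic_matchings (V - {v, w}) f"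
      using D by (auto simp: bichromatic_matchings_def)
    ultimately show "D \<in> ?R" using \<open>w \<in> V\<close> w(2) by blast
  qed
  show "?R \<subseteq> ?L"
  proof
    fix D assume "D \<in> ?R"
    then obtain w D' where w: "w \<in> V" "f w \<noteq> f v" and D: "D = insert {v, w} D'"
      and D': "D' \<in> bichromatic_matchings (V - {v, w}) f" by auto
    have "{v, w} \<notin> D'" using D' by (auto simp: bichromatic_matchings_def partition_on_def)
    then have "partition_on V D"
      using D' w assms by (auto simp: D partition_on_insert_pair bichromatic_matchings_def)
    moreover have "\<exists>p q. {v, w} = {p, q} \<and> f p \<noteq> f q" using w by metis
    ultimately show "D \<in> ?L" using D' by (auto simp: bichromatic_matchings_def D)
  qed
qed

lemma card_bichromatic_matchings_remove:
  assumes "finite V" "v \<in> V"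
  shows "card (bichromatic_matchings V f) =
    (\<Sum>w\<in>{w\<in>V. f w \<noteq> f v}. card (bichromatic_matchings (V - {v, w}) f))"
proof -
  have nin: "{v, w} \<notin> D" if "D \<in> bichromatic_matchings (V - {v, w'}) f" for w w' D
    using that by (auto simp: bichromatic_matchings_def partition_on_def)
  have "card (bichromatic_matchings V f) =
      (\<Sum>w\<in>{w\<in>V. f w \<noteq> f v}. card (insert {v, w} ` bichromatic_matchings (V - {v, w}) f))"
    unfolding bichromatic_matchings_decompose [OF assms(2)]
  proof (rule card_UN_disjoint)
    show "\<forall>i\<in>{w \<in> V. f w \<noteq> f v}. \<forall>j\<in>{w \<in> V. f w \<noteq> f v}. i \<noteq> j \<longrightarrow>
        insert {v, i} ` bichromatic_matchings (V - {v, i}) f \<inter> insert {v, j} ` bichromatic_matchings (V - {v, j}) f = {}"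
    proof (intro ballI impI equals0I)
      fix i j D assume ij: "i \<in> {w \<in> V. f w \<noteq> f v}" "j \<in> {w \<in> V. f w \<noteq> f v}" "i \<noteq> j"
        and D: "D \<in> insert {v, i} ` bichromatic_matchings (V - {v, i}) f \<inter> insert {v, j} ` bichromatic_matchings (V - {v, j}) f"
      then have "{v, i} \<in> D" by auto
      moreover obtain D' where "D = insert {v, j} D'" "D' \<in> bichromatic_matchings (V - {v, j}) f"
        using D by auto
      ultimately have "{v, i} = {v, j}" using nin by blast
      then show False using ij by (auto simp: doubleton_eq_iff)
    qed
  qed (use assms in \<open>auto intro!: finite_bichromatic_matchings\<close>)
  also have "\<dots> = (\<Sum>w\<in>{w\<in>V. f w \<noteq> f v}. card (bichromatic_matchings (V - {v, w}) f))"
  proof (rule sum.cong [OF refl], rule card_image, rule inj_onI)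
    fix w D D' assume D: "D \<in> bichromatic_matchings (V - {v, w}) f"
      and D': "D' \<in> bichromatic_matchings (V - {v, w}) f" and eq: "insert {v, w} D = insert {v, w} D'"
    show "D = D'" using eq nin [OF D, of w] nin [OF D', of w] by (metis insert_ident)
  qed
  finally show ?thesis .
qed

text \<open>Only the pattern of equal colours matters. Since the count obeys a recursion that
  deletes \<open>v\<close> and its partner, induction on the size of \<open>V\<close> proves this
  without transporting whole matchings along \<open>h\<close>.\<close>

lemma card_bichromatic_matchings_bij:
  assumes "finite V" "bij_betw h V V'" "\<And>v w. v \<in> V \<Longrightarrow> w \<in> V \<Longrightarrow> f' (h v) = f' (h w) \<longleftrightarrow> f v = f w"
  shows "card (bichromatic_matchings V f) = card (bichromatic_matchings V' f')"
  using assms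
proof (induction "card V" arbitrary: V V' rule: less_induct)
  case less
  show ?case
  proof (cases "V = {}")
    case True
    then have "V' = {}" using less.prems by (auto simp: bij_betw_def)
    then show ?thesis using True by (simp add: bichromatic_matchings_empty)
  next
    case False
    then obtain v where v: "v \<in> V" by blast
    have V': "V' = h ` V" and inj: "inj_on h V" using less.prems by (auto simp: bij_betw_def)
    have bij: "bij_betw h {w\<in>V. f w \<noteq> f v} {w\<in>V'. f' w \<noteq> f' (h v)}"
      unfolding bij_betw_def
    proof
      show "inj_on h {w \<in> V. f w \<noteq> f v}" using inj by (rule inj_on_subset) auto
      show "h ` {w \<in> V. f w \<noteq> f v} = {w \<in> V'. f' w \<noteq> f' (h v)}"
        using less.prems(3) v by (auto simp: V')
    qed
    have "card (bichromatic_matchings V f) =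
        (\<Sum>w\<in>{w\<in>V. f w \<noteq> f v}. card (bichromatic_matchings (V - {v, w}) f))"
      by (rule card_bichromatic_matchings_remove) (use less.prems v in auto)
    also have "\<dots> = (\<Sum>w\<in>{w\<in>V. f w \<noteq> f v}. card (bichromatic_matchings (V' - {h v, h w}) f'))"
    proof (rule sum.cong [OF refl])
      fix w assume w: "w \<in> {w\<in>V. f w \<noteq> f v}"
      show "card (bichromatic_matchings (V - {v, w}) f) = card (bichromatic_matchings (V' - {h v, h w}) f')"
      proof (rule less.hyps)
        show "card (V - {v, w}) < card V"
          using v less.prems(1) by (intro psubset_card_mono) auto
        have "bij_betw h (V - {v, w}) (h ` (V - {v, w}))"
          using inj by (intro inj_on_imp_bij_betw) (rule inj_on_subset, auto)
        moreover have "h ` (V - {v, w}) = V' - {h v, h w}"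
          using inj v w by (subst inj_on_image_set_diff [of h V]) (auto simp: V')
        ultimately show "bij_betw h (V - {v, w}) (V' - {h v, h w})" by simp
      qed (use less.prems in auto)
    qed
    also have "\<dots> = (\<Sum>w\<in>{w\<in>V'. f' w \<noteq> f' (h v)}. card (bichromatic_matchings (V' - {h v, w}) f'))"
      by (rule sum.reindex_bij_betw [OF bij])
    also have "\<dots> = card (bichromatic_matchings V' f')"
      by (rule card_bichromatic_matchings_remove [symmetric]) (use less.prems(1) v in \<open>auto simp: V'\<close>)
    finally show ?thesis .
  qed
qed

text \<open>Bijections between the classes of each colour glue to one colour-preserving bijection,
  so the count depends on the class sizes alone.\<close>

lemma card_bichromatic_matchings_cong:
  assumes "finite V" "finite V'" "\<And>i. card {v\<in>V. f v = i} = card {v\<in>V'. f' v = i}"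
  shows "card (bichromatic_matchings V f) = card (bichromatic_matchings V' f')"
proof -
  have "\<exists>h. bij_betw h {v\<in>V. f v = i} {v\<in>V'. f' v = i}" for i
    using assms by (intro finite_same_card_bij) auto
  then obtain h where h: "\<And>i. bij_betw (h i) {v\<in>V. f v = i} {v\<in>V'. f' v = i}" by metis
  have col: "f' (h i v) = i" "h i v \<in> V'" if "v \<in> V" "f v = i" for i v
    using bij_betwE [OF h [of i]] that by auto
  show ?thesis
  proof (rule card_bichromatic_matchings_bij [where h = "\<lambda>v. h (f v) v"])
    show "bij_betw (\<lambda>v. h (f v) v) V V'"
      unfolding bij_betw_def
    proof
      show "inj_on (\<lambda>v. h (f v) v) V"
      proof (rule inj_onI)
        fix v w assume vw: "v \<in> V" "w \<in> V" "h (f v) v = h (f w) w"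
        then have "f v = f w" using col by metis
        then show "v = w" using bij_betw_imp_inj_on [OF h [of "f v"]] vw
          by (auto dest: inj_onD)
      qed
      show "(\<lambda>v. h (f v) v) ` V = V'"
      proof
        show "V' \<subseteq> (\<lambda>v. h (f v) v) ` V"
        proof
          fix x assume "x \<in> V'"
          then have "x \<in> h (f' x) ` {v \<in> V. f v = f' x}" using h [of "f' x"] by (auto simp: bij_betw_def)
          then obtain v where "v \<in> V" "f v = f' x" "x = h (f v) v" by auto
          then show "x \<in> (\<lambda>v. h (f v) v) ` V" by blast
        qed
      qed (use col in auto)
    qed
    show "f' (h (f v) v) = f' (h (f w) w) \<longleftrightarrow> f v = f w" if "v \<in> V" "w \<in> V" for v w
      using that col by metis
  qed (use assms in auto)
qed

section \<open>Distributing vertices over slots, and the linear recurrence\<close>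

definition slots :: "(nat \<Rightarrow> nat) \<Rightarrow> (nat \<times> nat) set" where
  "slots a = {(i, j). j < a i}"

definition slot_matchings :: "(nat \<Rightarrow> nat) \<Rightarrow> nat" where
  "slot_matchings a = card (bichromatic_matchings (slots a) fst)"

text \<open>The slots are numbered \<open>0..k\<close>, so there are \<open>k + 1\<close> of them,
  and they may be empty. The value \<open>0\<close> beyond \<open>k\<close> makes equal
  distributions equal as functions.\<close>

definition compositions :: "nat \<Rightarrow> nat \<Rightarrow> (nat \<Rightarrow> nat) set" where
  "compositions k s = {a. (\<forall>i>k. a i = 0) \<and> (\<Sum>i\<le>k. a i) = s}"

lemma slots_eq_Sigma:
  assumes "\<And>i. i > k \<Longrightarrow> a i = 0" shows "slots a = (SIGMA i:{..k}. {..<a i})"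
proof -
  have "i \<le> k" if "j < a i" for i j
    using assms [of i] that by (cases "i \<le> k") auto
  then show ?thesis by (auto simp: slots_def)
qed

lemma finite_slots:
  assumes "\<And>i. i > k \<Longrightarrow> a i = 0" shows "finite (slots a)"
  by (subst slots_eq_Sigma [of k]) (use assms in auto)

lemma slots_fibre: "{v \<in> slots a. fst v = i} = {i} \<times> {..<a i}"
  by (auto simp: slots_def)

lemma slot_matchings_eqI:
  assumes "finite V" "\<And>i. i > k \<Longrightarrow> a i = 0" "\<And>i. card {v\<in>V. f v = i} = a i"
  shows "card (bichromatic_matchings V f) = slot_matchings a"
  unfolding slot_matchings_def
  by (rule card_bichromatic_matchings_cong) (use assms finite_slots [of k a] in \<open>auto simp: slots_fibre\<close>)

lemma slot_matchings_zero: "slot_matchings (\<lambda>_. 0) = 1"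
  by (simp add: slot_matchings_def slots_def bichromatic_matchings_empty)

text \<open>The vertex \<open>(i, 0)\<close> is removed with its partner. All \<open>a j\<close>
  partners in slot \<open>j\<close> leave the same slot sizes, and only the sizes matter. For
  \<open>a j = 0\<close> the truncated \<open>a j - 1\<close> is multiplied by
  \<open>0\<close>.\<close>

lemma slot_matchings_remove:
  assumes "\<And>i. i > k \<Longrightarrow> a i = 0" "a i > 0"
  shows "slot_matchings a = (\<Sum>j\<in>{..k}-{i}. a j * slot_matchings (a(i := a i - 1, j := a j - 1)))"
proof -
  have fin: "finite (slots a)" using assms by (intro finite_slots)
  have v: "(i, 0) \<in> slots a" using assms by (simp add: slots_def)
  have "slot_matchings a =
      (\<Sum>w\<in>{w\<in>slots a. fst w \<noteq> i}. card (bichromatic_matchings (slots a - {(i, 0), w}) fst))"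
    unfolding slot_matchings_def using card_bichromatic_matchings_remove [OF fin v, of fst] by simp
  also have "{w\<in>slots a. fst w \<noteq> i} = (SIGMA j:{..k}-{i}. {..<a j})"
    by (subst slots_eq_Sigma [of k]) (use assms in auto)
  also have "(\<Sum>w\<in>\<dots>. card (bichromatic_matchings (slots a - {(i, 0), w}) fst)) =
      (\<Sum>w\<in>(SIGMA j:{..k}-{i}. {..<a j}). slot_matchings (a(i := a i - 1, fst w := a (fst w) - 1)))"
  proof (rule sum.cong [OF refl])
    fix w assume w: "w \<in> (SIGMA j:{..k}-{i}. {..<a j})"
    then obtain j l where jl: "w = (j, l)" "j \<le> k" "j \<noteq> i" "l < a j" by auto
    show "card (bichromatic_matchings (slots a - {(i, 0), w}) fst) =
        slot_matchings (a(i := a i - 1, fst w := a (fst w) - 1))"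
    proof (rule slot_matchings_eqI [where k = k])
      fix i'
      have "{v \<in> slots a - {(i, 0), w}. fst v = i'} = {v \<in> slots a. fst v = i'} - {(i, 0), w}" by auto
      also have "\<dots> = {i'} \<times> {..<a i'} - {(i, 0), w}" by (simp add: slots_fibre)
      also have "\<dots> = (if i' = i then {i} \<times> {0<..<a i} else if i' = j then {j} \<times> ({..<a j} - {l}) else {i'} \<times> {..<a i'})"
        using jl by auto
      also have "card \<dots> = (a(i := a i - 1, fst w := a (fst w) - 1)) i'"
        using jl by (auto simp: card_cartesian_product)
      finally show "card {v \<in> slots a - {(i, 0), w}. fst v = i'} = (a(i := a i - 1, fst w := a (fst w) - 1)) i'" .
    qed (use fin assms jl in auto)
  qed
  also have "\<dots> = (\<Sum>j\<in>{..k}-{i}. a j * slot_matchings (a(i := a i - 1, j := a j - 1)))"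
    using sum.Sigma [of "{..k} - {i}" "\<lambda>j. {..<a j}" "\<lambda>j _. slot_matchings (a(i := a i - 1, j := a j - 1))"]
    by (simp add: case_prod_unfold)
  finally show ?thesis .
qed

lemma slot_matchings_shift:
  assumes "\<And>i. i > k \<Longrightarrow> a i = 0"
  shows "slot_matchings (case_nat 0 a) = slot_matchings a"
proof -
  have "slot_matchings a = slot_matchings (case_nat 0 a)"
    unfolding slot_matchings_def
  proof (rule card_bichromatic_matchings_bij [where h = "\<lambda>(i, j). (Suc i, j)"])
    show "finite (slots a)" using assms by (intro finite_slots)
    show "bij_betw (\<lambda>(i, j). (Suc i, j)) (slots a) (slots (case_nat 0 a))"
      unfolding bij_betw_def
    proof
      show "(\<lambda>(i, j). (Suc i, j)) ` slots a = slots (case_nat 0 a)"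
        by (auto simp: slots_def image_iff split: nat.splits)
    qed (auto simp: inj_on_def)
  qed auto
  then show ?thesis ..
qed

lemma slot_matchings_transpose:
  assumes "\<And>i. i > k \<Longrightarrow> a i = 0" "p \<le> k" "q \<le> k"
  shows "slot_matchings (a \<circ> Transposition.transpose p q) = slot_matchings a"
  unfolding slot_matchings_def
proof (rule card_bichromatic_matchings_bij [where h = "\<lambda>(i, j). (Transposition.transpose p q i, j)"])
  have "\<And>i. i > k \<Longrightarrow> (a \<circ> Transposition.transpose p q) i = 0"
    using assms by (auto simp: Transposition.transpose_def)
  then show "finite (slots (a \<circ> Transposition.transpose p q))" by (rule finite_slots)
  show "bij_betw (\<lambda>(i, j). (Transposition.transpose p q i, j)) (slots (a \<circ> Transposition.transpose p q)) (slots a)"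
    by (rule bij_betw_byWitness [where f' = "\<lambda>(i, j). (Transposition.transpose p q i, j)"]) (auto simp: slots_def)
qed (auto dest: transpose_eq_imp_eq)

lemma finite_compositions: "finite (compositions k s)"
proof -
  have "compositions k s \<subseteq> {a. \<forall>i. (i \<in> {..k} \<longrightarrow> a i \<in> {..s}) \<and> (i \<notin> {..k} \<longrightarrow> a i = 0)}"
  proof (clarsimp simp: compositions_def)
    fix a :: "nat \<Rightarrow> nat" and i assume "i \<le> k"
    then show "a i \<le> (\<Sum>i\<le>k. a i)" by (intro member_le_sum) auto
  qed
  then show ?thesis using finite_set_of_finite_funs [of "{..k}" "{..s}" 0] finite_subset by blast
qed

text \<open>For \<open>s = 2 * n - 2 * k\<close> this is the number \<open>c(n, k)\<close> of the
  overview, by \<open>card_crystallized_short\<close>.\<close>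

definition composition_matchings :: "nat \<Rightarrow> nat \<Rightarrow> nat" where
  "composition_matchings k s = (\<Sum>a\<in>compositions k s. slot_matchings a)"

lemma compositions_zero: "compositions k 0 = {\<lambda>_. 0}"
proof -
  have "a i = 0" if "a \<in> compositions k 0" for a i
    using that by (cases "i \<le> k") (auto simp: compositions_def)
  then have "a = (\<lambda>_. 0)" if "a \<in> compositions k 0" for a
    using that by (intro ext)
  moreover have "(\<lambda>_. 0) \<in> compositions k 0" by (simp add: compositions_def)
  ultimately show ?thesis by blast
qed

lemma composition_matchings_0_right: "composition_matchings k 0 = 1"
  by (simp add: composition_matchings_def compositions_zero slot_matchings_zero)

lemma composition_matchings_0_left:
  assumes "s > 0" shows "composition_matchings 0 s = 0"
  unfolding composition_matchings_def
proof (rule sum.neutral, rule ballI)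
  fix a assume "a \<in> compositions 0 s"
  then have "\<And>i. i > 0 \<Longrightarrow> a i = 0" "a 0 > 0" using assms by (auto simp: compositions_def)
  then show "slot_matchings a = 0" by (subst slot_matchings_remove [of 0 a 0]) auto
qed

text \<open>Swapping the slots \<open>0\<close> and \<open>j\<close> is an involution of
  \<open>compositions k s\<close> that preserves \<open>slot_matchings\<close>. This symmetry is
  what permits averaging over the slots.\<close>

lemma composition_weight_symmetric:
  assumes "j \<le> k"
  shows "(\<Sum>b\<in>compositions k s. b j * slot_matchings b) = (\<Sum>b\<in>compositions k s. b 0 * slot_matchings b)"
proof (rule sum.reindex_bij_witness [where i = "\<lambda>b. b \<circ> Transposition.transpose 0 j" and j = "\<lambda>b. b \<circ> Transposition.transpose 0 j"])
  fix b assume b: "b \<in> compositions k s"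
  have "(\<Sum>i\<le>k. b (Transposition.transpose 0 j i)) = (\<Sum>i\<le>k. b i)"
    by (rule sum.reindex_bij_witness [where i = "Transposition.transpose 0 j" and j = "Transposition.transpose 0 j"])
       (use assms in \<open>auto simp: Transposition.transpose_def\<close>)
  then show "b \<circ> Transposition.transpose 0 j \<in> compositions k s" "b \<circ> Transposition.transpose 0 j \<in> compositions k s"
    using b assms by (auto simp: compositions_def Transposition.transpose_def)
  show "(b \<circ> Transposition.transpose 0 j) 0 * slot_matchings (b \<circ> Transposition.transpose 0 j) = b j * slot_matchings b"
    using slot_matchings_transpose [of k b 0 j] b assms by (simp add: compositions_def)
qed (auto simp: comp_def)

text \<open>Deleting the empty first slot merges nothing else, so one slot fewer remains; this is
  the source of the term \<open>c(n - 1, k - 1)\<close>.\<close>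

lemma sum_compositions_first_zero:
  "(\<Sum>a\<in>{a\<in>compositions (Suc k) s. a 0 = 0}. slot_matchings a) = composition_matchings k s"
  unfolding composition_matchings_def
proof (rule sum.reindex_bij_witness [where i = "\<lambda>a. case_nat 0 a" and j = "\<lambda>a i. a (Suc i)"])
  fix a assume a: "a \<in> {a \<in> compositions (Suc k) s. a 0 = 0}"
  show eq: "case_nat 0 (\<lambda>i. a (Suc i)) = a" using a by (auto split: nat.splits)
  show "(\<lambda>i. a (Suc i)) \<in> compositions k s"
    using a by (auto simp: compositions_def sum.atMost_Suc_shift simp del: sum.atMost_Suc)
  have "slot_matchings (case_nat 0 (\<lambda>i. a (Suc i))) = slot_matchings (\<lambda>i. a (Suc i))"
    by (rule slot_matchings_shift [of k]) (use a in \<open>auto simp: compositions_def\<close>)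
  then show "slot_matchings (\<lambda>i. a (Suc i)) = slot_matchings a" unfolding eq ..
next
  fix a assume a: "a \<in> compositions k s"
  then show "case_nat 0 a \<in> {a \<in> compositions (Suc k) s. a 0 = 0}"
    by (auto simp: compositions_def sum.atMost_Suc_shift simp del: sum.atMost_Suc split: nat.splits)
qed auto

text \<open>Compositions with \<open>a j = 0\<close> contribute nothing. On the others, lowering the
  entries \<open>0\<close> and \<open>j\<close> by one is a bijection onto
  \<open>compositions k s\<close>, under which \<open>a j\<close> becomes
  \<open>b j + 1\<close>.\<close>

lemma sum_compositions_first_pos:
  assumes "j \<in> {1..k}"
  shows "(\<Sum>a\<in>{a\<in>compositions k (s + 2). a 0 > 0}. a j * slot_matchings (a(0 := a 0 - 1, j := a j - 1))) =
         (\<Sum>b\<in>compositions k s. (b j + 1) * slot_matchings b)"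
proof -
  have split: "(\<Sum>i\<le>k. c i) = c 0 + c j + (\<Sum>i\<in>{..k}-{0,j}. c i)" for c :: "nat \<Rightarrow> nat"
  proof -
    have "(\<Sum>i\<le>k. c i) = (\<Sum>i\<in>{0,j}. c i) + (\<Sum>i\<in>{..k}-{0,j}. c i)"
      using assms by (subst sum.subset_diff [of "{0,j}"]) auto
    then show ?thesis using assms by auto
  qed
  have "(\<Sum>a\<in>{a\<in>compositions k (s + 2). a 0 > 0}. a j * slot_matchings (a(0 := a 0 - 1, j := a j - 1))) =
        (\<Sum>a\<in>{a\<in>compositions k (s + 2). a 0 > 0 \<and> a j > 0}. a j * slot_matchings (a(0 := a 0 - 1, j := a j - 1)))"
    by (rule sum.mono_neutral_right) (auto intro: finite_subset [OF _ finite_compositions])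
  also have "\<dots> = (\<Sum>b\<in>compositions k s. (b j + 1) * slot_matchings b)"
  proof (rule sum.reindex_bij_witness [where i = "\<lambda>b. b(0 := b 0 + 1, j := b j + 1)" and j = "\<lambda>a. a(0 := a 0 - 1, j := a j - 1)"])
    fix a assume a: "a \<in> {a\<in>compositions k (s + 2). a 0 > 0 \<and> a j > 0}"
    show "a(0 := a 0 - 1, j := a j - 1) \<in> compositions k s"
      using a assms split [of a] split [of "a(0 := a 0 - 1, j := a j - 1)"]
      by (auto simp: compositions_def)
  next
    fix a assume a: "a \<in> compositions k s"
    show "a(0 := a 0 + 1, j := a j + 1) \<in> {a\<in>compositions k (s + 2). a 0 > 0 \<and> a j > 0}"
      using a assms split [of a] split [of "a(0 := a 0 + 1, j := a j + 1)"]
      by (auto simp: compositions_def)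
  qed (use assms in \<open>auto simp: fun_eq_iff\<close>)
  finally show ?thesis .
qed

text \<open>Multiplying by \<open>k + 2\<close>, the number of slots, keeps the averaged recurrence
  inside the natural numbers.\<close>

theorem composition_matchings_rec:
  "(k + 2) * composition_matchings (Suc k) (s + 2) =
     (k + 2) * composition_matchings k (s + 2) + (k + 1) * (s + k + 2) * composition_matchings (Suc k) s"
proof -
  let ?K = "Suc k"
  define X where "X = (\<Sum>b\<in>compositions ?K s. b 0 * slot_matchings b)"
  let ?C = "composition_matchings ?K s"
  \<comment> \<open>\<open>X\<close> is the weight of any single slot. Summed over all
    \<open>k + 2\<close> slots, the weights \<open>b j\<close> add up to \<open>s\<close>.\<close>
  have X: "(k + 2) * X = s * ?C"
  proof -
    have "(k + 2) * X = (\<Sum>j\<le>?K. \<Sum>b\<in>compositions ?K s. b j * slot_matchings b)"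
    proof -
      have "(\<Sum>j\<le>?K. \<Sum>b\<in>compositions ?K s. b j * slot_matchings b) = (\<Sum>j\<le>?K. X)"
        unfolding X_def by (intro sum.cong refl composition_weight_symmetric) auto
      then show ?thesis by simp
    qed
    also have "\<dots> = (\<Sum>b\<in>compositions ?K s. (\<Sum>j\<le>?K. b j) * slot_matchings b)"
      by (subst sum.swap) (simp add: sum_distrib_right del: sum.atMost_Suc)
    also have "\<dots> = (\<Sum>b\<in>compositions ?K s. s * slot_matchings b)"
      by (rule sum.cong) (auto simp: compositions_def)
    finally show ?thesis by (simp add: composition_matchings_def sum_distrib_left)
  qed
  have "composition_matchings ?K (s + 2) =
      (\<Sum>a\<in>{a\<in>compositions ?K (s + 2). a 0 = 0}. slot_matchings a) +
      (\<Sum>a\<in>{a\<in>compositions ?K (s + 2). a 0 > 0}. slot_matchings a)"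
    unfolding composition_matchings_def
    by (subst sum.union_disjoint [symmetric])
       (auto intro: finite_subset [OF _ finite_compositions] intro!: sum.cong)
  also have "(\<Sum>a\<in>{a\<in>compositions ?K (s + 2). a 0 > 0}. slot_matchings a) =
      (\<Sum>a\<in>{a\<in>compositions ?K (s + 2). a 0 > 0}. \<Sum>j\<in>{1..?K}. a j * slot_matchings (a(0 := a 0 - 1, j := a j - 1)))"
  proof (rule sum.cong [OF refl])
    fix a assume a: "a \<in> {a\<in>compositions ?K (s + 2). a 0 > 0}"
    have "{..?K} - {0} = {1..?K}" by auto
    then show "slot_matchings a = (\<Sum>j\<in>{1..?K}. a j * slot_matchings (a(0 := a 0 - 1, j := a j - 1)))"
      using slot_matchings_remove [of ?K a 0] a by (auto simp: compositions_def)
  qed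
  also have "\<dots> = (\<Sum>j\<in>{1..?K}. \<Sum>b\<in>compositions ?K s. (b j + 1) * slot_matchings b)"
    by (subst sum.swap) (intro sum.cong refl sum_compositions_first_pos)
  also have "\<dots> = (\<Sum>j\<in>{1..?K}. X + ?C)"
  proof (rule sum.cong [OF refl])
    fix j assume "j \<in> {1..?K}"
    then have "(\<Sum>b\<in>compositions ?K s. b j * slot_matchings b) = X"
      unfolding X_def by (intro composition_weight_symmetric) auto
    then show "(\<Sum>b\<in>compositions ?K s. (b j + 1) * slot_matchings b) = X + ?C"
      by (simp add: algebra_simps sum.distrib composition_matchings_def)
  qed
  also have "\<dots> = (k + 1) * (X + ?C)" by simp
  also have "(\<Sum>a\<in>{a\<in>compositions ?K (s + 2). a 0 = 0}. slot_matchings a) = composition_matchings k (s + 2)"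
    by (rule sum_compositions_first_zero)
  finally have "(k + 2) * composition_matchings ?K (s + 2) =
      (k + 2) * composition_matchings k (s + 2) + (k + 1) * ((k + 2) * X + (k + 2) * ?C)"
    by (simp add: algebra_simps)
  also have "(k + 2) * X + (k + 2) * ?C = (s + k + 2) * ?C" unfolding X by (simp add: algebra_simps)
  finally show ?thesis by (simp only: mult.assoc)
qed

section \<open>From diagrams to compositions\<close>

text \<open>A set of short chords is encoded by the set \<open>S\<close> of the left endpoints.\<close>

definition sparse_sets :: "nat \<Rightarrow> nat \<Rightarrow> nat set set" where
  "sparse_sets L k = {S. S \<subseteq> {1..<L} \<and> card S = k \<and> (\<forall>s\<in>S. Suc s \<notin> S)}"

lemma sparse_setsD:
  assumes "S \<in> sparse_sets L k"
  shows "finite S" "card S = k" "S \<subseteq> {1..<L}" "\<And>s. s \<in> S \<Longrightarrow> Suc s \<notin> S" "\<And>s. s \<in> S \<Longrightarrow> 1 \<le> s \<and> s < L"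
  using assms finite_subset [of S "{1..<L}"] by (auto simp: sparse_sets_def)

text \<open>For an uncovered \<open>v\<close> this counts the short chords to its left. It numbers
  all slots, including empty ones, which are not bubbles.\<close>

definition slot_index :: "nat set \<Rightarrow> nat \<Rightarrow> nat" where
  "slot_index S v = card {s\<in>S. s < v}"

definition uncovered :: "nat \<Rightarrow> nat set \<Rightarrow> nat set" where
  "uncovered L S = {1..L} - S - Suc ` S"

definition slot_sizes :: "nat \<Rightarrow> nat set \<Rightarrow> nat \<Rightarrow> nat" where
  "slot_sizes L S i = card {v\<in>uncovered L S. slot_index S v = i}"

lemma slot_index_le:
  assumes "finite S" shows "slot_index S v \<le> card S"
  unfolding slot_index_def using assms by (intro card_mono) auto

lemma slot_sizes_eq_0:
  assumes "finite S" "i > card S" shows "slot_sizes L S i = 0"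
proof -
  have "slot_index S v \<noteq> i" for v
    using slot_index_le [OF assms(1), of v] assms(2) by simp
  then show ?thesis by (simp add: slot_sizes_def)
qed

text \<open>The slots left of the last short chord \<open>{s, Suc s}\<close> are those of
  \<open>S\<close> on the line \<open>{1..s - 1}\<close>; the last slot is
  \<open>{s + 2..L}\<close>, of size \<open>L - s - 1\<close>.\<close>

lemma slot_sizes_insert_last:
  assumes S: "S \<in> sparse_sets (s - 1) k" and s: "1 \<le> s" "s < L"
  shows "slot_sizes L (insert s S) = (slot_sizes (s - 1) S)(Suc k := L - s - 1)"
proof
  fix i
  note fin = sparse_setsD(1) [OF S] and card = sparse_setsD(2) [OF S]
  have lt: "1 \<le> t \<and> Suc t < s" if "t \<in> S" for t
    using sparse_setsD(5) [OF S that] by auto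
  have "s \<notin> S" using lt [of s] by auto
  have unc: "uncovered L (insert s S) = uncovered (s - 1) S \<union> {s + 2..L}"
  proof -
    have "v \<in> uncovered L (insert s S) \<longleftrightarrow> v \<in> uncovered (s - 1) S \<union> {s + 2..L}" for v
    proof (cases "v < s")
      case True
      then show ?thesis using s by (auto simp: uncovered_def)
    next
      case False
      then have "v \<notin> S" using lt [of v] by auto
      moreover have "v \<notin> Suc ` S"
      proof
        assume "v \<in> Suc ` S"
        then obtain t where "t \<in> S" "v = Suc t" by blast
        then show False using lt [of t] False by simp
      qed
      ultimately      show ?thesis using False s by (auto simp: uncovered_def)
    qed
    then show ?thesis by blast
  qed
  have idx1: "slot_index (insert s S) v = slot_index S v" if "v < s" for v
    unfolding slot_index_def using that by (intro arg_cong [where f = card]) auto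
  have idx2: "slot_index (insert s S) v = Suc k" if "v > s" for v
  proof -
    have "{t \<in> insert s S. t < v} = insert s S" using that lt by force
    then show ?thesis using card fin \<open>s \<notin> S\<close> by (simp add: slot_index_def)
  qed
  have "{v\<in>uncovered L (insert s S). slot_index (insert s S) v = i} =
        {v\<in>uncovered (s - 1) S. slot_index S v = i} \<union> (if i = Suc k then {s + 2..L} else {})"
  proof (intro equalityI subsetI)
    fix v assume v: "v \<in> {v\<in>uncovered L (insert s S). slot_index (insert s S) v = i}"
    show "v \<in> {v\<in>uncovered (s - 1) S. slot_index S v = i} \<union> (if i = Suc k then {s + 2..L} else {})"
      using v idx1 [of v] idx2 [of v] s unfolding unc by (cases "v < s") (auto simp: uncovered_def)
  next
    fix v assume v: "v \<in> {v\<in>uncovered (s - 1) S. slot_index S v = i} \<union> (if i = Suc k then {s + 2..L} else {})"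
    show "v \<in> {v\<in>uncovered L (insert s S). slot_index (insert s S) v = i}"
      using v idx1 [of v] idx2 [of v] s unfolding unc by (cases "v < s") (auto simp: uncovered_def split: if_splits)
  qed
  moreover have "card \<dots> = card {v\<in>uncovered (s - 1) S. slot_index S v = i} + card (if i = Suc k then {s + 2..L} else {})"
    by (intro card_Un_disjoint) (auto simp: uncovered_def)
  ultimately have "slot_sizes L (insert s S) i = slot_sizes (s - 1) S i + (if i = Suc k then L - s - 1 else 0)"
    by (simp add: slot_sizes_def)
  moreover have "slot_sizes (s - 1) S (Suc k) = 0"
    using slot_sizes_eq_0 fin card by simp
  ultimately show "slot_sizes L (insert s S) i = ((slot_sizes (s - 1) S)(Suc k := L - s - 1)) i"
    by auto
qed

lemma sparse_sets_Suc_cases: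
  assumes "S \<in> sparse_sets L (Suc k)"
  obtains s S' where "S = insert s S'" "1 \<le> s" "s < L" "S' \<in> sparse_sets (s - 1) k"
proof
  have fin: "finite S" and ne: "S \<noteq> {}" using assms by (auto simp: sparse_sets_def intro: finite_subset)
  let ?s = "Max S"
  have in_S: "?s \<in> S" using fin ne by simp
  show "S = insert ?s (S - {?s})" using in_S by auto
  show "1 \<le> ?s" "?s < L" using in_S assms by (auto simp: sparse_sets_def)
  have "Suc t < ?s" if "t \<in> S - {?s}" for t
  proof -
    have "t \<le> ?s" using that fin by simp
    moreover have "Suc t \<noteq> ?s" using that in_S assms by (auto simp: sparse_sets_def)
    ultimately show ?thesis using that by auto
  qed
  then show "S - {?s} \<in> sparse_sets (?s - 1) k"
    using assms in_S fin by (force simp: sparse_sets_def)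
qed

lemma sparse_sets_insert:
  assumes "S \<in> sparse_sets (s - 1) k" "1 \<le> s" "s < L"
  shows "insert s S \<in> sparse_sets L (Suc k)"
proof -
  note fin = sparse_setsD(1) [OF assms(1)]
  have lt: "1 \<le> t \<and> Suc t < s" if "t \<in> S" for t
    using sparse_setsD(5) [OF assms(1) that] by auto
  have "s \<notin> S" "Suc s \<notin> S" using lt [of s] lt [of "Suc s"] by auto
  moreover have "Suc t \<noteq> s" if "t \<in> S" for t using lt [OF that] by simp
  moreover have "t < L" if "t \<in> S" for t using lt [OF that] assms(3) by simp
  ultimately show ?thesis
    using sparse_setsD [OF assms(1)] assms by (auto simp: sparse_sets_def)
qed

lemma sparse_sets_0: "sparse_sets L 0 = {{}}"
proof -
  have "S = {}" if "S \<in> sparse_sets L 0" for S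
    using sparse_setsD(1,2) [OF that] by simp
  moreover have "{} \<in> sparse_sets L 0" by (simp add: sparse_sets_def)
  ultimately show ?thesis by blast
qed

text \<open>The \<open>k\<close> pairs are disjoint, so they cover \<open>2 * k\<close> of the
  \<open>L\<close> vertices.\<close>

lemma sparse_sets_empty:
  assumes "L < 2 * k" shows "sparse_sets L k = {}"
proof (rule equals0I)
  fix S assume "S \<in> sparse_sets L k"
  then have *: "S \<subseteq> {1..<L}" "card S = k" "\<And>s. s \<in> S \<Longrightarrow> Suc s \<notin> S" using sparse_setsD by blast+
  then have fin: "finite S" using finite_subset by blast
  have "card (S \<union> Suc ` S) = card S + card (Suc ` S)"
    using fin * by (intro card_Un_disjoint) auto
  also have "\<dots> = 2 * k" using * by (simp add: card_image)
  finally have "2 * k = card (S \<union> Suc ` S)" ..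
  also have "\<dots> \<le> card {1..L}" using * by (intro card_mono) auto
  finally show False using assms by simp
qed

text \<open>Induction on \<open>k\<close> by removing the last short chord: the size of the last
  slot determines the position of this chord, and the other slots are handled by the hypothesis on
  the shortened line.\<close>

lemma bij_betw_slot_sizes:
  assumes "2 * k \<le> L"
  shows "bij_betw (slot_sizes L) (sparse_sets L k) (compositions k (L - 2 * k))"
  using assms
proof (induction k arbitrary: L)
  case 0
  have "slot_sizes L {} = (\<lambda>i. if i = 0 then L else 0)"
  proof
    fix i
    have "{v\<in>uncovered L {}. slot_index {} v = i} = (if i = 0 then {1..L} else {})"
      by (auto simp: slot_index_def uncovered_def)
    then show "slot_sizes L {} i = (if i = 0 then L else 0)" by (simp add: slot_sizes_def)
  qed
  moreover have "compositions 0 L = {\<lambda>i. if i = 0 then L else 0}"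
    by (auto simp: compositions_def fun_eq_iff)
  ultimately show ?case by (simp add: sparse_sets_0 bij_betw_def)
next
  case (Suc k)
  let ?upd = "\<lambda>s S. (slot_sizes (s - 1) S)(Suc k := L - s - 1)"
  have IH: "bij_betw (slot_sizes M) (sparse_sets M k) (compositions k (M - 2 * k))" if "2 * k \<le> M" for M
    using Suc.IH that .
  have big: "2 * k \<le> M" if "S \<in> sparse_sets M k" for S M
    using sparse_sets_empty [of M k] that by (cases "M < 2 * k") auto
  have zero: "slot_sizes (s - 1) S (Suc k) = 0" if "S \<in> sparse_sets (s - 1) k" for s S
    using that by (intro slot_sizes_eq_0) (auto simp: sparse_sets_def intro: finite_subset)
  show ?case
    unfolding bij_betw_def
  proof
    show "inj_on (slot_sizes L) (sparse_sets L (Suc k))"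
    proof (rule inj_onI)
      fix S T assume S: "S \<in> sparse_sets L (Suc k)" and T: "T \<in> sparse_sets L (Suc k)"
        and eq: "slot_sizes L S = slot_sizes L T"
      obtain s S' where S': "S = insert s S'" "1 \<le> s" "s < L" "S' \<in> sparse_sets (s - 1) k"
        using S by (rule sparse_sets_Suc_cases)
      obtain t T' where T': "T = insert t T'" "1 \<le> t" "t < L" "T' \<in> sparse_sets (t - 1) k"
        using T by (rule sparse_sets_Suc_cases)
      have eq': "?upd s S' = ?upd t T'"
        using eq S' T' by (simp add: slot_sizes_insert_last)
      have "s = t" using fun_cong [OF eq', of "Suc k"] S' T' by simp
      have "slot_sizes (s - 1) S' i = slot_sizes (s - 1) T' i" for i
        using fun_cong [OF eq', of i] zero S'(4) T'(4) by (cases "i = Suc k") (auto simp: \<open>s = t\<close>)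
      then have "slot_sizes (s - 1) S' = slot_sizes (s - 1) T'" ..
      then have "S' = T'"
        using bij_betw_imp_inj_on [OF IH [of "s - 1"]] big [OF S'(4)] S'(4) T'(4)
        by (auto simp: \<open>s = t\<close> dest: inj_onD)
      then show "S = T" using S' T' \<open>s = t\<close> by simp
    qed
    show "slot_sizes L ` sparse_sets L (Suc k) = compositions (Suc k) (L - 2 * Suc k)"
    proof (intro equalityI subsetI)
      fix a assume "a \<in> slot_sizes L ` sparse_sets L (Suc k)"
      then obtain S where S: "S \<in> sparse_sets L (Suc k)" "a = slot_sizes L S" by auto
      obtain s S' where S': "S = insert s S'" "1 \<le> s" "s < L" "S' \<in> sparse_sets (s - 1) k"
        using S(1) by (rule sparse_sets_Suc_cases)
      have "2 * k \<le> s - 1" using big S' by blast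
      then have "slot_sizes (s - 1) S' \<in> compositions k (s - 1 - 2 * k)"
        using bij_betw_imp_surj_on [OF IH] S'(4) by blast
      moreover have "a = ?upd s S'" using S S' by (simp add: slot_sizes_insert_last)
      ultimately show "a \<in> compositions (Suc k) (L - 2 * Suc k)"
        using \<open>2 * k \<le> s - 1\<close> S' by (auto simp: compositions_def)
    next
      fix a assume a: "a \<in> compositions (Suc k) (L - 2 * Suc k)"
      \<comment> \<open>The unique position for which the last slot \<open>{s + 2..L}\<close> has
        size \<open>a (Suc k)\<close>.\<close>
      define s where "s = L - 1 - a (Suc k)"
      have sum: "(\<Sum>i\<le>k. a i) + a (Suc k) = L - 2 * Suc k" and z: "\<And>i. i > Suc k \<Longrightarrow> a i = 0"
        using a by (auto simp: compositions_def)
      have s: "1 \<le> s" "s < L" "2 * k \<le> s - 1" "a (Suc k) = L - s - 1"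
        using sum Suc.prems by (auto simp: s_def)
      have "a(Suc k := 0) \<in> compositions k (s - 1 - 2 * k)"
        using sum s z Suc.prems by (auto simp: compositions_def)
      then obtain S' where S': "S' \<in> sparse_sets (s - 1) k" "slot_sizes (s - 1) S' = a(Suc k := 0)"
        using bij_betw_imp_surj_on [OF IH [OF s(3)]] by (metis imageE)
      have "slot_sizes L (insert s S') = a"
        using S' s by (auto simp: slot_sizes_insert_last fun_eq_iff)
      moreover have "insert s S' \<in> sparse_sets L (Suc k)"
        using S' s by (intro sparse_sets_insert)
      ultimately show "a \<in> slot_sizes L ` sparse_sets L (Suc k)" by blast
    qed
  qed
qed

lemma sum_sparse_sets_matchings:
  assumes "2 * k \<le> L"
  shows "(\<Sum>S\<in>sparse_sets L k. card (bichromatic_matchings (uncovered L S) (slot_index S))) =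
         composition_matchings k (L - 2 * k)"
proof -
  have "(\<Sum>S\<in>sparse_sets L k. card (bichromatic_matchings (uncovered L S) (slot_index S))) =
        (\<Sum>S\<in>sparse_sets L k. slot_matchings (slot_sizes L S))"
  proof (rule sum.cong [OF refl], rule slot_matchings_eqI [where k = k])
    fix S i assume S: "S \<in> sparse_sets L k"
    show "slot_sizes L S i = 0" if "i > k"
      using S that by (intro slot_sizes_eq_0) (auto simp: sparse_sets_def intro: finite_subset)
  qed (auto simp: uncovered_def slot_sizes_def)
  also have "\<dots> = composition_matchings k (L - 2 * k)"
    unfolding composition_matchings_def by (rule sum.reindex_bij_betw [OF bij_betw_slot_sizes [OF assms]])
  finally show ?thesis .
qed

section \<open>Diagrams as short chords together with a matching of the other vertices\<close>

definition short_pairs :: "nat set \<Rightarrow> nat set set" where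
  "short_pairs S = (\<lambda>s. {s, Suc s}) ` S"

lemma pair_Suc_eq_iff: "{s, Suc s} = {t, Suc t} \<longleftrightarrow> s = t"
  by (auto simp: doubleton_eq_iff)

lemma card_short_pairs: "card (short_pairs S) = card S"
  unfolding short_pairs_def by (rule card_image) (auto simp: inj_on_def pair_Suc_eq_iff)

lemma Union_short_pairs: "\<Union>(short_pairs S) = S \<union> Suc ` S"
  by (auto simp: short_pairs_def)

lemma inj_short_pairs: "short_pairs S = short_pairs T \<Longrightarrow> S = T"
  using inj_image_eq_iff [of "\<lambda>s. {s, Suc s}" S T] by (simp add: short_pairs_def inj_def pair_Suc_eq_iff)

lemma slot_index_eq_iff:
  assumes "finite S" "p \<le> q"
  shows "slot_index S p = slot_index S q \<longleftrightarrow> (\<forall>s\<in>S. \<not> (p \<le> s \<and> s < q))"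
proof -
  have sub: "{s\<in>S. s < p} \<subseteq> {s\<in>S. s < q}" using assms by auto
  have "slot_index S p = slot_index S q \<longleftrightarrow> {s\<in>S. s < p} = {s\<in>S. s < q}"
    unfolding slot_index_def using sub card_subset_eq [of "{s\<in>S. s < q}" "{s\<in>S. s < p}"] assms by auto
  also have "\<dots> \<longleftrightarrow> (\<forall>s\<in>S. \<not> (p \<le> s \<and> s < q))" proof -
    have "(s < p \<longleftrightarrow> s < q) \<longleftrightarrow> \<not> (p \<le> s \<and> s < q)" for s using assms by auto
    then show ?thesis by blast
  qed
  finally show ?thesis .
qed

text \<open>Connects the numbering of slots with the definition of bubbles. If no short chord lies
  between \<open>p\<close> and \<open>q\<close>, extending \<open>{p..q}\<close> to the nearest
  short chords or to the ends of the line gives a bubble.\<close>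

lemma same_slot_iff_bubble:
  assumes S: "S \<subseteq> {1..<2 * n}" "short_chords D = short_pairs S"
    and pq: "p \<in> uncovered (2 * n) S" "q \<in> uncovered (2 * n) S" "p \<le> q"
  shows "slot_index S p = slot_index S q \<longleftrightarrow> (\<exists>B\<in>bubbles n D. {p, q} \<subseteq> B)"
proof
  have fin: "finite S" using S finite_subset by blast
  have U: "\<Union>(short_chords D) = S \<union> Suc ` S" by (simp add: S Union_short_pairs)
  {
    assume "slot_index S p = slot_index S q"
    then have no: "\<And>s. s \<in> S \<Longrightarrow> p \<le> s \<Longrightarrow> s < q \<Longrightarrow> False"
      using slot_index_eq_iff [OF fin pq(3)] by blast
    \<comment> \<open>The nearest chord on the left occupies its left endpoint and the next vertex,
      hence \<open>+ 2\<close>. The nearest chord on the right starts at the minimum used for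
      \<open>b\<close>, so the bubble ends one vertex earlier.\<close>
    define a where "a = (if {s\<in>S. s < p} = {} then 1 else Max {s\<in>S. s < p} + 2)"
    define b where "b = (if {s\<in>S. q \<le> s} = {} then 2 * n else Min {s\<in>S. q \<le> s} - 1)"
    have a: "1 \<le> a" "a \<le> p" "a = 1 \<or> a - 1 \<in> S \<union> Suc ` S" "\<And>s. s \<in> S \<Longrightarrow> s < p \<Longrightarrow> Suc s < a"
    proof -
      show "a = 1 \<or> a - 1 \<in> S \<union> Suc ` S"
        using Max_in [of "{s\<in>S. s < p}"] fin by (auto simp: a_def)
      show "a \<le> p"
      proof (cases "{s\<in>S. s < p} = {}")
        case False
        then have "Max {s\<in>S. s < p} \<in> {s\<in>S. s < p}" using fin by (intro Max_in) auto
        moreover from this have "Suc (Max {s\<in>S. s < p}) \<noteq> p" using pq(1) unfolding uncovered_def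
          by (metis (no_types, lifting) DiffD2 imageI mem_Collect_eq)
        ultimately have "Max {s\<in>S. s < p} + 2 \<le> p" by simp
        then show ?thesis using False by (simp add: a_def)
      qed (use pq in \<open>auto simp: a_def uncovered_def\<close>)
      show "Suc s < a" if "s \<in> S" "s < p" for s
      proof -
        have "s \<le> Max {s\<in>S. s < p}" using that fin by (intro Max_ge) auto
        moreover have "a = Max {s\<in>S. s < p} + 2" using that unfolding a_def by auto
        ultimately show ?thesis by linarith
      qed
    qed (auto simp: a_def)
    have b: "q \<le> b" "b \<le> 2 * n" "b = 2 * n \<or> b + 1 \<in> S \<union> Suc ` S" "\<And>s. s \<in> S \<Longrightarrow> q \<le> s \<Longrightarrow> b < s"
    proof -
      have M: "Min {s\<in>S. q \<le> s} \<in> S" "q < Min {s\<in>S. q \<le> s}" "Min {s\<in>S. q \<le> s} < 2 * n" if "{s\<in>S. q \<le> s} \<noteq> {}"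
      proof -
        have "Min {s\<in>S. q \<le> s} \<in> {s\<in>S. q \<le> s}" using that fin by (intro Min_in) auto
        moreover from this have "Min {s\<in>S. q \<le> s} \<noteq> q" using pq by (auto simp: uncovered_def)
        ultimately show "Min {s\<in>S. q \<le> s} \<in> S" "q < Min {s\<in>S. q \<le> s}" "Min {s\<in>S. q \<le> s} < 2 * n"
          using S by auto
      qed
      show "q \<le> b" "b \<le> 2 * n" "b = 2 * n \<or> b + 1 \<in> S \<union> Suc ` S"
      proof (atomize (full), cases "{s\<in>S. q \<le> s} = {}")
        case True
        then have "b = 2 * n" unfolding b_def by (rule if_P)
        then show "q \<le> b \<and> b \<le> 2 * n \<and> (b = 2 * n \<or> b + 1 \<in> S \<union> Suc ` S)"
          using pq by (simp add: uncovered_def)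
      next
        case False
        then have "b = Min {s\<in>S. q \<le> s} - 1" unfolding b_def by (rule if_not_P)
        with M(2) [OF False] have "b + 1 = Min {s\<in>S. q \<le> s}" by linarith
        with M [OF False] show "q \<le> b \<and> b \<le> 2 * n \<and> (b = 2 * n \<or> b + 1 \<in> S \<union> Suc ` S)"
          by (metis UnI1 add.commute less_Suc_eq_le not_less_eq_eq plus_1_eq_Suc order_less_imp_le Suc_le_eq)
      qed
      show "b < s" if "s \<in> S" "q \<le> s" for s
      proof -
        have ne: "{s\<in>S. q \<le> s} \<noteq> {}" using that by blast
        then have "b = Min {s\<in>S. q \<le> s} - 1" unfolding b_def by (rule if_not_P)
        moreover have "Min {s\<in>S. q \<le> s} \<le> s" using that fin by (intro Min_le) auto
        ultimately show ?thesis using M(2) [OF ne] by linarith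
      qed
    qed
    have "{a..b} \<inter> (S \<union> Suc ` S) = {}"
    proof -
      have "s \<notin> {a..b} \<and> Suc s \<notin> {a..b}" if "s \<in> S" for s
      proof (cases "s < p")
        case True then show ?thesis using a(4) [OF that] by auto
      next
        case False
        then have "q \<le> s" using no [OF that] by (meson not_le)
        then show ?thesis using b(4) [OF that] by auto
      qed
      then show ?thesis by blast
    qed
    then have "{a..b} \<in> bubbles n D"
      unfolding bubbles_def U using a b pq(3) by auto
    moreover have "{p, q} \<subseteq> {a..b}" using a b pq(3) by auto
    ultimately show "\<exists>B\<in>bubbles n D. {p, q} \<subseteq> B" by blast
  }
  {
    assume "\<exists>B\<in>bubbles n D. {p, q} \<subseteq> B"
    then obtain a b where "{p, q} \<subseteq> {a..b}" "{a..b} \<inter> (S \<union> Suc ` S) = {}"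
      unfolding bubbles_def U by auto
    then have "\<forall>s\<in>S. \<not> (p \<le> s \<and> s < q)" by (force simp: disjoint_iff)
    then show "slot_index S p = slot_index S q" using slot_index_eq_iff [OF fin pq(3)] by blast
  }
qed

text \<open>The point is that \<open>D'\<close> creates no further short chord: two adjacent
  uncovered vertices lie in the same slot, while chords of \<open>D'\<close> join different slots.
  So \<open>S\<close> can be recovered from \<open>D\<close>.\<close>

lemma crystallized_of_matching:
  assumes S: "S \<in> sparse_sets (2 * n) k" and D': "D' \<in> bichromatic_matchings (uncovered (2 * n) S) (slot_index S)"
  defines "D \<equiv> short_pairs S \<union> D'"
  shows "D \<in> crystallized_diagrams n" "short_chords D = short_pairs S" "D - short_pairs S = D'"
proof -
  have S': "S \<subseteq> {1..<2 * n}" "card S = k" "\<And>s. s \<in> S \<Longrightarrow> Suc s \<notin> S"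
    using S by (auto simp: sparse_sets_def)
  have fin: "finite S" using S' finite_subset by blast
  have pD': "partition_on (uncovered (2 * n) S) D'"
    and bi: "\<And>c. c \<in> D' \<Longrightarrow> \<exists>p q. c = {p, q} \<and> slot_index S p \<noteq> slot_index S q"
    using D' by (auto simp: bichromatic_matchings_def)
  have sub: "c \<subseteq> uncovered (2 * n) S" if "c \<in> D'" for c
    using pD' that by (auto simp: partition_on_def)
  have not_short: "c \<noteq> {i, Suc i}" if "c \<in> D'" for c i
  proof
    assume c: "c = {i, Suc i}"
    have "slot_index S i = slot_index S (Suc i)"
    proof -
      have "i \<notin> S" using sub [OF that] c by (auto simp: uncovered_def)
      then have "\<forall>s\<in>S. \<not> (i \<le> s \<and> s < Suc i)" using le_antisym by fastforce
      then show ?thesis using slot_index_eq_iff [OF fin, of i "Suc i"] by simp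
    qed
    then show False using bi [OF that] c by (auto simp: doubleton_eq_iff)
  qed
  show sc: "short_chords D = short_pairs S"
    unfolding short_chords_def D_def using not_short by (auto simp: short_pairs_def)
  show "D - short_pairs S = D'"
    unfolding D_def using not_short by (auto simp: short_pairs_def)
  have pS: "partition_on (S \<union> Suc ` S) (short_pairs S)"
    unfolding partition_on_def
  proof (intro conjI)
    show "disjoint (short_pairs S)"
      unfolding disjoint_def short_pairs_def using S'(3) by auto
  qed (auto simp: short_pairs_def)
  have "partition_on (S \<union> Suc ` S \<union> uncovered (2 * n) S) D"
  proof -
    have "c \<inter> d = {}" if "c \<in> short_pairs S" "d \<in> D'" for c d
      using sub [OF that(2)] that(1) by (auto simp: short_pairs_def uncovered_def)
    then show ?thesis
      using pS pD' unfolding D_def partition_on_def by (auto intro!: disjoint_union)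
  qed
  moreover have "S \<union> Suc ` S \<union> uncovered (2 * n) S = {1..2 * n}"
  proof -
    have "s \<in> {1..2 * n} \<and> Suc s \<in> {1..2 * n}" if "s \<in> S" for s
      using subsetD [OF S'(1) that] by auto
    then have "S \<union> Suc ` S \<subseteq> {1..2 * n}" by blast
    then show ?thesis unfolding uncovered_def by blast
  qed
  moreover have "card c = 2" if "c \<in> D" for c
  proof (cases "c \<in> D'")
    case True
    then obtain p q where "c = {p, q}" "slot_index S p \<noteq> slot_index S q" using bi by blast
    then show ?thesis by (auto simp: card_2_iff)
  qed (use that in \<open>auto simp: D_def short_pairs_def\<close>)
  ultimately have cd: "D \<in> chord_diagrams n" by (simp add: chord_diagrams_def)
  have "empty_bubble D B" if B: "B \<in> bubbles n D" for B
    unfolding empty_bubble_def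
  proof
    assume "\<exists>c\<in>D. c \<subseteq> B"
    then obtain c where c: "c \<in> D" "c \<subseteq> B" by blast
    have "B \<inter> \<Union>(short_pairs S) = {}" using B by (auto simp: bubbles_def sc)
    then have "c \<in> D'" using c by (auto simp: D_def short_pairs_def)
    then obtain p q where pq: "c = {p, q}" "slot_index S p \<noteq> slot_index S q" using bi by blast
    have in_u: "p \<in> uncovered (2 * n) S" "q \<in> uncovered (2 * n) S" using sub [OF \<open>c \<in> D'\<close>] pq by auto
    consider "p \<le> q" | "q \<le> p" by linarith
    then show False
    proof cases
      case 1
      then show False using same_slot_iff_bubble [OF S'(1) sc in_u 1] pq c B by auto
    next
      case 2
      then show False using same_slot_iff_bubble [OF S'(1) sc in_u(2) in_u(1) 2] pq c B by auto
    qed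
  qed
  then show "D \<in> crystallized_diagrams n" using cd by (simp add: crystallized_diagrams_def)
qed

text \<open>The converse: a chord with both ends in one slot would lie in a bubble by
  \<open>same_slot_iff_bubble\<close>, contradicting emptiness.\<close>

lemma matching_of_crystallized:
  assumes D: "D \<in> crystallized_diagrams n"
  obtains S D' where "S \<in> sparse_sets (2 * n) (card (short_chords D))"
    "D' \<in> bichromatic_matchings (uncovered (2 * n) S) (slot_index S)" "D = short_pairs S \<union> D'"
proof
  define S where "S = {s. {s, Suc s} \<in> D}"
  have part: "partition_on {1..2 * n} D" and two: "\<And>c. c \<in> D \<Longrightarrow> card c = 2"
    and bub: "\<And>B. B \<in> bubbles n D \<Longrightarrow> empty_bubble D B"
    using D by (auto simp: crystallized_diagrams_def chord_diagrams_def)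
  have sc: "short_chords D = short_pairs S"
    by (auto simp: short_chords_def short_pairs_def S_def)
  have disj: "c = d" if "c \<in> D" "d \<in> D" "x \<in> c" "x \<in> d" for c d x
    using part that by (auto simp: partition_on_def disjoint_def)
  have sub: "S \<subseteq> {1..<2 * n}"
  proof
    fix s assume "s \<in> S"
    then have "{s, Suc s} \<subseteq> {1..2 * n}" using part by (auto simp: S_def partition_on_def)
    then show "s \<in> {1..<2 * n}" by auto
  qed
  have "Suc s \<notin> S" if "s \<in> S" for s
  proof
    assume "Suc s \<in> S"
    then have "{s, Suc s} = {Suc s, Suc (Suc s)}"
      using that by (intro disj [of _ _ "Suc s"]) (auto simp: S_def)
    then show False by (simp add: pair_Suc_eq_iff)
  qed
  then show "S \<in> sparse_sets (2 * n) (card (short_chords D))"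
    using sub by (auto simp: sparse_sets_def sc card_short_pairs)
  show "D = short_pairs S \<union> (D - short_pairs S)"
    by (auto simp: short_pairs_def S_def)
  have "partition_on ({1..2 * n} - (S \<union> Suc ` S)) (D - short_pairs S)"
  proof -
    have "short_pairs S \<subseteq> D" by (auto simp: short_pairs_def S_def)
    have "\<Union>(D - short_pairs S) = \<Union>D - \<Union>(short_pairs S)"
    proof (intro equalityI subsetI)
      fix x assume "x \<in> \<Union>(D - short_pairs S)"
      then obtain c where c: "c \<in> D" "c \<notin> short_pairs S" "x \<in> c" by blast
      have "x \<notin> \<Union>(short_pairs S)"
      proof
        assume "x \<in> \<Union>(short_pairs S)"
        then obtain d where "d \<in> short_pairs S" "x \<in> d" by blast
        then show False using disj [of c d x] c \<open>short_pairs S \<subseteq> D\<close> by blast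
      qed
      then show "x \<in> \<Union>D - \<Union>(short_pairs S)" using c by blast
    qed blast
    then show ?thesis
      using part by (auto simp: partition_on_def Union_short_pairs disjoint_def)
  qed
  then have p: "partition_on (uncovered (2 * n) S) (D - short_pairs S)"
    by (simp add: uncovered_def Diff_Diff_Int Diff_eq Int_assoc)
  have "\<exists>p q. c = {p, q} \<and> slot_index S p \<noteq> slot_index S q" if c: "c \<in> D - short_pairs S" for c
  proof -
    obtain p q where pq: "c = {p, q}" "p < q"
      using two [of c] c by (auto simp: card_2_iff) (metis insert_commute linorder_neqE_nat)
    have "p \<in> uncovered (2 * n) S" "q \<in> uncovered (2 * n) S"
      using p c pq by (auto simp: partition_on_def)
    then have "slot_index S p = slot_index S q \<longleftrightarrow> (\<exists>B\<in>bubbles n D. {p, q} \<subseteq> B)"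
      using same_slot_iff_bubble [OF sub sc, of p q] pq by simp
    moreover have "\<not> (\<exists>B\<in>bubbles n D. {p, q} \<subseteq> B)"
      using bub c pq by (meson DiffD1 empty_bubble_def)
    ultimately show ?thesis using pq by blast
  qed
  then show "D - short_pairs S \<in> bichromatic_matchings (uncovered (2 * n) S) (slot_index S)"
    using p by (auto simp: bichromatic_matchings_def)
qed

text \<open>A diagram determines \<open>S\<close> through its short chords and \<open>D'\<close> as
  its remaining chords, so the union over \<open>S\<close> is disjoint and each \<open>D'\<close>
  counts once. Summing over \<open>S\<close> becomes summing over slot sizes.\<close>

theorem card_crystallized_short:
  "card {D\<in>crystallized_diagrams n. card (short_chords D) = k} =
     (if k \<le> n then composition_matchings k (2 * n - 2 * k) else 0)"
proof -
  let ?M = "\<lambda>S. bichromatic_matchings (uncovered (2 * n) S) (slot_index S)"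
  have eq: "{D\<in>crystallized_diagrams n. card (short_chords D) = k} =
      (\<Union>S\<in>sparse_sets (2 * n) k. (\<lambda>D'. short_pairs S \<union> D') ` ?M S)" (is "?L = ?R")
  proof (intro equalityI subsetI)
    fix D assume "D \<in> ?L"
    then show "D \<in> ?R" using matching_of_crystallized [of D n] by blast
  next
    fix D assume "D \<in> ?R"
    then obtain S D' where "S \<in> sparse_sets (2 * n) k" "D' \<in> ?M S" "D = short_pairs S \<union> D'" by blast
    then show "D \<in> ?L"
      using crystallized_of_matching [of S n k D'] by (simp add: card_short_pairs) (simp add: sparse_sets_def)
  qed
  have fin: "finite (sparse_sets (2 * n) k)"
    by (rule finite_subset [of _ "Pow {1..<2 * n}"]) (auto simp: sparse_sets_def)
  have "card ?L = (\<Sum>S\<in>sparse_sets (2 * n) k. card ((\<lambda>D'. short_pairs S \<union> D') ` ?M S))"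
    unfolding eq
  proof (rule card_UN_disjoint [OF fin])
    show "\<forall>S\<in>sparse_sets (2 * n) k. finite ((\<lambda>D'. short_pairs S \<union> D') ` ?M S)"
      by (auto intro!: finite_bichromatic_matchings simp: uncovered_def)
    show "\<forall>S\<in>sparse_sets (2 * n) k. \<forall>T\<in>sparse_sets (2 * n) k. S \<noteq> T \<longrightarrow>
        (\<lambda>D'. short_pairs S \<union> D') ` ?M S \<inter> (\<lambda>D'. short_pairs T \<union> D') ` ?M T = {}"
    proof (intro ballI impI equals0I)
      fix S T D assume S: "S \<in> sparse_sets (2 * n) k" and T: "T \<in> sparse_sets (2 * n) k" and "S \<noteq> T"
        and "D \<in> (\<lambda>D'. short_pairs S \<union> D') ` ?M S \<inter> (\<lambda>D'. short_pairs T \<union> D') ` ?M T"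
      then have "short_chords D = short_pairs S" "short_chords D = short_pairs T"
        by (auto simp: crystallized_of_matching(2) [OF S] crystallized_of_matching(2) [OF T])
      then show False using \<open>S \<noteq> T\<close> inj_short_pairs [of S T] by simp
    qed
  qed
  also have "\<dots> = (\<Sum>S\<in>sparse_sets (2 * n) k. card (?M S))"
  proof (rule sum.cong [OF refl], rule card_image, rule inj_onI)
    fix S D' E' assume "S \<in> sparse_sets (2 * n) k" "D' \<in> ?M S" "E' \<in> ?M S" "short_pairs S \<union> D' = short_pairs S \<union> E'"
    then show "D' = E'" using crystallized_of_matching(3) by metis
  qed
  also have "\<dots> = (if k \<le> n then composition_matchings k (2 * n - 2 * k) else 0)"
    using sum_sparse_sets_matchings [of k "2 * n"] sparse_sets_empty [of "2 * n" k] by auto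
  finally show ?thesis .
qed

section \<open>The exponential generating function\<close>

text \<open>The factor \<open>k / (k + 1)\<close> of the recurrence, with the index shifted by one
  because the recurrence will be stated for \<open>Suc k\<close>.\<close>

definition bridge_ratio :: "nat \<Rightarrow> real" where
  "bridge_ratio k = (real k + 1) / (real k + 2)"

lemma bridge_ratio_bounds: "0 < bridge_ratio k" "bridge_ratio k < 1"
  by (auto simp: bridge_ratio_def)

text \<open>\<open>bridge_coeff k j\<close> is \<open>c(n, k)\<close> for \<open>j = 2n - k\<close>, the number of objects on the line when a short chord
  counts as one object. For the other parity of \<open>j\<close> it vanishes.\<close>

fun bridge_coeff :: "nat \<Rightarrow> nat \<Rightarrow> real" where
  "bridge_coeff 0 j = (if j = 0 then 1 else 0)"
| "bridge_coeff (Suc k) 0 = 0"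
| "bridge_coeff (Suc k) (Suc j) = bridge_coeff k j + bridge_ratio k * j * bridge_coeff (Suc k) (j - 1)"

lemma bridge_coeff_nonneg: "bridge_coeff k j \<ge> 0"
  by (induction k j rule: bridge_coeff.induct) (auto simp: bridge_ratio_bounds(1) less_imp_le)

lemma bridge_coeff_eq_0: "j < k \<or> odd (j + k) \<Longrightarrow> bridge_coeff k j = 0"
proof (induction k j rule: bridge_coeff.induct)
  case (3 k j)
  then have "bridge_coeff k j = 0" by auto
  moreover have "bridge_coeff (Suc k) (j - 1) = 0" if "j > 0" using 3 that by (cases j) auto
  ultimately show ?case by (cases "j = 0") auto
qed (auto simp: odd_pos)

text \<open>A crude bound, uniform in \<open>k\<close>, that makes the power series converge
  everywhere. It follows from the recurrence with \<open>bridge_ratio k\<close> replaced by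
  \<open>1\<close>.\<close>

lemma bridge_coeff_div_fact_le: "bridge_coeff k j / fact j \<le> 1 / fact (j div 2)"
proof (induction k j rule: bridge_coeff.induct)
  case (3 k j)
  have fact_j: "real j * bridge_coeff (Suc k) (j - 1) / fact j = (if j = 0 then 0 else bridge_coeff (Suc k) (j - 1) / fact (j - 1))"
    by (cases j) (auto simp del: bridge_coeff.simps of_nat_Suc)
  have "bridge_ratio k * (real j * bridge_coeff (Suc k) (j - 1) / fact j) \<le> 1 * (real j * bridge_coeff (Suc k) (j - 1) / fact j)"
    using bridge_ratio_bounds [of k] by (intro mult_right_mono) (auto simp: bridge_coeff_nonneg)
  also have "\<dots> \<le> (if j = 0 then 0 else 1 / fact ((j - 1) div 2))"
    using 3(2) by (subst mult_1, subst fact_j) auto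
  moreover have "bridge_coeff (Suc k) (Suc j) / fact j =
      bridge_coeff k j / fact j + bridge_ratio k * (real j * bridge_coeff (Suc k) (j - 1) / fact j)"
    by (simp add: add_divide_distrib)
  ultimately have "bridge_coeff (Suc k) (Suc j) / fact j \<le> 1 / fact (j div 2) + (if j = 0 then 0 else 1 / fact ((j - 1) div 2))"
    using 3(1) by linarith
  also have "\<dots> \<le> (Suc j) * (1 / fact (Suc j div 2))"
  proof (cases "even j")
    case True
    then obtain m where m: "j = 2 * m" by blast
    show ?thesis
    proof (cases m)
      case (Suc m')
      have e: "1 / fact m' = real (Suc m') / fact (Suc m')" by (simp del: of_nat_Suc)
      have "1 / fact (Suc m') + 1 / fact m' = (1 + real (Suc m')) / fact (Suc m')"
        unfolding e by (simp only: add_divide_distrib)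
      also have "\<dots> \<le> Suc j / fact (Suc m')"
        by (intro divide_right_mono) (auto simp: m Suc)
      finally show ?thesis by (simp add: m Suc del: fact_Suc of_nat_Suc)
    qed (simp add: m)
  next
    case False
    then obtain m where m: "j = 2 * m + 1" by (auto elim: oddE)
    have "Suc j div 2 = Suc m" by (simp add: m)
    have e: "1 / fact m = real (Suc m) / fact (Suc m)" by (simp del: of_nat_Suc)
    have "1 / fact m + 1 / fact m = real (2 * Suc m) / fact (Suc m)"
      unfolding e by (simp only: add_divide_distrib [symmetric]) simp
    then show ?thesis using \<open>Suc j div 2 = Suc m\<close> by (simp add: m del: fact_Suc of_nat_Suc)
  qed
  finally have "bridge_coeff (Suc k) (Suc j) / fact j / Suc j \<le> Suc j * (1 / fact (Suc j div 2)) / Suc j"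
    by (rule divide_right_mono) simp
  moreover have "bridge_coeff (Suc k) (Suc j) / fact j / Suc j = bridge_coeff (Suc k) (Suc j) / fact (Suc j)"
    by (simp add: mult.commute del: bridge_coeff.simps of_nat_Suc)
  moreover have "Suc j * (1 / fact (Suc j div 2)) / Suc j = (1 / fact (Suc j div 2) :: real)"
    by (simp del: of_nat_Suc)
  ultimately show ?case by (simp only:)
qed auto

text \<open>Grouping the terms \<open>2 * i\<close> and \<open>2 * i + 1\<close> compares the series
  with \<open>(1 + \<bar>x\<bar>) * exp (\<bar>x\<bar>\<^sup>2)\<close>.\<close>

lemma summable_half_fact: "summable (\<lambda>j. x ^ j / fact (j div 2) :: real)" 
proof (rule summable_rabs_cancel, rule summableI_nonneg_bounded)
  fix n :: nat
  have even: "\<bar>x ^ (i * 2)\<bar> = x ^ (i * 2)" for i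
    using zero_le_even_power [of "i * 2" x] by (simp add: abs_of_nonneg)
  have "(\<Sum>j<n. \<bar>x ^ j / fact (j div 2)\<bar>) \<le> (\<Sum>j<2 * n. \<bar>x ^ j / fact (j div 2)\<bar>)"
    by (rule sum_mono2) auto
  also have "\<dots> = (\<Sum>i<n. (1 + \<bar>x\<bar>) * ((\<bar>x\<bar>\<^sup>2) ^ i / fact i))"
    by (induction n) (auto simp: even abs_mult algebra_simps add_divide_distrib simp flip: power_mult)
  also have "\<dots> = (1 + \<bar>x\<bar>) * (\<Sum>i<n. (\<bar>x\<bar>\<^sup>2) ^ i / fact i)"
    by (simp add: sum_distrib_left)
  also have "\<dots> \<le> (1 + \<bar>x\<bar>) * exp (\<bar>x\<bar>\<^sup>2)"
  proof (rule mult_left_mono)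
    show "(\<Sum>i<n. (\<bar>x\<bar>\<^sup>2) ^ i / fact i) \<le> exp (\<bar>x\<bar>\<^sup>2)"
      using summable_exp [of "\<bar>x\<bar>\<^sup>2"]
      by (subst exp_def) (auto intro!: sum_le_suminf simp: field_simps scaleR_conv_of_real)
  qed simp
  finally show "(\<Sum>j<n. \<bar>x ^ j / fact (j div 2)\<bar>) \<le> (1 + \<bar>x\<bar>) * exp (\<bar>x\<bar>\<^sup>2)" .
qed simp

definition bridge_egf :: "nat \<Rightarrow> real \<Rightarrow> real" where
  "bridge_egf k x = (\<Sum>j. bridge_coeff k j / fact j * x ^ j)"

lemma summable_bridge_egf: "summable (\<lambda>j. bridge_coeff k j / fact j * x ^ j)"
proof (rule summable_comparison_test' [OF summable_half_fact [of "\<bar>x\<bar>"]])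
  fix j
  have "\<bar>bridge_coeff k j / fact j\<bar> * \<bar>x\<bar> ^ j \<le> 1 / fact (j div 2) * \<bar>x\<bar> ^ j"
    using bridge_coeff_div_fact_le [of k j] by (intro mult_right_mono) (auto simp: bridge_coeff_nonneg)
  then show "norm (bridge_coeff k j / fact j * x ^ j) \<le> \<bar>x\<bar> ^ j / fact (j div 2)"
    by (simp add: abs_mult power_abs)
qed

lemma bridge_egf_nonneg: "x \<ge> 0 \<Longrightarrow> bridge_egf k x \<ge> 0"
  unfolding bridge_egf_def by (intro suminf_nonneg summable_bridge_egf) (auto simp: bridge_coeff_nonneg)

lemma bridge_egf_0: "bridge_egf 0 x = 1"
proof -
  have "bridge_egf 0 x = (\<Sum>j\<in>{0}. bridge_coeff 0 j / fact j * x ^ j)"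
    unfolding bridge_egf_def by (rule suminf_finite) auto
  then show ?thesis by simp
qed

lemma bridge_egf_at_0: "bridge_egf (Suc k) 0 = 0"
proof -
  have "(\<lambda>j. bridge_coeff (Suc k) j / fact j * 0 ^ j) = (\<lambda>_. 0)"
    by (rule ext, rename_tac j, case_tac j) auto
  then show ?thesis by (simp add: bridge_egf_def)
qed

text \<open>This is the recurrence of \<open>bridge_coeff\<close> divided by \<open>fact n\<close>:
  in the last term the factor \<open>n\<close> cancels against the factorial and leaves a shift by
  one, which is multiplication by \<open>x\<close>.\<close>

lemma DERIV_bridge_egf:
  "(bridge_egf (Suc k) has_real_derivative
     bridge_egf k x + bridge_ratio k * x * bridge_egf (Suc k) x) (at x)"
proof -
  let ?c = "\<lambda>k j. bridge_coeff k j / fact j"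
  let ?b = "bridge_ratio k"
  have "(bridge_egf (Suc k) has_real_derivative (\<Sum>n. diffs (?c (Suc k)) n * x ^ n)) (at x)"
    unfolding bridge_egf_def [abs_def]
    by (rule termdiffs_strong_converges_everywhere [OF summable_bridge_egf])
  moreover have "(\<lambda>n. diffs (?c (Suc k)) n * x ^ n) sums (bridge_egf k x + ?b * x * bridge_egf (Suc k) x)"
  proof -
    have s1: "(\<lambda>n. ?c k n * x ^ n) sums bridge_egf k x"
      unfolding bridge_egf_def by (rule summable_sums [OF summable_bridge_egf])
    have "(\<lambda>n. ?b * x * (?c (Suc k) n * x ^ n)) sums (?b * x * bridge_egf (Suc k) x)"
      unfolding bridge_egf_def by (rule sums_mult [OF summable_sums [OF summable_bridge_egf]])
    then have "(\<lambda>n. case n of 0 \<Rightarrow> 0 | Suc n \<Rightarrow> ?b * x * (?c (Suc k) n * x ^ n)) sums (?b * x * bridge_egf (Suc k) x)"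
      using sums_Suc_iff [of "\<lambda>n. case n of 0 \<Rightarrow> 0 | Suc n \<Rightarrow> ?b * x * (?c (Suc k) n * x ^ n)"] by simp
    from sums_add [OF s1 this]
    have "(\<lambda>n. ?c k n * x ^ n + (case n of 0 \<Rightarrow> 0 | Suc n \<Rightarrow> ?b * x * (?c (Suc k) n * x ^ n)))
        sums (bridge_egf k x + ?b * x * bridge_egf (Suc k) x)" .
    moreover have "diffs (?c (Suc k)) n * x ^ n =
        ?c k n * x ^ n + (case n of 0 \<Rightarrow> 0 | Suc n \<Rightarrow> ?b * x * (?c (Suc k) n * x ^ n))" for n
    proof -
      have "diffs (?c (Suc k)) n = bridge_coeff (Suc k) (Suc n) / fact n"
        by (simp add: diffs_def del: bridge_coeff.simps of_nat_Suc)
      also have "\<dots> = ?c k n + ?b * (real n * bridge_coeff (Suc k) (n - 1) / fact n)"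
        by (simp add: add_divide_distrib)
      also have "real n * bridge_coeff (Suc k) (n - 1) / fact n = (case n of 0 \<Rightarrow> 0 | Suc m \<Rightarrow> ?c (Suc k) m)"
        by (cases n) (auto simp del: bridge_coeff.simps of_nat_Suc)
      finally show ?thesis
        by (cases n) (auto simp: algebra_simps simp del: bridge_coeff.simps)
    qed
    ultimately show ?thesis by simp
  qed
  ultimately show ?thesis by (simp add: sums_iff)
qed

text \<open>Multiplication by the integrating factor of the differential equation: the exponent is
  \<open>bridge_ratio (k - 1) * x\<^sup>2 / 2\<close> for positive \<open>k\<close>, and
  \<open>0\<close> for \<open>k = 0\<close>.\<close>

definition reduced_egf :: "nat \<Rightarrow> real \<Rightarrow> real" where
  "reduced_egf k x = exp (- (real k * x\<^sup>2 / (2 * (real k + 1)))) * bridge_egf k x"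

lemma reduced_egf_nonneg: "x \<ge> 0 \<Longrightarrow> reduced_egf k x \<ge> 0"
  by (simp add: reduced_egf_def bridge_egf_nonneg)

lemma reduced_egf_0: "reduced_egf 0 x = 1"
  by (simp add: reduced_egf_def bridge_egf_0)

lemma reduced_egf_at_0: "reduced_egf (Suc k) 0 = 0"
  by (simp add: reduced_egf_def bridge_egf_at_0)

text \<open>The integrating factor cancels the term with \<open>bridge_egf (Suc k)\<close>. The
  remaining Gaussian is the quotient of the factors for \<open>k + 1\<close> and \<open>k\<close>,
  since \<open>(k + 1) / (k + 2) - k / (k + 1) = 1 / ((k + 1) * (k + 2))\<close>.\<close>

lemma DERIV_reduced_egf:
  "(reduced_egf (Suc k) has_real_derivative
     exp (- (x\<^sup>2 / (2 * (real k + 1) * (real k + 2)))) * reduced_egf k x) (at x)"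
proof -
  let ?b = "bridge_ratio k"
  define c where "c = bridge_ratio k / 2"
  have c: "?b = 2 * c" by (simp add: c_def)
  let ?E = "exp (- (c * x\<^sup>2))"
  have red: "reduced_egf (Suc k) = (\<lambda>x. exp (- (c * x\<^sup>2)) * bridge_egf (Suc k) x)"
    by (simp add: reduced_egf_def c_def bridge_ratio_def fun_eq_iff add.commute mult.commute)
  have "(reduced_egf (Suc k) has_real_derivative
     ?E * (bridge_egf k x + ?b * x * bridge_egf (Suc k) x) - ?b * x * ?E * bridge_egf (Suc k) x) (at x)"
    unfolding red c
    by (rule DERIV_cong, (rule derivative_eq_intros DERIV_bridge_egf refl)+) (simp add: c algebra_simps)
  also have "?E * (bridge_egf k x + ?b * x * bridge_egf (Suc k) x) - ?b * x * ?E * bridge_egf (Suc k) x =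
     ?E * bridge_egf k x" by (simp add: algebra_simps)
  also have "?E = exp (- (x\<^sup>2 / (2 * (real k + 1) * (real k + 2)))) * exp (- (real k * x\<^sup>2 / (2 * (real k + 1))))"
  proof -
    have "- (c * x\<^sup>2) = - (x\<^sup>2 / (2 * (real k + 1) * (real k + 2))) + - (real k * x\<^sup>2 / (2 * (real k + 1)))"
    proof -
      have "4 + (real k * 6 + real k * (real k * 2)) > 0" by (intro add_pos_nonneg) auto
      then show ?thesis by (simp add: c_def bridge_ratio_def divide_simps) (simp add: algebra_simps)
    qed
    then show ?thesis by (simp only: exp_add)
  qed
  finally show ?thesis unfolding reduced_egf_def [of k] by (simp only: mult.assoc)
qed

lemma continuous_reduced_egf: "continuous_on A (reduced_egf k)"
proof (cases k)
  case 0
  then show ?thesis by (simp add: reduced_egf_0 [abs_def])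
next
  case (Suc m)
  then have "isCont (reduced_egf k) x" for x
    using DERIV_isCont [OF DERIV_reduced_egf [of m x]] by simp
  then show ?thesis by (simp add: continuous_at_imp_continuous_on)
qed

lemma borel_measurable_reduced_egf [measurable]: "reduced_egf k \<in> borel_measurable borel"
  by (rule borel_measurable_continuous_onI) (rule continuous_reduced_egf)

section \<open>Gaussian integrals\<close>

text \<open>The integral of \<open>exp (- (s\<^sup>2 / 2))\<close> over \<open>{z..}\<close>,
  written through the normal distribution function so that its limits at both ends are those of a
  distribution function.\<close>

definition gauss_tail :: "real \<Rightarrow> real" where
  "gauss_tail z = sqrt (2 * pi) * (1 - cdf std_normal_distribution z)"

interpretation std_normal: real_distribution std_normal_distribution
  by (rule real_dist_normal_dist)

lemma gauss_tail_nonneg: "gauss_tail z \<ge> 0"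
  by (simp add: gauss_tail_def std_normal.cdf_bounded_prob)

lemma gauss_tail_at_top: "(gauss_tail \<longlongrightarrow> 0) at_top"
  unfolding gauss_tail_def [abs_def]
  by (rule tendsto_eq_intros std_normal.cdf_lim_at_top_prob refl | simp)+

lemma gauss_tail_at_bot: "(gauss_tail \<longlongrightarrow> sqrt (2 * pi)) at_bot"
  unfolding gauss_tail_def [abs_def]
  by (rule tendsto_eq_intros std_normal.cdf_lim_at_bot refl | simp)+

text \<open>The continuous density has an antiderivative \<open>F\<close>; it has the same
  increments as the distribution function, so the two differ by a constant.\<close>

lemma DERIV_cdf_std_normal: "(cdf std_normal_distribution has_real_derivative std_normal_density z) (at z)"
proof -
  have "\<exists>F. \<forall>x::real. - \<infinity> < ereal x \<longrightarrow> ereal x < \<infinity> \<longrightarrow> (F has_vector_derivative std_normal_density x) (at x)"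
    by (rule einterval_antiderivative) (auto simp: normal_density_def intro!: continuous_intros)
  then obtain F where F: "\<And>x. (F has_real_derivative std_normal_density x) (at x)"
    by (auto simp: has_real_derivative_iff_has_vector_derivative)
  have diff: "cdf std_normal_distribution b - cdf std_normal_distribution a = F b - F a" if "a < b" for a b
  proof -
    have "emeasure std_normal_distribution {a<..b} =
        (\<integral>\<^sup>+x. ennreal (std_normal_density x) * indicator {a<..b} x \<partial>lborel)"
      by (subst emeasure_density) auto
    also have "\<dots> = (\<integral>\<^sup>+x. ennreal (std_normal_density x) * indicator {a..b} x \<partial>lborel)"
      by (rule nn_integral_cong_AE, rule AE_mp [OF AE_lborel_singleton [of a]]) (auto split: split_indicator)
    also have "\<dots> = ennreal (F b - F a)"
      by (rule nn_integral_FTC_Icc) (use F that in auto)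
    finally have "measure std_normal_distribution {a<..b} = enn2real (ennreal (F b - F a))"
      by (simp add: measure_def)
    moreover have "F a \<le> F b"
      using F that by (intro DERIV_nonneg_imp_nondecreasing [of a b F]) (auto intro!: exI)
    ultimately show ?thesis using std_normal.cdf_diff_eq [OF that] by simp
  qed
  have "cdf std_normal_distribution x = F x + (cdf std_normal_distribution 0 - F 0)" for x
    using diff [of x 0] diff [of 0 x] by (cases x "0::real" rule: linorder_cases) auto
  then have "cdf std_normal_distribution = (\<lambda>x. F x + (cdf std_normal_distribution 0 - F 0))" ..
  moreover have "((\<lambda>x. F x + (cdf std_normal_distribution 0 - F 0)) has_real_derivative std_normal_density z) (at z)"
    by (rule derivative_eq_intros F refl | simp)+
  ultimately show ?thesis by simp
qed

lemma DERIV_gauss_tail: "(gauss_tail has_real_derivative - exp (- (z\<^sup>2 / 2))) (at z)"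
proof -
  have "(gauss_tail has_real_derivative sqrt (2 * pi) * (0 - std_normal_density z)) (at z)"
    unfolding gauss_tail_def [abs_def]
    by (rule derivative_eq_intros DERIV_cdf_std_normal refl | simp)+
  then show ?thesis by (simp add: std_normal_density_def)
qed

lemma borel_measurable_gauss_tail [measurable]: "gauss_tail \<in> borel_measurable borel"
  by (rule borel_measurable_continuous_onI)
     (meson DERIV_gauss_tail DERIV_isCont continuous_at_imp_continuous_on)

text \<open>An antiderivative is \<open>- (gauss_tail s ^ Suc m)\<close>. Integrating against one
  more Gaussian thus raises the power by one, which will be the inductive step for the
  transform.\<close>

lemma nn_integral_gauss_tail_power:
  "(\<integral>\<^sup>+s. ennreal (real (Suc m) * exp (- (s\<^sup>2 / 2)) * gauss_tail s ^ m) * indicator {z..} s \<partial>lborel) =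
     ennreal (gauss_tail z ^ Suc m)"
proof -
  have "(\<integral>\<^sup>+s. ennreal (real (Suc m) * exp (- (s\<^sup>2 / 2)) * gauss_tail s ^ m) * indicator {z..} s \<partial>lborel) =
      ennreal (0 - (- (gauss_tail z ^ Suc m)))"
  proof (rule nn_integral_FTC_atLeast)
    show "((\<lambda>s. - (gauss_tail s ^ Suc m)) has_real_derivative real (Suc m) * exp (- (s\<^sup>2 / 2)) * gauss_tail s ^ m) (at s)" for s
      by (rule derivative_eq_intros DERIV_gauss_tail refl | simp)+
    show "((\<lambda>s. - (gauss_tail s ^ Suc m)) \<longlongrightarrow> 0) at_top"
      by (rule tendsto_eq_intros gauss_tail_at_top refl | simp)+
  qed (auto simp: gauss_tail_nonneg)
  then show ?thesis by simp
qed

lemma nn_integral_gauss_tail_power_UNIV: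
  "(\<integral>\<^sup>+s. ennreal (real (Suc m) * exp (- (s\<^sup>2 / 2)) * gauss_tail s ^ m) \<partial>lborel) = ennreal (sqrt (2 * pi) ^ Suc m)"
proof (rule LIMSEQ_unique)
  let ?f = "\<lambda>s. ennreal (real (Suc m) * exp (- (s\<^sup>2 / 2)) * gauss_tail s ^ m)"
  have "(\<lambda>n::nat. \<integral>\<^sup>+s. ?f s * indicator {- real n..} s \<partial>lborel) \<longlonglongrightarrow> (\<integral>\<^sup>+s. ?f s \<partial>lborel)"
  proof (rule nn_integral_LIMSEQ)
    show "incseq (\<lambda>n::nat. \<lambda>s. ?f s * indicator {- real n..} s)"
      by (auto simp: incseq_def le_fun_def split: split_indicator)
    show "(\<lambda>n::nat. ?f s * indicator {- real n..} s) \<longlonglongrightarrow> ?f s" for s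
    proof (rule tendsto_eventually)
      have "eventually (\<lambda>n. n \<ge> nat \<lceil>- s\<rceil>) sequentially" by (rule eventually_ge_at_top)
      then show "eventually (\<lambda>n::nat. ?f s * indicator {- real n..} s = ?f s) sequentially"
        by eventually_elim (auto split: split_indicator simp: nat_le_iff ceiling_le_iff)
    qed
  qed measurable
  then show "(\<lambda>n::nat. ennreal (gauss_tail (- real n) ^ Suc m)) \<longlonglongrightarrow> (\<integral>\<^sup>+s. ?f s \<partial>lborel)"
    by (simp only: nn_integral_gauss_tail_power)
  have "filterlim (\<lambda>n::nat. - real n) at_bot sequentially"
    by (intro filterlim_uminus_at_bot_at_top filterlim_compose [OF filterlim_uminus_at_bot_at_top] filterlim_real_sequentially)
  from filterlim_compose [OF gauss_tail_at_bot this]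
  show "(\<lambda>n::nat. ennreal (gauss_tail (- real n) ^ Suc m)) \<longlonglongrightarrow> ennreal (sqrt (2 * pi) ^ Suc m)"
    by (intro tendsto_ennrealI tendsto_power)
qed

text \<open>By \<open>DERIV_reduced_egf\<close> this is the derivative of
  \<open>reduced_egf (Suc k)\<close>. Its integral over the positive reals is the one that is
  evaluated in closed form; compare \<open>reduced_density_eq\<close>.\<close>

definition reduced_density :: "nat \<Rightarrow> real \<Rightarrow> real" where
  "reduced_density k x = exp (- (x\<^sup>2 / (2 * (real k + 1) * (real k + 2)))) * reduced_egf k x"

text \<open>Expanding the square, this is \<open>exp (- ((k + 1) * z\<^sup>2 / 2))\<close> times the
  Laplace transform at \<open>z\<close> of
  \<open>exp (- (x\<^sup>2 / 2)) * bridge_egf k x\<close>.\<close>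

definition shifted_transform :: "nat \<Rightarrow> real \<Rightarrow> ennreal" where
  "shifted_transform k z = (\<integral>\<^sup>+x. ennreal (reduced_egf k x * exp (- (((real k + 1) * z + x)\<^sup>2 / (2 * (real k + 1))))) * indicator {0..} x \<partial>lborel)"

lemma reduced_density_nonneg: "x \<ge> 0 \<Longrightarrow> reduced_density k x \<ge> 0"
  by (simp add: reduced_density_def reduced_egf_nonneg)

lemma borel_measurable_reduced_density [measurable]: "reduced_density k \<in> borel_measurable borel"
  unfolding reduced_density_def by measurable

lemma reduced_egf_eq_nn_integral:
  assumes "y \<ge> 0"
  shows "(\<integral>\<^sup>+x. ennreal (reduced_density k x) * indicator {0..y} x \<partial>lborel) = ennreal (reduced_egf (Suc k) y)"
proof -
  have "(\<integral>\<^sup>+x. ennreal (reduced_density k x) * indicator {0..y} x \<partial>lborel) =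
      ennreal (reduced_egf (Suc k) y - reduced_egf (Suc k) 0)"
    by (rule nn_integral_FTC_Icc)
       (use assms DERIV_reduced_egf in \<open>auto simp: reduced_density_nonneg\<close>, simp add: reduced_density_def DERIV_reduced_egf)
  then show ?thesis by (simp add: reduced_egf_at_0)
qed

lemma borel_measurable_shifted_transform [measurable]: "shifted_transform k \<in> borel_measurable borel"
  unfolding shifted_transform_def by measurable

text \<open>One more factor \<open>exp (- (s\<^sup>2 / 2))\<close> turns the completed square for
  \<open>k + 1\<close> into the one for \<open>k + 2\<close>, and the leftover Gaussian in
  \<open>x\<close> is exactly what makes \<open>reduced_density k\<close> out of
  \<open>reduced_egf k\<close>. The function \<open>f\<close> is later \<open>k + 2\<close> on
  \<open>{z..}\<close> for the induction, and \<open>k + 2\<close> everywhere for the total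
  mass.\<close>

lemma shifted_transform_swap:
  assumes [measurable]: "f \<in> borel_measurable borel"
  shows "(\<integral>\<^sup>+s. f s * ennreal (exp (- (s\<^sup>2 / 2))) * shifted_transform k s \<partial>lborel) =
    (\<integral>\<^sup>+x. ennreal (reduced_density k x) * indicator {0..} x *
       (\<integral>\<^sup>+s. f s * ennreal (exp (- (((real k + 2) * s + x)\<^sup>2 / (2 * (real k + 2))))) \<partial>lborel) \<partial>lborel)"
proof -
  let ?e = "\<lambda>s x. exp (- (((real k + 2) * s + x)\<^sup>2 / (2 * (real k + 2))))"
  have eq: "ennreal (exp (- (s\<^sup>2 / 2))) * (ennreal (reduced_egf k x * exp (- (((real k + 1) * s + x)\<^sup>2 / (2 * (real k + 1))))) * indicator {0..} x)
      = ennreal (reduced_density k x) * indicator {0..} x * ennreal (?e s x)" for s x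
  proof (cases "x \<ge> 0")
    case True
    have "- (s\<^sup>2 / 2) + - (((real k + 1) * s + x)\<^sup>2 / (2 * (real k + 1))) =
        - (x\<^sup>2 / (2 * (real k + 1) * (real k + 2))) + - (((real k + 2) * s + x)\<^sup>2 / (2 * (real k + 2)))"
    proof -
      have "real k + 1 \<noteq> 0" "real k + 2 \<noteq> 0" by auto
      then show ?thesis by (simp add: divide_simps) (simp add: power2_eq_square algebra_simps)
    qed
    then have "exp (- (s\<^sup>2 / 2)) * exp (- (((real k + 1) * s + x)\<^sup>2 / (2 * (real k + 1)))) =
        exp (- (x\<^sup>2 / (2 * (real k + 1) * (real k + 2)))) * ?e s x"
      by (simp only: exp_add [symmetric])
    then have "exp (- (s\<^sup>2 / 2)) * (reduced_egf k x * exp (- (((real k + 1) * s + x)\<^sup>2 / (2 * (real k + 1))))) =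
        reduced_density k x * ?e s x"
      by (simp add: reduced_density_def algebra_simps)
    then show ?thesis
      using True by (simp add: reduced_density_nonneg reduced_egf_nonneg flip: ennreal_mult)
  qed simp
  have "(\<integral>\<^sup>+s. f s * ennreal (exp (- (s\<^sup>2 / 2))) * shifted_transform k s \<partial>lborel) =
     (\<integral>\<^sup>+s. \<integral>\<^sup>+x. f s * (ennreal (reduced_density k x) * indicator {0..} x * ennreal (?e s x)) \<partial>lborel \<partial>lborel)"
    unfolding shifted_transform_def
    by (subst nn_integral_cmult [symmetric], measurable) (simp only: mult.assoc eq)
  also have "\<dots> = (\<integral>\<^sup>+x. \<integral>\<^sup>+s. f s * (ennreal (reduced_density k x) * indicator {0..} x * ennreal (?e s x)) \<partial>lborel \<partial>lborel)"
    by (rule lborel_pair.Fubini') measurable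
  also have "\<dots> = (\<integral>\<^sup>+x. ennreal (reduced_density k x) * indicator {0..} x * (\<integral>\<^sup>+s. f s * ennreal (?e s x) \<partial>lborel) \<partial>lborel)"
    by (subst nn_integral_cmult [symmetric], measurable) (simp only: ac_simps)
  finally show ?thesis .
qed

text \<open>Up to a Gaussian factor, \<open>shifted_transform\<close> is the Laplace transform of a \<open>(k + 1)\<close>-fold convolution of half-Gaussians.\<close>

lemma shifted_transform_eq: "shifted_transform k z = ennreal (gauss_tail z ^ Suc k)"
proof (induction k arbitrary: z)
  case 0
  have "shifted_transform 0 z = (\<integral>\<^sup>+x. ennreal (exp (- ((z + x)\<^sup>2 / 2))) * indicator {z..} (z + x) \<partial>lborel)"
    unfolding shifted_transform_def by (intro nn_integral_cong) (auto simp: reduced_egf_0 split: split_indicator)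
  also have "\<dots> = (\<integral>\<^sup>+x. ennreal (exp (- (x\<^sup>2 / 2))) * indicator {z..} x \<partial>lborel)"
    by (subst nn_integral_real_affine [where c = 1 and t = z]) auto
  also have "\<dots> = ennreal (gauss_tail z ^ Suc 0)"
    using nn_integral_gauss_tail_power [of 0 z] by simp
  finally show ?case .
next
  case (Suc k)
  let ?e = "\<lambda>s x. exp (- (((real k + 2) * s + x)\<^sup>2 / (2 * (real k + 2))))"
  have "shifted_transform (Suc k) z =
     (\<integral>\<^sup>+y. (\<integral>\<^sup>+x. ennreal (reduced_density k x) * indicator {0..y} x \<partial>lborel) * ennreal (?e z y) * indicator {0..} y \<partial>lborel)"
    unfolding shifted_transform_def
  proof (intro nn_integral_cong)
    fix y
    show "ennreal (reduced_egf (Suc k) y * exp (- (((real (Suc k) + 1) * z + y)\<^sup>2 / (2 * (real (Suc k) + 1))))) * indicator {0..} y =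
       (\<integral>\<^sup>+x. ennreal (reduced_density k x) * indicator {0..y} x \<partial>lborel) * ennreal (?e z y) * indicator {0..} y"
    proof (cases "y \<ge> 0")
      case True
      have eq: "real (Suc k) + 1 = real k + 2" by simp
      show ?thesis
        unfolding eq reduced_egf_eq_nn_integral [OF True]
        using True reduced_egf_nonneg [OF True, of "Suc k"] by (simp add: ennreal_mult)
    qed simp
  qed
  \<comment> \<open>The inner integral over \<open>{0..y}\<close> becomes one over the region
    \<open>0 \<le> x \<le> y\<close>, ready for exchanging the order of integration.\<close>
  also have "\<dots> = (\<integral>\<^sup>+y. \<integral>\<^sup>+x. ennreal (reduced_density k x) * indicator {0..} x * (ennreal (?e z y) * indicator {0..} (y - x)) \<partial>lborel \<partial>lborel)"
  proof (intro nn_integral_cong)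
    fix y
    have "(\<integral>\<^sup>+x. ennreal (reduced_density k x) * indicator {0..y} x \<partial>lborel) * ennreal (?e z y) * indicator {0..} y =
       (\<integral>\<^sup>+x. ennreal (reduced_density k x) * indicator {0..y} x * (ennreal (?e z y) * indicator {0..} y) \<partial>lborel)"
      by (subst nn_integral_multc) (auto simp: mult.assoc)
    also have "\<dots> = (\<integral>\<^sup>+x. ennreal (reduced_density k x) * indicator {0..} x * (ennreal (?e z y) * indicator {0..} (y - x)) \<partial>lborel)"
      by (intro nn_integral_cong) (auto split: split_indicator)
    finally show "(\<integral>\<^sup>+x. ennreal (reduced_density k x) * indicator {0..y} x \<partial>lborel) * ennreal (?e z y) * indicator {0..} y = \<dots>" .
  qed
  also have "\<dots> = (\<integral>\<^sup>+x. \<integral>\<^sup>+y. ennreal (reduced_density k x) * indicator {0..} x * (ennreal (?e z y) * indicator {0..} (y - x)) \<partial>lborel \<partial>lborel)"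
    by (rule lborel_pair.Fubini') measurable
  also have "\<dots> = (\<integral>\<^sup>+x. ennreal (reduced_density k x) * indicator {0..} x *
       (\<integral>\<^sup>+s. ennreal (real k + 2) * indicator {z..} s * ennreal (?e s x) \<partial>lborel) \<partial>lborel)"
  proof (intro nn_integral_cong)
    fix x
    \<comment> \<open>Substitution \<open>y = x + (k + 2) * (s - z)\<close>, chosen so that
      \<open>(k + 2) * z + y = (k + 2) * s + x\<close>. Its Jacobian \<open>k + 2\<close> is the
      factor that \<open>nn_integral_gauss_tail_power\<close> asks for.\<close>
    have "(\<integral>\<^sup>+y. ennreal (?e z y) * indicator {0..} (y - x) \<partial>lborel) =
       ennreal (real k + 2) * (\<integral>\<^sup>+s. ennreal (?e z ((x - (real k + 2) * z) + (real k + 2) * s)) * indicator {0..} (((x - (real k + 2) * z) + (real k + 2) * s) - x) \<partial>lborel)"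
      by (subst nn_integral_real_affine [where c = "real k + 2" and t = "x - (real k + 2) * z"]) auto
    also have "\<dots> = ennreal (real k + 2) * (\<integral>\<^sup>+s. indicator {z..} s * ennreal (?e s x) \<partial>lborel)"
    proof (rule arg_cong2 [where f = "(*)", OF refl], rule nn_integral_cong)
      fix s
      have "(x - (real k + 2) * z) + (real k + 2) * s - x = (real k + 2) * (s - z)" by (simp add: algebra_simps)
      then have "indicator {0..} ((x - (real k + 2) * z) + (real k + 2) * s - x) = (indicator {z..} s :: ennreal)"
        by (simp add: indicator_def zero_le_mult_iff)
      moreover have "(real k + 2) * z + ((x - (real k + 2) * z) + (real k + 2) * s) = (real k + 2) * s + x" by (simp add: algebra_simps)
      ultimately show "ennreal (?e z ((x - (real k + 2) * z) + (real k + 2) * s)) * indicator {0..} (((x - (real k + 2) * z) + (real k + 2) * s) - x)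
          = indicator {z..} s * ennreal (?e s x)" by (simp only: mult.commute)
    qed
    also have "\<dots> = (\<integral>\<^sup>+s. ennreal (real k + 2) * indicator {z..} s * ennreal (?e s x) \<partial>lborel)"
      by (subst nn_integral_cmult [symmetric]) (auto simp: mult.assoc)
    finally show "(\<integral>\<^sup>+y. ennreal (reduced_density k x) * indicator {0..} x * (ennreal (?e z y) * indicator {0..} (y - x)) \<partial>lborel) =
        ennreal (reduced_density k x) * indicator {0..} x * (\<integral>\<^sup>+s. ennreal (real k + 2) * indicator {z..} s * ennreal (?e s x) \<partial>lborel)"
      by (subst nn_integral_cmult) auto
  qed
  also have "\<dots> = (\<integral>\<^sup>+s. ennreal (real k + 2) * indicator {z..} s * ennreal (exp (- (s\<^sup>2 / 2))) * shifted_transform k s \<partial>lborel)"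
    by (rule shifted_transform_swap [symmetric]) measurable
  also have "\<dots> = (\<integral>\<^sup>+s. ennreal (real (Suc (Suc k)) * exp (- (s\<^sup>2 / 2)) * gauss_tail s ^ Suc k) * indicator {z..} s \<partial>lborel)"
  proof (intro nn_integral_cong)
    fix s
    have eq: "real (Suc (Suc k)) = real k + 2" by simp
    show "ennreal (real k + 2) * indicator {z..} s * ennreal (exp (- (s\<^sup>2 / 2))) * shifted_transform k s =
        ennreal (real (Suc (Suc k)) * exp (- (s\<^sup>2 / 2)) * gauss_tail s ^ Suc k) * indicator {z..} s"
      unfolding Suc.IH eq
      by (simp add: ennreal_mult gauss_tail_nonneg mult_ac del: ennreal_plus power_Suc split: split_indicator)
  qed
  also have "\<dots> = ennreal (gauss_tail z ^ Suc (Suc k))"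
    by (rule nn_integral_gauss_tail_power)
  finally show ?case .
qed

lemma nn_integral_gauss_affine:
  assumes "m > 0"
  shows "(\<integral>\<^sup>+s. ennreal (exp (- ((m * s + x)\<^sup>2 / (2 * m)))) \<partial>lborel) = ennreal (sqrt (2 * pi / m))"
proof -
  have "ennreal (sqrt (2 * pi)) = (\<integral>\<^sup>+u. ennreal (exp (- (u\<^sup>2 / 2))) \<partial>lborel)"
    using nn_integral_gauss_tail_power_UNIV [of 0] by simp
  also have "\<dots> = ennreal (sqrt m) * (\<integral>\<^sup>+s. ennreal (exp (- ((x / sqrt m + sqrt m * s)\<^sup>2 / 2))) \<partial>lborel)"
    using assms by (subst nn_integral_real_affine [where c = "sqrt m" and t = "x / sqrt m"]) auto
  also have "(\<lambda>s. (x / sqrt m + sqrt m * s)\<^sup>2 / 2) = (\<lambda>s. (m * s + x)\<^sup>2 / (2 * m))"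
  proof
    fix s
    have "x / sqrt m + sqrt m * s = (m * s + x) / sqrt m"
      using assms by (simp add: field_simps)
    then show "(x / sqrt m + sqrt m * s)\<^sup>2 / 2 = (m * s + x)\<^sup>2 / (2 * m)"
      using assms by (simp add: power_divide)
  qed
  finally have "ennreal (1 / sqrt m) * ennreal (sqrt (2 * pi)) =
      ennreal (1 / sqrt m) * (ennreal (sqrt m) * (\<integral>\<^sup>+s. ennreal (exp (- ((m * s + x)\<^sup>2 / (2 * m)))) \<partial>lborel))"
    by (rule arg_cong)
  then show ?thesis
    using assms by (simp add: real_sqrt_divide field_simps flip: ennreal_mult mult.assoc)
qed

text \<open>\<open>shifted_transform_eq\<close> is integrated over all \<open>s\<close> against
  \<open>(k + 2) * exp (- (s\<^sup>2 / 2))\<close>. After the swap the inner Gaussian integral does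
  not depend on \<open>x\<close>, so it factors out and the wanted integral can be solved
  for.\<close>

lemma nn_integral_reduced_density:
  "(\<integral>\<^sup>+x. ennreal (reduced_density k x) * indicator {0..} x \<partial>lborel) = ennreal (sqrt (2 * pi) ^ Suc k / sqrt (real k + 2))"
proof -
  let ?I = "\<integral>\<^sup>+x. ennreal (reduced_density k x) * indicator {0..} x \<partial>lborel"
  have "ennreal (sqrt (2 * pi) ^ Suc (Suc k)) =
      (\<integral>\<^sup>+s. ennreal (real (Suc (Suc k)) * exp (- (s\<^sup>2 / 2)) * gauss_tail s ^ Suc k) \<partial>lborel)"
    by (rule nn_integral_gauss_tail_power_UNIV [symmetric])
  also have "\<dots> = (\<integral>\<^sup>+s. ennreal (real k + 2) * ennreal (exp (- (s\<^sup>2 / 2))) * shifted_transform k s \<partial>lborel)"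
  proof (intro nn_integral_cong)
    fix s
    have eq: "real (Suc (Suc k)) = real k + 2" by simp
    show "ennreal (real (Suc (Suc k)) * exp (- (s\<^sup>2 / 2)) * gauss_tail s ^ Suc k) =
        ennreal (real k + 2) * ennreal (exp (- (s\<^sup>2 / 2))) * shifted_transform k s"
      unfolding shifted_transform_eq eq
      by (simp add: ennreal_mult gauss_tail_nonneg mult_ac del: ennreal_plus power_Suc)
  qed
  also have "\<dots> = (\<integral>\<^sup>+x. ennreal (reduced_density k x) * indicator {0..} x *
       (\<integral>\<^sup>+s. ennreal (real k + 2) * ennreal (exp (- (((real k + 2) * s + x)\<^sup>2 / (2 * (real k + 2))))) \<partial>lborel) \<partial>lborel)"
    by (rule shifted_transform_swap) measurable
  also have "\<dots> = (\<integral>\<^sup>+x. ennreal (reduced_density k x) * indicator {0..} x * ennreal ((real k + 2) * sqrt (2 * pi / (real k + 2))) \<partial>lborel)"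
  proof -
    have "(\<integral>\<^sup>+s. ennreal (real k + 2) * ennreal (exp (- (((real k + 2) * s + x)\<^sup>2 / (2 * (real k + 2))))) \<partial>lborel) =
        ennreal ((real k + 2) * sqrt (2 * pi / (real k + 2)))" for x
      by (subst nn_integral_cmult, measurable, subst nn_integral_gauss_affine)
         (simp_all add: ennreal_mult del: ennreal_plus)
    then show ?thesis by (simp only:)
  qed
  also have "\<dots> = ?I * ennreal ((real k + 2) * sqrt (2 * pi / (real k + 2)))"
    by (rule nn_integral_multc) measurable
  finally have eq: "ennreal (sqrt (2 * pi) ^ Suc (Suc k)) = ?I * ennreal ((real k + 2) * sqrt (2 * pi / (real k + 2)))" .
  define c where "c = (real k + 2) * sqrt (2 * pi / (real k + 2))"
  have c: "c = sqrt (2 * pi) * sqrt (real k + 2)"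
    by (simp add: c_def real_sqrt_divide field_simps)
  have c_pos: "c > 0" by (simp add: c_def)
  have "?I = ?I * ennreal c * ennreal (1 / c)"
    using c_pos by (simp add: mult.assoc flip: ennreal_mult)
  also have "\<dots> = ennreal (sqrt (2 * pi) ^ Suc (Suc k)) * ennreal (1 / c)"
    unfolding eq c_def ..
  also have "\<dots> = ennreal (sqrt (2 * pi) ^ Suc (Suc k) * (1 / c))"
    by (rule ennreal_mult [symmetric]) (use c_pos in auto)
  also have "sqrt (2 * pi) ^ Suc (Suc k) * (1 / c) = sqrt (2 * pi) ^ Suc k / sqrt (real k + 2)"
    unfolding c by simp
  finally show ?thesis .
qed

section \<open>Leading-order counts\<close>

text \<open>The integral of \<open>x ^ j / fact j * exp (- (b * x\<^sup>2 / 2))\<close> over the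
  positive reals. By the duplication formula the factorial and one Gamma value merge into a single
  Gamma value, uniformly in the parity of \<open>j\<close>.\<close>

definition gauss_moment :: "real \<Rightarrow> nat \<Rightarrow> real" where
  "gauss_moment b j = sqrt pi / (sqrt (2 * b) ^ Suc j * Gamma (j / 2 + 1))"

lemma gauss_moment_pos: "b > 0 \<Longrightarrow> gauss_moment b j > 0"
  by (simp add: gauss_moment_def Gamma_real_pos)

lemma Gamma_plus1_real: "x > 0 \<Longrightarrow> Gamma (x + 1) = x * Gamma (x::real)"
  by (rule Gamma_plus1) (auto dest: nonpos_Ints_nonpos)

lemma gauss_moment_Suc_Suc:
  assumes "b > 0" shows "gauss_moment b (Suc (Suc j)) = gauss_moment b j / (b * (real j + 2))"
proof -
  have "real (Suc (Suc j)) / 2 + 1 = (j / 2 + 1) + 1" by (simp add: field_simps)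
  then have "Gamma (real (Suc (Suc j)) / 2 + 1) = (j / 2 + 1) * Gamma (j / 2 + 1)"
    by (simp only: Gamma_plus1_real add_pos_nonneg zero_less_one divide_nonneg_nonneg of_nat_0_le_iff zero_le_numeral add_nonneg_pos)
  moreover have "sqrt (2 * b) ^ Suc (Suc (Suc j)) = sqrt (2 * b) ^ Suc j * (2 * b)"
  proof -
    have "sqrt (2 * b) ^ Suc (Suc (Suc j)) = sqrt (2 * b) ^ Suc j * (sqrt (2 * b))\<^sup>2"
      by (simp add: power2_eq_square)
    then show ?thesis using assms by simp
  qed
  ultimately have "gauss_moment b (Suc (Suc j)) =
      sqrt pi / (sqrt (2 * b) ^ Suc j * (2 * b) * ((j / 2 + 1) * Gamma (j / 2 + 1)))"
    by (simp only: gauss_moment_def)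
  also have "sqrt (2 * b) ^ Suc j * (2 * b) * ((j / 2 + 1) * Gamma (j / 2 + 1)) =
      sqrt (2 * b) ^ Suc j * Gamma (j / 2 + 1) * (b * (real j + 2))"
    by (simp add: field_simps)
  finally show ?thesis by (simp only: gauss_moment_def divide_divide_eq_left)
qed

lemma Gamma_half_odd: "Gamma (real m + 3 / 2) = sqrt pi * fact (2 * m + 1) / (2 ^ (2 * m + 1) * fact m)"
proof (induction m)
  case 0
  show ?case using Gamma_plus1_real [of "1 / 2"] by (simp add: Gamma_one_half_real)
next
  case (Suc m)
  have "Gamma (real (Suc m) + 3 / 2) = (real m + 3 / 2) * Gamma (real m + 3 / 2)"
    using Gamma_plus1_real [of "real m + 3 / 2"] by (simp add: add_ac)
  also have "\<dots> = sqrt pi * fact (2 * Suc m + 1) / (2 ^ (2 * Suc m + 1) * fact (Suc m))"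
  proof -
    define F P f where "F = (fact (2 * m + 1) :: real)" and "P = (2 ^ (2 * m + 1) :: real)" and "f = (fact m :: real)"
    have "fact (2 * Suc m + 1) = (2 * real m + 3) * (2 * real m + 2) * F"
      by (simp add: F_def algebra_simps)
    moreover have "2 ^ (2 * Suc m + 1) = 4 * P" by (simp add: P_def)
    moreover have "fact (Suc m) = (real m + 1) * f" by (simp add: f_def)
    moreover have "P > 0" "f > 0" "real m + 1 > 0" by (simp_all add: P_def f_def)
    ultimately show ?thesis
      unfolding Suc.IH F_def [symmetric] P_def [symmetric] f_def [symmetric]
      by (simp add: divide_simps)
  qed
  finally show ?case .
qed

lemma nn_integral_power_exp_square:
  "(\<integral>\<^sup>+t. ennreal (t ^ j * exp (- t\<^sup>2)) * indicator {0..} t \<partial>lborel) = ennreal (sqrt pi * fact j / (2 ^ Suc j * Gamma (j / 2 + 1)))"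
proof -
  have *: "(\<integral>\<^sup>+t. ennreal (t ^ j * exp (- t\<^sup>2)) * indicator {0..} t \<partial>lborel) = ennreal c"
    if "has_bochner_integral lborel (\<lambda>x::real. indicator {0..} x *\<^sub>R (exp (- x\<^sup>2) * x ^ j)) c" for c
  proof -
    have "(\<integral>\<^sup>+x. ennreal (indicator {0..} x *\<^sub>R (exp (- x\<^sup>2) * x ^ j)) \<partial>lborel) = ennreal c"
      using that by (subst nn_integral_eq_integral)
        (auto simp: has_bochner_integral_iff split: split_indicator)
    moreover have "ennreal (indicator {0..} x *\<^sub>R (exp (- x\<^sup>2) * x ^ j)) = ennreal (x ^ j * exp (- x\<^sup>2)) * indicator {0..} x" for x :: real
      by (auto simp: mult.commute split: split_indicator)
    ultimately show ?thesis by simp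
  qed
  show ?thesis
  proof (cases "even j")
    case True
    then obtain m where m: "j = 2 * m" by blast
    have "Gamma (real j / 2 + 1) = fact m"
      using Gamma_fact [of m, where 'a = real] by (simp add: m add.commute)
    moreover have "(\<integral>\<^sup>+t. ennreal (t ^ j * exp (- t\<^sup>2)) * indicator {0..} t \<partial>lborel) =
        ennreal ((sqrt pi / 2) * (fact (2 * m) / (2 ^ (2 * m) * fact m)))"
      by (rule *) (use gaussian_moment_even_pos [of m] in \<open>simp add: m\<close>)
    ultimately show ?thesis by (simp add: m)
  next
    case False
    then obtain m where m: "j = 2 * m + 1" by (auto elim: oddE)
    have "real j / 2 + 1 = real m + 3 / 2" by (simp add: m field_simps)
    then have "Gamma (real j / 2 + 1) = sqrt pi * fact (2 * m + 1) / (2 ^ (2 * m + 1) * fact m)"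
      by (simp only: Gamma_half_odd)
    moreover have "(\<integral>\<^sup>+t. ennreal (t ^ j * exp (- t\<^sup>2)) * indicator {0..} t \<partial>lborel) = ennreal (fact m / 2)"
      by (rule *) (use gaussian_moment_odd_pos [of m] in \<open>simp add: m\<close>)
    ultimately show ?thesis by (simp add: m del: fact_Suc)
  qed
qed

lemma nn_integral_gauss_moment:
  assumes "b > 0"
  shows "(\<integral>\<^sup>+x. ennreal (x ^ j / fact j * exp (- (b * x\<^sup>2 / 2))) * indicator {0..} x \<partial>lborel) = ennreal (gauss_moment b j)"
proof -
  \<comment> \<open>The scaling for which
    \<open>b * (c * t)\<^sup>2 / 2 = t\<^sup>2\<close>.\<close>
  define c where "c = sqrt (2 / b)"
  have c: "c > 0" "c\<^sup>2 = 2 / b" using assms by (auto simp: c_def)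
  have "(\<integral>\<^sup>+x. ennreal (x ^ j / fact j * exp (- (b * x\<^sup>2 / 2))) * indicator {0..} x \<partial>lborel) =
      ennreal c * (\<integral>\<^sup>+t. ennreal ((c * t) ^ j / fact j * exp (- (b * (c * t)\<^sup>2 / 2))) * indicator {0..} (c * t) \<partial>lborel)"
    using c by (subst nn_integral_real_affine [where c = c and t = 0]) auto
  also have "(\<lambda>t. ennreal ((c * t) ^ j / fact j * exp (- (b * (c * t)\<^sup>2 / 2))) * indicator {0..} (c * t)) =
      (\<lambda>t. ennreal (c ^ j / fact j) * (ennreal (t ^ j * exp (- t\<^sup>2)) * indicator {0..} t))"
  proof
    fix t
    show "ennreal ((c * t) ^ j / fact j * exp (- (b * (c * t)\<^sup>2 / 2))) * indicator {0..} (c * t) =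
        ennreal (c ^ j / fact j) * (ennreal (t ^ j * exp (- t\<^sup>2)) * indicator {0..} t)"
    proof (cases "t \<ge> 0")
      case True
      have "b * (c * t)\<^sup>2 / 2 = t\<^sup>2" using assms by (simp add: power_mult_distrib c)
      then have "(c * t) ^ j / fact j * exp (- (b * (c * t)\<^sup>2 / 2)) = (c ^ j / fact j) * (t ^ j * exp (- t\<^sup>2))"
        by (simp add: power_mult_distrib)
      moreover have "ennreal ((c ^ j / fact j) * (t ^ j * exp (- t\<^sup>2))) = ennreal (c ^ j / fact j) * ennreal (t ^ j * exp (- t\<^sup>2))"
        by (rule ennreal_mult) (use True c in auto)
      moreover have "indicator {0..} (c * t) = (1 :: ennreal)" "indicator {0..} t = (1 :: ennreal)"
        using True c by auto
      ultimately show ?thesis by (simp only: mult_1_right)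
    next
      case False
      then show ?thesis using c by (simp add: indicator_def zero_le_mult_iff)
    qed
  qed
  also have "ennreal c * (\<integral>\<^sup>+t. ennreal (c ^ j / fact j) * (ennreal (t ^ j * exp (- t\<^sup>2)) * indicator {0..} t) \<partial>lborel) =
      ennreal c * (ennreal (c ^ j / fact j) * ennreal (sqrt pi * fact j / (2 ^ Suc j * Gamma (j / 2 + 1))))"
    by (subst nn_integral_cmult) (simp_all only: nn_integral_power_exp_square, measurable)
  also have "\<dots> = ennreal (c * (c ^ j / fact j * (sqrt pi * fact j / (2 ^ Suc j * Gamma (j / 2 + 1)))))"
  proof -
    have n: "0 \<le> c" "0 \<le> c ^ j / fact j" "0 \<le> sqrt pi * fact j / (2 ^ Suc j * Gamma (j / 2 + 1))"
      using c Gamma_real_pos [of "j / 2 + 1"] by auto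
    show ?thesis
      using ennreal_mult [OF n(2,3)] ennreal_mult [OF n(1) mult_nonneg_nonneg [OF n(2,3)]] by (simp only:)
  qed
  also have "c * (c ^ j / fact j * (sqrt pi * fact j / (2 ^ Suc j * Gamma (j / 2 + 1)))) = gauss_moment b j"
  proof -
    have "c / 2 = 1 / sqrt (2 * b)"
      using assms by (simp add: c_def real_sqrt_divide real_sqrt_mult field_simps)
    then have "(c / 2) ^ Suc j = 1 / sqrt (2 * b) ^ Suc j" by (simp only: power_one_over [symmetric])
    then have "gauss_moment b j = sqrt pi * (c / 2) ^ Suc j / Gamma (j / 2 + 1)"
      unfolding gauss_moment_def by (simp only: divide_divide_eq_left [symmetric] times_divide_eq_right mult_1_right)
    then show ?thesis by (simp add: power_divide)
  qed
  finally show ?thesis .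
qed

definition bridge_mass :: "nat \<Rightarrow> real" where
  "bridge_mass k = sqrt (2 * pi) ^ Suc k / sqrt (real k + 2)"

lemma bridge_mass_pos: "bridge_mass k > 0"
  by (simp add: bridge_mass_def)

lemma reduced_density_eq: "reduced_density k x = exp (- (bridge_ratio k * x\<^sup>2 / 2)) * bridge_egf k x"
proof -
  have "real k + 1 \<noteq> 0" "real k + 2 \<noteq> 0" by auto
  then have "- (x\<^sup>2 / (2 * (real k + 1) * (real k + 2))) + - (real k * x\<^sup>2 / (2 * (real k + 1))) = - (bridge_ratio k * x\<^sup>2 / 2)"
    by (simp add: bridge_ratio_def divide_simps) (simp add: algebra_simps)
  then show ?thesis
    unfolding reduced_density_def reduced_egf_def by (simp only: mult.assoc [symmetric] exp_add [symmetric])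
qed

text \<open>All terms are nonnegative, so integrating termwise needs no prior convergence;
  summability follows afterwards because the integral is finite.\<close>

lemma bridge_coeff_moment_sums:
  "(\<lambda>j. bridge_coeff k j * gauss_moment (bridge_ratio k) j) sums bridge_mass k"
proof -
  let ?b = "bridge_ratio k"
  have nonneg: "0 \<le> bridge_coeff k j * gauss_moment ?b j" for j
    using gauss_moment_pos [OF bridge_ratio_bounds(1)] by (simp add: bridge_coeff_nonneg less_imp_le)
  have "ennreal (bridge_mass k) = (\<integral>\<^sup>+x. ennreal (reduced_density k x) * indicator {0..} x \<partial>lborel)"
    by (simp only: nn_integral_reduced_density bridge_mass_def)
  also have "\<dots> = (\<integral>\<^sup>+x. (\<Sum>j. ennreal (bridge_coeff k j) * (ennreal (x ^ j / fact j * exp (- (?b * x\<^sup>2 / 2))) * indicator {0..} x)) \<partial>lborel)"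
  proof (intro nn_integral_cong)
    fix x :: real
    show "ennreal (reduced_density k x) * indicator {0..} x =
        (\<Sum>j. ennreal (bridge_coeff k j) * (ennreal (x ^ j / fact j * exp (- (?b * x\<^sup>2 / 2))) * indicator {0..} x))"
    proof (cases "x \<ge> 0")
      case True
      have sums: "(\<lambda>j. exp (- (?b * x\<^sup>2 / 2)) * (bridge_coeff k j / fact j * x ^ j)) sums reduced_density k x"
        unfolding reduced_density_eq bridge_egf_def
        by (intro sums_mult summable_sums summable_bridge_egf)
      have "ennreal (reduced_density k x) = (\<Sum>j. ennreal (exp (- (?b * x\<^sup>2 / 2)) * (bridge_coeff k j / fact j * x ^ j)))"
        using sums True by (subst suminf_ennreal2) (auto simp: sums_iff bridge_coeff_nonneg)
      also have "\<dots> = (\<Sum>j. ennreal (bridge_coeff k j) * ennreal (x ^ j / fact j * exp (- (?b * x\<^sup>2 / 2))))"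
        using True by (intro suminf_cong) (simp add: bridge_coeff_nonneg mult_ac flip: ennreal_mult)
      finally show ?thesis using True by simp
    qed simp
  qed
  also have "\<dots> = (\<Sum>j. \<integral>\<^sup>+x. ennreal (bridge_coeff k j) * (ennreal (x ^ j / fact j * exp (- (?b * x\<^sup>2 / 2))) * indicator {0..} x) \<partial>lborel)"
    by (rule nn_integral_suminf) measurable
  also have "\<dots> = (\<Sum>j. ennreal (bridge_coeff k j * gauss_moment ?b j))"
  proof (rule suminf_cong)
    fix j
    show "(\<integral>\<^sup>+x. ennreal (bridge_coeff k j) * (ennreal (x ^ j / fact j * exp (- (?b * x\<^sup>2 / 2))) * indicator {0..} x) \<partial>lborel) =
        ennreal (bridge_coeff k j * gauss_moment ?b j)"
      by (subst nn_integral_cmult, measurable, subst nn_integral_gauss_moment [OF bridge_ratio_bounds(1)])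
         (simp add: ennreal_mult' bridge_coeff_nonneg)
  qed
  finally have eq: "(\<Sum>j. ennreal (bridge_coeff k j * gauss_moment ?b j)) = ennreal (bridge_mass k)" ..
  then have summ: "summable (\<lambda>j. bridge_coeff k j * gauss_moment ?b j)"
    by (intro summable_suminf_not_top nonneg) simp
  then have "ennreal (\<Sum>j. bridge_coeff k j * gauss_moment ?b j) = ennreal (bridge_mass k)"
    using eq nonneg by (simp add: suminf_ennreal2)
  then have "(\<Sum>j. bridge_coeff k j * gauss_moment ?b j) = bridge_mass k"
    using bridge_mass_pos [of k] suminf_nonneg [OF summ nonneg] by (simp add: ennreal_inj)
  then show ?thesis using summ by (simp add: sums_iff)
qed

text \<open>The recurrence telescopes. Since
  \<open>gauss_moment b (j - 2) = b * j * gauss_moment b j\<close>, multiplying the recurrence for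
  \<open>bridge_coeff (Suc k) (Suc j)\<close> by \<open>gauss_moment (bridge_ratio k) j\<close> adds
  one term to the partial sum ending at \<open>j - 2\<close>.\<close>

lemma bridge_coeff_partial_sum:
  assumes "even (j + k)"
  shows "(\<Sum>i\<le>j. bridge_coeff k i * gauss_moment (bridge_ratio k) i) =
     bridge_coeff (Suc k) (Suc j) * gauss_moment (bridge_ratio k) j"
  using assms
proof (induction j rule: less_induct)
  case (less j)
  consider "j = 0" | "j = 1" | i where "j = Suc (Suc i)"
    by (metis One_nat_def not0_implies_Suc)
  then show ?case
  proof cases
    case 2
    then have "bridge_coeff k 0 = 0" using less.prems by (intro bridge_coeff_eq_0) auto
    then show ?thesis using 2 by (simp add: numeral_2_eq_2)
  next
    case (3 i)
    let ?g = "gauss_moment (bridge_ratio k)"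
    have "bridge_coeff k (Suc i) = 0" using less.prems 3 by (intro bridge_coeff_eq_0) auto
    moreover have "(\<Sum>l\<le>i. bridge_coeff k l * ?g l) = bridge_coeff (Suc k) (Suc i) * ?g i"
      using less.prems 3 by (intro less.IH) auto
    ultimately have "(\<Sum>l\<le>j. bridge_coeff k l * ?g l) = bridge_coeff (Suc k) (Suc i) * ?g i + bridge_coeff k j * ?g j"
      unfolding 3 by (simp del: bridge_coeff.simps)
    also have "?g i = ?g j * (bridge_ratio k * j)"
      using bridge_ratio_bounds(1) [of k] by (simp add: 3 gauss_moment_Suc_Suc add.commute)
    finally show ?thesis by (simp add: 3 algebra_simps del: bridge_coeff.simps(2))
  qed auto
qed

text \<open>The value that \<open>bridge_coeff (Suc k) (Suc j)\<close> would have if the partial sum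
  were replaced by the total.\<close>

definition leading_count :: "nat \<Rightarrow> nat \<Rightarrow> real" where
  "leading_count k j = bridge_mass k / gauss_moment (bridge_ratio k) j"

lemma leading_count_pos: "leading_count k j > 0"
  by (simp add: leading_count_def bridge_mass_pos gauss_moment_pos bridge_ratio_bounds)

lemma bridge_coeff_le_leading_count: "bridge_coeff (Suc k) (Suc j) \<le> leading_count k j"
proof (cases "even (j + k)")
  case True
  let ?g = "gauss_moment (bridge_ratio k)"
  have g: "?g i > 0" for i by (rule gauss_moment_pos [OF bridge_ratio_bounds(1)])
  have "(\<Sum>i<Suc j. bridge_coeff k i * ?g i) \<le> (\<Sum>i. bridge_coeff k i * ?g i)"
    using bridge_coeff_moment_sums g
    by (intro sum_le_suminf) (auto simp: sums_iff bridge_coeff_nonneg less_imp_le)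
  then have "bridge_coeff (Suc k) (Suc j) * ?g j \<le> bridge_mass k"
    using bridge_coeff_partial_sum [OF True] bridge_coeff_moment_sums [of k]
    by (simp add: sums_iff lessThan_Suc_atMost del: bridge_coeff.simps)
  then show ?thesis using g by (simp add: leading_count_def pos_le_divide_eq)
next
  case False
  then have "bridge_coeff (Suc k) (Suc j) = 0" by (intro bridge_coeff_eq_0) auto
  then show ?thesis using leading_count_pos [of k j] by simp
qed

text \<open>The error is the tail of the moment series. Its terms are at most \<open>q m\<close>, by
  the upper bound one level down, and \<open>q\<close> shrinks at each step at least by
  \<open>bridge_ratio k / bridge_ratio (Suc k) = 1 - 1 / (k + 2)^2\<close>. A geometric series with
  this ratio costs the factor \<open>(k + 2)^2\<close>.\<close>

lemma leading_count_le_bridge_coeff: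
  assumes "even (j + k)"
  shows "leading_count (Suc k) (Suc j) - (real k + 2)\<^sup>2 * leading_count k j \<le> bridge_coeff (Suc (Suc k)) (Suc (Suc j))"
proof -
  let ?g = "gauss_moment (bridge_ratio (Suc k))"
  let ?K = "(real k + 2)\<^sup>2"
  have g: "?g i > 0" for i by (rule gauss_moment_pos [OF bridge_ratio_bounds(1)])
  define P where "P m = (\<Sum>i\<le>Suc j + 2 * m. bridge_coeff (Suc k) i * ?g i)" for m
  \<comment> \<open>Bounds the terms beyond \<open>P 0\<close>. By parity only every second
    coefficient can be nonzero, hence the steps \<open>2 * m\<close>.\<close>
  define q where "q m = leading_count k (j + 2 * m) * ?g (Suc j + 2 * m)" for m
  have P: "P m = bridge_coeff (Suc (Suc k)) (Suc (Suc j + 2 * m)) * ?g (Suc j + 2 * m)" for m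
    unfolding P_def by (rule bridge_coeff_partial_sum) (use assms in auto)
  have q_pos: "q m > 0" for m by (simp add: q_def leading_count_pos g)
  have q_Suc: "q (Suc m) \<le> (1 - 1 / ?K) * q m" for m
  proof -
    let ?i = "j + 2 * m"
    have "leading_count k (Suc (Suc ?i)) = leading_count k ?i * (bridge_ratio k * (real ?i + 2))"
      using bridge_ratio_bounds(1) [of k] by (simp add: leading_count_def gauss_moment_Suc_Suc)
    moreover have "?g (Suc (Suc (Suc ?i))) = ?g (Suc ?i) / (bridge_ratio (Suc k) * (real (Suc ?i) + 2))"
      by (rule gauss_moment_Suc_Suc [OF bridge_ratio_bounds(1)])
    ultimately have "q (Suc m) = q m * (bridge_ratio k / bridge_ratio (Suc k)) * ((real ?i + 2) / (real ?i + 3))"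
      by (simp add: q_def) (simp add: divide_simps)
    also have "\<dots> \<le> q m * (bridge_ratio k / bridge_ratio (Suc k)) * 1"
      using q_pos [of m] bridge_ratio_bounds(1) [of k] bridge_ratio_bounds(1) [of "Suc k"]
      by (intro mult_left_mono mult_nonneg_nonneg divide_nonneg_nonneg) auto
    also have "bridge_ratio k / bridge_ratio (Suc k) = 1 - 1 / ?K"
    proof -
      have "real k + 2 \<noteq> 0" "real k + 3 \<noteq> 0" by auto
      then show ?thesis by (simp add: bridge_ratio_def divide_simps) (simp add: power2_eq_square algebra_simps)
    qed
    finally show ?thesis by (simp add: mult.commute)
  qed
  have step: "P (Suc m) \<le> P m + q (Suc m)" for m
  proof -
    have "bridge_coeff (Suc k) (Suc (Suc j + 2 * m)) = 0" using assms by (intro bridge_coeff_eq_0) auto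
    then have "P (Suc m) = P m + bridge_coeff (Suc k) (Suc (j + 2 * Suc m)) * ?g (Suc j + 2 * Suc m)"
      by (simp add: P_def del: bridge_coeff.simps)
    also have "\<dots> \<le> P m + leading_count k (j + 2 * Suc m) * ?g (Suc j + 2 * Suc m)"
      using g by (intro add_left_mono mult_right_mono bridge_coeff_le_leading_count) (auto simp: less_imp_le)
    finally show ?thesis by (simp add: q_def)
  qed
  \<comment> \<open>A potential argument in place of summing the geometric tail: the decay of
    \<open>q\<close> compensates the growth of \<open>P\<close>, so \<open>P m + ?K * q m\<close>
    never increases.\<close>
  have bound: "P m + ?K * q m \<le> P 0 + ?K * q 0" for m
  proof (induction m)
    case (Suc m)
    have K: "?K > 0" by simp
    have "P (Suc m) + ?K * q (Suc m) \<le> P m + (1 + ?K) * q (Suc m)"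
      using step [of m] by (simp add: algebra_simps)
    also have "\<dots> \<le> P m + (1 + ?K) * ((1 - 1 / ?K) * q m)"
      using K by (intro add_left_mono mult_left_mono q_Suc) auto
    also have "(1 + ?K) * (1 - 1 / ?K) = ?K - 1 / ?K"
      using K by (simp add: field_simps)
    then have "P m + (1 + ?K) * ((1 - 1 / ?K) * q m) = P m + (?K - 1 / ?K) * q m"
      by (simp only: mult.assoc [symmetric])
    also have "\<dots> \<le> P m + ?K * q m"
      using q_pos [of m] K by (intro add_left_mono mult_right_mono) auto
    finally show ?case using Suc.IH by linarith
  qed simp
  have "P \<longlonglongrightarrow> bridge_mass (Suc k)"
  proof -
    have "(\<lambda>n. \<Sum>i\<le>n. bridge_coeff (Suc k) i * ?g i) \<longlonglongrightarrow> bridge_mass (Suc k)"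
      using bridge_coeff_moment_sums [of "Suc k"] by (simp add: sums_def_le)
    moreover have "strict_mono (\<lambda>m. Suc j + 2 * m)" by (simp add: strict_mono_def)
    ultimately show ?thesis unfolding P_def [abs_def]
      by (rule LIMSEQ_subseq_LIMSEQ [unfolded comp_def])
  qed
  moreover have "P m \<le> P 0 + ?K * q 0" for m
  proof -
    have "0 \<le> ?K * q m" using q_pos [of m] by (simp add: less_imp_le)
    then show ?thesis using bound [of m] by linarith
  qed
  ultimately have "bridge_mass (Suc k) \<le> P 0 + ?K * q 0"
    by (intro LIMSEQ_le_const2) auto
  then have "bridge_mass (Suc k) / ?g (Suc j) \<le> (P 0 + ?K * q 0) / ?g (Suc j)"
    using g by (intro divide_right_mono) (auto simp: less_imp_le)
  moreover have "(P 0 + ?K * q 0) / ?g (Suc j) = bridge_coeff (Suc (Suc k)) (Suc (Suc j)) + ?K * leading_count k j"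
    using g [of "Suc j"] by (simp add: P q_def add_divide_distrib del: bridge_coeff.simps)
  ultimately show ?thesis by (simp add: leading_count_def)
qed

section \<open>Exact counts and log-concavity\<close>

text \<open>\<open>composition_matchings_rec\<close> and the third equation of
  \<open>bridge_coeff\<close> are the same recurrence once the second index is read as
  \<open>2 * N + k\<close>; both terms on its right lower \<open>N + k\<close>.\<close>

lemma composition_matchings_eq_bridge_coeff:
  "real (composition_matchings k (2 * N)) = bridge_coeff k (2 * N + k)"
proof (induction "N + k" arbitrary: N k rule: less_induct)
  case less
  show ?case
  proof (cases k)
    case 0
    then show ?thesis
      by (cases "N = 0") (auto simp: composition_matchings_0_right composition_matchings_0_left)
  next
    case (Suc m)
    show ?thesis
    proof (cases N)
      case 0
      have "real (composition_matchings m (2 * 0)) = bridge_coeff m (2 * 0 + m)"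
        by (rule less.hyps) (use Suc in auto)
      moreover have "bridge_coeff (Suc m) (m - 1) = 0" by (intro bridge_coeff_eq_0 disjI1) linarith
      ultimately show ?thesis by (simp add: 0 Suc composition_matchings_0_right)
    next
      case (Suc M)
      note k = \<open>k = Suc m\<close>
      have IH1: "real (composition_matchings m (2 * Suc M)) = bridge_coeff m (2 * Suc M + m)"
        by (rule less.hyps) (use Suc k in auto)
      have IH2: "real (composition_matchings (Suc m) (2 * M)) = bridge_coeff (Suc m) (2 * M + Suc m)"
        by (rule less.hyps) (use Suc k in auto)
      let ?C = "\<lambda>k s. real (composition_matchings k s)"
      have "(real m + 2) * ?C (Suc m) (2 * Suc M) =
          (real m + 2) * ?C m (2 * Suc M) + (real m + 1) * (2 * real M + real m + 2) * ?C (Suc m) (2 * M)"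
        using arg_cong [OF composition_matchings_rec [of m "2 * M"], of real] by (simp add: algebra_simps)
      then have "?C (Suc m) (2 * Suc M) = ?C m (2 * Suc M) + bridge_ratio m * (2 * real M + real m + 2) * ?C (Suc m) (2 * M)"
        by (simp add: bridge_ratio_def field_simps)
      also have "\<dots> = bridge_coeff (Suc m) (2 * Suc M + Suc m)"
        unfolding IH1 IH2 by (simp add: algebra_simps)
      finally show ?thesis by (simp only: Suc k)
    qed
  qed
qed

text \<open>The integer index makes log-concavity symmetric under reflection.\<close>

definition crystal_count :: "nat \<Rightarrow> int \<Rightarrow> real" where
  "crystal_count n i = (if i < 0 then 0 else bridge_coeff (nat i) (2 * n - nat i))"

lemma crystal_count_nonneg: "crystal_count n i \<ge> 0"
  by (simp add: crystal_count_def bridge_coeff_nonneg)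

lemma crystal_count_eq_0: "i < 0 \<or> i > int n \<Longrightarrow> crystal_count n i = 0"
  by (auto simp: crystal_count_def intro!: bridge_coeff_eq_0)

theorem card_crystallized_eq_crystal_count:
  "real (card {D\<in>crystallized_diagrams n. card (short_chords D) = k}) = crystal_count n (int k)"
proof (cases "k \<le> n")
  case True
  have "2 * n - 2 * k = 2 * (n - k)" "2 * n - k = 2 * (n - k) + k" using True by auto
  then show ?thesis
    using True by (simp add: card_crystallized_short crystal_count_def composition_matchings_eq_bridge_coeff)
next
  case False
  then show ?thesis by (simp add: card_crystallized_short crystal_count_eq_0)
qed

definition crystal_weight :: "nat \<Rightarrow> int \<Rightarrow> real" where
  "crystal_weight n i = of_int i / (of_int i + 1) * (2 * real n + 1 - of_int i)"

lemma crystal_count_Suc: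
  "crystal_count (Suc n) i = crystal_count n (i - 1) + crystal_weight n i * crystal_count n i"
proof -
  consider "i \<le> 0" | "i > int n + 1" | k where "i = int (Suc k)" "k \<le> n"
  proof -
    have "\<exists>k. i = int (Suc k) \<and> k \<le> n" if "0 < i" "i \<le> int n + 1"
      using that by (intro exI [of _ "nat (i - 1)"]) auto
    then show thesis using that by force
  qed
  then show ?thesis
  proof cases
    case 1
    then show ?thesis
      by (cases "i = 0") (auto simp: crystal_count_def crystal_weight_def intro: bridge_coeff_eq_0)
  next
    case 2
    then show ?thesis by (simp add: crystal_count_eq_0)
  next
    case (3 k)
    then have "2 * Suc n - Suc k = Suc (2 * n - k)" "2 * n - Suc k = (2 * n - k) - 1" by auto
    moreover have "crystal_weight n i = bridge_ratio k * real (2 * n - k)"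
      using 3 by (simp add: crystal_weight_def bridge_ratio_def of_nat_diff add_ac)
    ultimately show ?thesis using 3 by (simp add: crystal_count_def nat_add_distrib)
  qed
qed

lemma crystal_weight_nonneg: "0 \<le> i \<Longrightarrow> i \<le> 2 * int n + 1 \<Longrightarrow> crystal_weight n i \<ge> 0"
  unfolding crystal_weight_def by (intro mult_nonneg_nonneg divide_nonneg_nonneg) auto

text \<open>In partial fractions the weight is a linear function minus
  \<open>(2 * n + 2) / (i + 1)\<close>. The linear part cancels, and what remains is the convexity
  of the reciprocal.\<close>

lemma crystal_weight_concave:
  assumes "1 \<le> i" "i \<le> j"
  shows "crystal_weight n (i - 1) + crystal_weight n (j + 1) \<le> crystal_weight n i + crystal_weight n j"
proof -
  have eq: "crystal_weight n l = 2 * real n + 2 - of_int l - (2 * real n + 2) * (1 / (of_int l + 1))" if "l \<ge> 0" for l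
  proof -
    have "of_int l + 1 > (0::real)" using that by linarith
    then show ?thesis by (simp add: crystal_weight_def field_simps)
  qed
  define x y :: real where "x = of_int i" and "y = of_int j"
  have xy: "1 \<le> x" "x \<le> y" using assms by (auto simp: x_def y_def)
  have "1 / (x + 1) + 1 / (y + 1) \<le> 1 / x + 1 / (y + 2)"
  proof -
    have "1 / (y + 1) - 1 / (y + 2) = 1 / ((y + 1) * (y + 2))" using xy by (simp add: field_simps)
    also have "\<dots> \<le> 1 / (x * (x + 1))"
      using xy by (intro divide_left_mono mult_mono) auto
    also have "\<dots> = 1 / x - 1 / (x + 1)" using xy by (simp add: field_simps)
    finally show ?thesis by simp
  qed
  then have "(2 * real n + 2) * (1 / (x + 1) + 1 / (y + 1)) \<le> (2 * real n + 2) * (1 / x + 1 / (y + 2))"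
    by (intro mult_left_mono) auto
  then show ?thesis
    using assms by (simp add: eq x_def y_def add_ac distrib_left)
qed

text \<open>The factors \<open>i / (i + 1)\<close> and \<open>2 * n + 1 - i\<close> are compared
  separately, and the two inequalities are multiplied.\<close>

lemma crystal_weight_log_concave:
  assumes "1 \<le> i" "i \<le> j" "j \<le> 2 * int n"
  shows "crystal_weight n (i - 1) * crystal_weight n (j + 1) \<le> crystal_weight n i * crystal_weight n j"
proof -
  define x y X Y :: real where "x = of_int i" and "y = of_int j" and "X = 2 * real n + 1 - x" and "Y = 2 * real n + 1 - y"
  have xy: "1 \<le> x" "x \<le> y" "y \<le> 2 * real n" using assms by (auto simp: x_def y_def)
  have 1: "(X + 1) * (Y - 1) \<le> X * Y" using xy by (simp add: X_def Y_def algebra_simps)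
  have 2: "(x - 1) / x * ((y + 1) / (y + 2)) \<le> x / (x + 1) * (y / (y + 1))"
  proof -
    have "x\<^sup>2 \<le> (y + 1)\<^sup>2" using xy by (intro power_mono) auto
    then have "(x - 1) * (y + 1) * ((x + 1) * (y + 1)) \<le> x * y * (x * (y + 2))"
      by (simp add: power2_eq_square algebra_simps)
    moreover have "x * (y + 2) > 0" "(x + 1) * (y + 1) > 0" using xy by auto
    ultimately have "(x - 1) * (y + 1) / (x * (y + 2)) \<le> x * y / ((x + 1) * (y + 1))"
      by (simp only: pos_divide_le_eq times_divide_eq_left pos_le_divide_eq)
    then show ?thesis by (simp only: times_divide_times_eq)
  qed
  have "((x - 1) / x * ((y + 1) / (y + 2))) * ((X + 1) * (Y - 1)) \<le> (x / (x + 1) * (y / (y + 1))) * (X * Y)"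
  proof (rule mult_mono [OF 2 1])
    show "0 \<le> x / (x + 1) * (y / (y + 1))" using xy by auto
    show "0 \<le> (X + 1) * (Y - 1)" using xy by (simp add: X_def Y_def)
  qed
  moreover have "crystal_weight n (i - 1) = (x - 1) / x * (X + 1)" "crystal_weight n (j + 1) = (y + 1) / (y + 2) * (Y - 1)"
      "crystal_weight n i = x / (x + 1) * X" "crystal_weight n j = y / (y + 1) * Y"
    by (simp_all add: crystal_weight_def x_def y_def X_def Y_def add_ac)
  ultimately show ?thesis by (simp only: ac_simps)
qed

text \<open>Demanding the inequality for all \<open>i \<le> j\<close>, and not just for
  \<open>i = j\<close>, rules out zeros between positive values and gives the induction the mixed
  products it compares.\<close>

definition log_concave_int :: "(int \<Rightarrow> real) \<Rightarrow> bool" where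
  "log_concave_int f \<longleftrightarrow> (\<forall>i. f i \<ge> 0) \<and> (\<forall>i j. i \<le> j \<longrightarrow> f (i - 1) * f (j + 1) \<le> f i * f j)"

text \<open>Expanding both sides by the recurrence gives four products each. Those with no weight or
  with two weights compare one by one. The two with a single weight compare only in sum, and there
  concavity of the weight is needed besides log-concavity.\<close>

lemma log_concave_crystal_count: "log_concave_int (crystal_count n)"
proof (induction n)
  case 0
  have "crystal_count 0 (i - 1) * crystal_count 0 (j + 1) = 0" if "i \<le> j" for i j
    using that crystal_count_eq_0 [of "i - 1" 0] crystal_count_eq_0 [of "j + 1" 0] by (cases "i \<le> 0") auto
  then have "crystal_count 0 (i - 1) * crystal_count 0 (j + 1) \<le> crystal_count 0 i * crystal_count 0 j" if "i \<le> j" for i j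
    using that by (simp only: mult_nonneg_nonneg crystal_count_nonneg)
  then show ?case by (simp add: log_concave_int_def crystal_count_nonneg)
next
  case (Suc n)
  let ?x = "crystal_count n" and ?y = "crystal_count (Suc n)" and ?b = "crystal_weight n"
  have IH: "?x (i - 1) * ?x (j + 1) \<le> ?x i * ?x j" if "i \<le> j" for i j
    using Suc that by (simp add: log_concave_int_def)
  have "?y (i - 1) * ?y (j + 1) \<le> ?y i * ?y j" if "i \<le> j" for i j
  proof (cases "1 \<le> i \<and> j \<le> int n")
    case False
    then have "?y (i - 1) = 0 \<or> ?y (j + 1) = 0"
      using crystal_count_eq_0 [of "i - 1" "Suc n"] crystal_count_eq_0 [of "j + 1" "Suc n"]
      by (auto simp: crystal_count_def)
    then show ?thesis by (auto simp: crystal_count_nonneg)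
  next
    case True
    then have ij: "1 \<le> i" "i \<le> j" "j \<le> int n" using that by auto
    have b: "?b (i - 1) \<ge> 0" "?b i \<ge> 0" "?b j \<ge> 0" "?b (j + 1) \<ge> 0"
      using ij by (auto intro!: crystal_weight_nonneg)
    have x: "?x l \<ge> 0" for l by (rule crystal_count_nonneg)
    have conc: "?b (i - 1) + ?b (j + 1) \<le> ?b i + ?b j" by (rule crystal_weight_concave [OF ij(1,2)])
    have t1: "?x (i - 2) * ?x j \<le> ?x (i - 1) * ?x (j - 1)"
      using IH [of "i - 1" "j - 1"] ij by simp
    have t2: "?b (i - 1) * ?b (j + 1) * (?x (i - 1) * ?x (j + 1)) \<le> ?b i * ?b j * (?x i * ?x j)"
      using ij b x by (intro mult_mono crystal_weight_log_concave IH) auto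
    have t3: "?x (i - 2) * ?x (j + 1) \<le> ?x (i - 1) * ?x j"
      using IH [of "i - 1" j] ij by simp
    have t4: "?x (i - 1) * ?x j \<le> ?x i * ?x (j - 1)"
      using IH [of i "j - 1"] ij by (cases "i = j") (auto simp: mult.commute)
    have "?b (i - 1) * (?x (i - 1) * ?x j) + ?b (j + 1) * (?x (i - 2) * ?x (j + 1)) \<le>
        (?b (i - 1) + ?b (j + 1)) * (?x (i - 1) * ?x j)"
      using mult_left_mono [OF t3 b(4)] by (simp add: algebra_simps)
    also have "\<dots> \<le> (?b i + ?b j) * (?x (i - 1) * ?x j)"
      using conc x by (intro mult_right_mono) auto
    also have "\<dots> \<le> ?b i * (?x i * ?x (j - 1)) + ?b j * (?x (i - 1) * ?x j)"
      using mult_left_mono [OF t4 b(2)] by (simp add: algebra_simps)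
    finally have "(?x (i - 2) + ?b (i - 1) * ?x (i - 1)) * (?x j + ?b (j + 1) * ?x (j + 1)) \<le>
        (?x (i - 1) + ?b i * ?x i) * (?x (j - 1) + ?b j * ?x j)"
      using t1 t2 by (simp add: algebra_simps)
    then show ?thesis by (simp add: crystal_count_Suc)
  qed
  then show ?case by (simp add: log_concave_int_def crystal_count_nonneg)
qed

section \<open>Asymptotics near the typical number of short chords\<close>

text \<open>The constant \<open>pi\<close> matters for the centring: with \<open>ln n\<close> in its
  place the value would move by about the square of \<open>short_scale n\<close>, far out of the
  window, although the ratio would still tend to \<open>1\<close>.\<close>

definition typical_short :: "nat \<Rightarrow> real" where
  "typical_short n = sqrt (2 * real n / ln (real n / pi))"

text \<open>By the definition of \<open>t = typical_short n\<close>, its square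
  \<open>t / ln (n / pi)\<close> is the same as \<open>t ^ 3 / (2 * n)\<close>.\<close>

definition short_scale :: "nat \<Rightarrow> real" where
  "short_scale n = sqrt (typical_short n / ln (real n / pi))"

lemma typical_short_at_top: "filterlim typical_short at_top sequentially"
  unfolding typical_short_def [abs_def] by real_asymp

lemma short_scale_at_top: "filterlim short_scale at_top sequentially"
  unfolding typical_short_def [abs_def] short_scale_def [abs_def] by real_asymp

lemma short_scale_div_typical: "(\<lambda>n. short_scale n / typical_short n) \<longlonglongrightarrow> 0"
  unfolding typical_short_def short_scale_def by real_asymp

lemma short_scale_mult_typical: "(\<lambda>n. short_scale n * typical_short n / real n) \<longlonglongrightarrow> 0"
  unfolding typical_short_def short_scale_def by real_asymp

lemma typical_short_div_n: "(\<lambda>n. typical_short n / real n) \<longlonglongrightarrow> 0"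
  unfolding typical_short_def by real_asymp

lemma typical_short_sq_div_n: "(\<lambda>n. (typical_short n)\<^sup>2 / real n) \<longlonglongrightarrow> 0"
  unfolding typical_short_def by real_asymp

lemma typical_short_asymp_equiv: "typical_short \<sim>[at_top] (\<lambda>n. sqrt (2 * real n / ln (real n)))"
  unfolding typical_short_def [abs_def] by real_asymp

text \<open>The functional equation makes \<open>ln y\<close> the increment of
  \<open>ln_Gamma\<close> from \<open>y\<close> to \<open>y + 1\<close>, hence a value of
  \<open>Digamma\<close> in between; monotonicity of \<open>Digamma\<close> does the rest.\<close>

lemma Digamma_real_bounds:
  assumes "x > (1::real)" shows "ln (x - 1) \<le> Digamma x" "Digamma x \<le> ln x"
proof -
  have step: "ln_Gamma (y + 1) - ln_Gamma y = ln y" if "y > 0" for y :: real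
  proof -
    have "Gamma y \<noteq> 0" using Gamma_real_pos [OF that] by linarith
    then show ?thesis using that by (simp add: ln_Gamma_real_pos Gamma_plus1_real ln_mult)
  qed
  have mvt: "\<exists>z. y < z \<and> z < y + 1 \<and> ln y = Digamma z" if y: "y > 0" for y :: real
  proof -
    have "\<exists>z. y < z \<and> z < y + 1 \<and> ln_Gamma (y + 1) - ln_Gamma y = (y + 1 - y) * Digamma z"
      using y by (intro MVT2) (auto intro!: has_field_derivative_ln_Gamma_real)
    then show ?thesis using step [OF y] by auto
  qed
  obtain z where "x - 1 < z" "z < x" "ln (x - 1) = Digamma z" using mvt [of "x - 1"] assms by auto
  then show "ln (x - 1) \<le> Digamma x" using assms by (simp add: Digamma_real_mono)
  obtain z where "x < z" "ln x = Digamma z" using mvt [of x] assms by auto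
  then show "Digamma x \<le> ln x" using assms by (simp add: Digamma_real_mono)
qed

lemma ln_Gamma_diff_bounds:
  assumes "1 < (a::real)" "a \<le> b"
  shows "(b - a) * ln (a - 1) \<le> ln (Gamma b) - ln (Gamma a)"
        "ln (Gamma b) - ln (Gamma a) \<le> (b - a) * ln b"
proof -
  have *: "(b - a) * ln (a - 1) \<le> ln (Gamma b) - ln (Gamma a) \<and> ln (Gamma b) - ln (Gamma a) \<le> (b - a) * ln b"
  proof (cases "a = b")
    case False
    then have "\<exists>z. a < z \<and> z < b \<and> ln_Gamma b - ln_Gamma a = (b - a) * Digamma z"
      using assms by (intro MVT2) (auto intro!: has_field_derivative_ln_Gamma_real)
    then obtain z where z: "a < z" "z < b" "ln_Gamma b - ln_Gamma a = (b - a) * Digamma z" by blast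
    have "ln (a - 1) \<le> ln (z - 1)" "ln z \<le> ln b" using assms z by auto
    then have "ln (a - 1) \<le> Digamma z" "Digamma z \<le> ln b"
      using Digamma_real_bounds [of z] assms z by linarith+
    then have "(b - a) * ln (a - 1) \<le> (b - a) * Digamma z" "(b - a) * Digamma z \<le> (b - a) * ln b"
      using assms by (auto intro!: mult_left_mono)
    then show ?thesis using z assms by (simp add: ln_Gamma_real_pos)
  qed simp
  then show "(b - a) * ln (a - 1) \<le> ln (Gamma b) - ln (Gamma a)"
        "ln (Gamma b) - ln (Gamma a) \<le> (b - a) * ln b" by auto
qed

text \<open>The logarithms in the previous bounds are replaced by \<open>ln n\<close>. The
  hypotheses keep all their arguments above \<open>n / 2\<close>, where the slope of
  \<open>ln\<close> is at most \<open>2 / n\<close>.\<close>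

lemma ln_Gamma_diff_approx:
  assumes "real n / 2 + 1 < a" "real n / 2 + 1 < b" "n > 0"
  shows "\<bar>ln (Gamma b) - ln (Gamma a) - (b - a) * ln (real n)\<bar> \<le> \<bar>b - a\<bar> * (2 * (\<bar>a - real n\<bar> + \<bar>b - real n\<bar> + 1) / real n)"
proof -
  have ln_close: "\<bar>ln t - ln (real n)\<bar> \<le> 2 * \<bar>t - real n\<bar> / real n" if "t > real n / 2" for t
  proof -
    have t: "t > 0" using that assms(3) by (simp add: order.strict_trans1 [of 0 "real n / 2"])
    have "ln (t / n) \<le> t / n - 1" using t assms(3) by (intro ln_le_minus_one) auto
    then have 1: "ln t - ln n \<le> (t - n) / n" using t assms(3) by (simp add: ln_div field_simps)
    have "ln (n / t) \<le> n / t - 1" using t assms(3) by (intro ln_le_minus_one) auto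
    then have 2: "ln n - ln t \<le> (n - t) / t" using t assms(3) by (simp add: ln_div field_simps)
    have 3: "(t - n) / n \<le> 2 * \<bar>t - n\<bar> / n" using assms(3) by (intro divide_right_mono) (auto simp: abs_if)
    have "(n - t) / t \<le> \<bar>t - n\<bar> / t" using t by (intro divide_right_mono) (auto simp: abs_if)
    also have "\<dots> \<le> \<bar>t - n\<bar> / (n / 2)" using that assms(3) by (intro divide_left_mono mult_pos_pos t) auto
    finally have "(n - t) / t \<le> 2 * \<bar>t - n\<bar> / n" by (simp add: mult.commute)
    then show ?thesis unfolding abs_le_iff using 1 2 3 by linarith
  qed
  have main: "\<bar>ln (Gamma d) - ln (Gamma c) - (d - c) * ln (real n)\<bar> \<le> (d - c) * (2 * (\<bar>c - real n\<bar> + \<bar>d - real n\<bar> + 1) / real n)"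
    if cd: "c \<le> d" "real n / 2 + 1 < c" for c d
  proof -
    have c1: "1 < c" using cd assms(3) by (simp add: order.strict_trans1 [of 1 "real n / 2 + 1"])
    let ?e = "2 * (\<bar>c - real n\<bar> + \<bar>d - real n\<bar> + 1) / real n"
    have "\<bar>ln (c - 1) - ln (real n)\<bar> \<le> 2 * \<bar>c - 1 - real n\<bar> / real n" using cd by (intro ln_close) auto
    also have "\<dots> \<le> ?e" using assms(3) by (intro divide_right_mono) (auto simp: abs_if)
    finally have e1: "ln (real n) - ?e \<le> ln (c - 1)" by linarith
    have "\<bar>ln d - ln (real n)\<bar> \<le> 2 * \<bar>d - real n\<bar> / real n" using cd by (intro ln_close) auto
    also have "\<dots> \<le> ?e" using assms(3) by (intro divide_right_mono) (auto simp: abs_if)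
    finally have e2: "ln d \<le> ln (real n) + ?e" by linarith
    have "(d - c) * (ln (real n) - ?e) \<le> (d - c) * ln (c - 1)" using e1 cd by (intro mult_left_mono) auto
    moreover have "(d - c) * ln d \<le> (d - c) * (ln (real n) + ?e)" using e2 cd by (intro mult_left_mono) auto
    ultimately show ?thesis
      using ln_Gamma_diff_bounds [OF c1 cd(1)] by (simp only: abs_le_iff algebra_simps) linarith
  qed
  show ?thesis
  proof (cases "a \<le> b")
    case True
    then show ?thesis using main [OF True assms(1)] by simp
  next
    case False
    then have "b \<le> a" by simp
    have "\<bar>ln (Gamma b) - ln (Gamma a) - (b - a) * ln (real n)\<bar> = \<bar>ln (Gamma a) - ln (Gamma b) - (a - b) * ln (real n)\<bar>"
      by (simp add: algebra_simps abs_minus_commute)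
    also have "\<dots> \<le> (a - b) * (2 * (\<bar>b - real n\<bar> + \<bar>a - real n\<bar> + 1) / real n)"
      by (rule main [OF \<open>b \<le> a\<close> assms(2)])
    also have "a - b = \<bar>b - a\<bar>" using \<open>b \<le> a\<close> by simp
    finally show ?thesis by (simp only: ac_simps)
  qed
qed

text \<open>The quantity \<open>E(n, K)\<close>; the subtractions are truncated, so this is meaningful for \<open>1 \<le> K < n\<close> only.\<close>

definition leading_diagrams :: "nat \<Rightarrow> nat \<Rightarrow> real" where
  "leading_diagrams n K = leading_count (K - 1) (2 * n - K - 1)"

lemma leading_diagrams_pos: "leading_diagrams n K > 0"
  by (simp add: leading_diagrams_def leading_count_pos)

lemma crystal_count_bounds:
  assumes "2 \<le> K" "K < n"
  shows "crystal_count n (int K) \<le> leading_diagrams n K"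
    and "leading_diagrams n K - (real K)\<^sup>2 * leading_diagrams (n - 1) (K - 1) \<le> crystal_count n (int K)"
proof -
  define k j where "k = K - 2" and "j = 2 * n - K - 2"
  have eqs: "K = Suc (Suc k)" "2 * n - K = Suc (Suc j)" "K - 1 = Suc k" "2 * n - K - 1 = Suc j"
    "K - 1 - 1 = k" "2 * (n - 1) - (K - 1) - 1 = j" "even (j + k)" "real K = real k + 2"
    using assms by (auto simp: k_def j_def)
  have cc: "crystal_count n (int K) = bridge_coeff (Suc (Suc k)) (Suc (Suc j))"
  proof -
    have "crystal_count n (int K) = bridge_coeff K (2 * n - K)" by (simp add: crystal_count_def)
    then show ?thesis unfolding eqs(2) unfolding eqs(1) .
  qed
  show "crystal_count n (int K) \<le> leading_diagrams n K"
    unfolding cc leading_diagrams_def eqs(3,4) by (rule bridge_coeff_le_leading_count)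
  show "leading_diagrams n K - (real K)\<^sup>2 * leading_diagrams (n - 1) (K - 1) \<le> crystal_count n (int K)"
    unfolding cc leading_diagrams_def eqs(5,6) unfolding eqs(3,4,8)
    by (rule leading_count_le_bridge_coeff [OF eqs(7)])
qed

lemma ln_leading_diagrams:
  assumes "1 \<le> K" "K < n"
  shows "ln (leading_diagrams n K) = real K * (ln (2 * pi) / 2) - ln (real K + 1) / 2
    + (2 * real n - real K) / 2 * ln (2 * (real K / (real K + 1)))
    + ln (Gamma (real n - (real K - 1) / 2)) - ln pi / 2"
proof -
  define j where "j = 2 * n - K - 1"
  have Sj: "Suc j = 2 * n - K" "real (Suc j) = 2 * real n - real K" using assms by (auto simp: j_def of_nat_diff)
  have G: "real j / 2 + 1 = real n - (real K - 1) / 2" using Sj(2) by (simp add: field_simps)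
  have SK: "Suc (K - 1) = K" using assms by simp
  have K2: "real (K - 1) + 2 = real K + 1" using assms by (simp add: of_nat_diff)
  have br: "bridge_ratio (K - 1) = real K / (real K + 1)" using assms by (simp add: bridge_ratio_def of_nat_diff)
  define b where "b = 2 * (real K / (real K + 1))"
  have b: "b > 0" using assms by (simp add: b_def)
  define g where "g = Gamma (real n - (real K - 1) / 2)"
  have g: "g > 0" unfolding g_def G [symmetric] by (intro Gamma_real_pos add_nonneg_pos) auto
  have "leading_diagrams n K = sqrt (2 * pi) ^ K / sqrt (real K + 1) / (sqrt pi / (sqrt b ^ Suc j * g))"
    unfolding leading_diagrams_def leading_count_def bridge_mass_def gauss_moment_def j_def [symmetric] SK K2 G br b_def g_def
    by simp
  also have "\<dots> = sqrt (2 * pi) ^ K * (sqrt b ^ Suc j * g) / (sqrt (real K + 1) * sqrt pi)"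
    by simp
  finally have "ln (leading_diagrams n K) =
     real K * ln (sqrt (2 * pi)) + (real (Suc j) * ln (sqrt b) + ln g) - (ln (sqrt (real K + 1)) + ln (sqrt pi))"
    using b g by (simp add: ln_div ln_mult ln_realpow del: power_Suc of_nat_Suc)
  from this [unfolded Sj(2)] show ?thesis
    using b by (simp add: ln_sqrt b_def g_def)
qed

text \<open>Numbers of chords are integers, so \<open>t + s * x\<close> is met only up to rounding;
  the limit form absorbs every error that is small compared with \<open>s\<close>.\<close>

definition near_typical :: "(nat \<Rightarrow> nat) \<Rightarrow> real \<Rightarrow> bool" where
  "near_typical K x \<longleftrightarrow> ((\<lambda>n. (real (K n) - typical_short n) / short_scale n) \<longlonglongrightarrow> x)"

text \<open>Expressed through \<open>t\<close> and \<open>s\<close>, both \<open>n\<close> and its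
  logarithm are rational, so the estimates in the window become algebra in \<open>t\<close> and
  \<open>s\<close>. Starting at \<open>4\<close> ensures \<open>n > pi\<close>.\<close>

lemma typical_identities:
  "eventually (\<lambda>n. typical_short n > 0 \<and> short_scale n > 0 \<and> real n > 0 \<and>
     real n = typical_short n ^ 3 / (2 * (short_scale n)\<^sup>2) \<and>
     ln (real n / pi) = typical_short n / (short_scale n)\<^sup>2) sequentially"
  using eventually_ge_at_top [of "4::nat"]
proof eventually_elim
  case (elim n)
  define l where "l = ln (real n / pi)"
  have "real n / pi > 1" using elim pi_less_4 by (simp add: field_simps)
  then have l: "l > 0" unfolding l_def by (rule ln_gt_zero)
  have n: "real n > 0" using elim by simp
  define t s where "t = typical_short n" and "s = short_scale n"
  have t: "t > 0" "t\<^sup>2 = 2 * real n / l" using l n by (simp_all add: t_def typical_short_def l_def [symmetric])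
  have s: "s > 0" "s\<^sup>2 = t / l" using l n t(1) by (simp_all add: s_def short_scale_def l_def [symmetric] t_def [symmetric])
  have 1: "l = t / s\<^sup>2" using s t l by (simp add: field_simps)
  have "real n = t\<^sup>2 * l / 2" using t l by simp
  also have "\<dots> = t ^ 3 / (2 * s\<^sup>2)" unfolding 1 by (simp add: power2_eq_square power3_eq_cube)
  finally show ?case using t(1) s(1) n 1 by (simp add: t_def s_def l_def)
qed

context
  fixes K :: "nat \<Rightarrow> nat" and x :: real
  assumes near: "near_typical K x"
begin

lemma near_typical_ratio: "(\<lambda>n. real (K n) / typical_short n) \<longlonglongrightarrow> 1"
proof -
  have "(\<lambda>n. 1 + (real (K n) - typical_short n) / short_scale n * (short_scale n / typical_short n)) \<longlonglongrightarrow> 1 + x * 0"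
    using near unfolding near_typical_def by (intro tendsto_intros short_scale_div_typical)
  moreover have "eventually (\<lambda>n. 1 + (real (K n) - typical_short n) / short_scale n * (short_scale n / typical_short n) =
      real (K n) / typical_short n) sequentially"
    using typical_identities by eventually_elim (simp add: field_simps)
  ultimately have "(\<lambda>n. real (K n) / typical_short n) \<longlonglongrightarrow> 1 + x * 0"
    by (rule Lim_transform_eventually)
  then show ?thesis by simp
qed

lemma near_typical_at_top: "filterlim (\<lambda>n. real (K n)) at_top sequentially"
proof -
  have "filterlim (\<lambda>n. real (K n) / typical_short n * typical_short n) at_top sequentially"
    by (rule filterlim_tendsto_pos_mult_at_top [OF near_typical_ratio _ typical_short_at_top]) simp
  moreover have "eventually (\<lambda>n. real (K n) / typical_short n * typical_short n = real (K n)) sequentially"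
    using typical_identities by eventually_elim simp
  ultimately show ?thesis using filterlim_cong [OF refl refl] by metis
qed

lemma near_typical_inverse_ratio: "(\<lambda>n. typical_short n / real (K n)) \<longlonglongrightarrow> 1"
  using tendsto_inverse [OF near_typical_ratio] by (simp add: divide_inverse mult.commute)

lemma near_typical_div_n: "(\<lambda>n. real (K n) / real n) \<longlonglongrightarrow> 0"
proof -
  have "(\<lambda>n. real (K n) / typical_short n * (typical_short n / real n)) \<longlonglongrightarrow> 1 * 0"
    by (intro tendsto_intros near_typical_ratio typical_short_div_n)
  moreover have "eventually (\<lambda>n. real (K n) / typical_short n * (typical_short n / real n) = real (K n) / real n) sequentially"
    using typical_identities by eventually_elim simp
  ultimately have "(\<lambda>n. real (K n) / real n) \<longlonglongrightarrow> 1 * 0"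
    by (rule Lim_transform_eventually)
  then show ?thesis by simp
qed

lemma near_typical_range: "eventually (\<lambda>n. 2 \<le> K n \<and> K n < n \<and> 4 * real (K n) + 8 < real n) sequentially"
proof -
  have "eventually (\<lambda>n. real (K n) \<ge> 2) sequentially"
    using near_typical_at_top unfolding filterlim_at_top by blast
  moreover have "eventually (\<lambda>n. real (K n) / real n < 1 / 8) sequentially"
    by (rule order_tendstoD(2) [OF near_typical_div_n]) simp
  ultimately show ?thesis
    using eventually_gt_at_top [of 16] by eventually_elim (simp add: field_simps)
qed

end

text \<open>The derivative \<open>u / (1 + u)\<close> of \<open>u - ln (1 + u)\<close> is at most
  \<open>u\<close>. This second-order smallness has to beat a factor \<open>n\<close> later.\<close>

lemma diff_ln_one_plus_bound:
  assumes "0 < (u::real)" "0 < v"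
  shows "\<bar>(u - ln (1 + u)) - (v - ln (1 + v))\<bar> \<le> \<bar>u - v\<bar> * (u + v)"
proof -
  have *: "\<bar>(u - ln (1 + u)) - (v - ln (1 + v))\<bar> \<le> \<bar>u - v\<bar> * (u + v)" if uv: "0 < v" "v \<le> u" for u v :: real
  proof -
    have "ln ((1 + u) / (1 + v)) \<le> (1 + u) / (1 + v) - 1" using uv by (intro ln_le_minus_one) auto
    also have "\<dots> = (u - v) / (1 + v)" using uv by (simp add: field_simps)
    also have "\<dots> \<le> u - v" using uv by (simp add: divide_le_eq mult_le_cancel_left1)
    finally have 1: "ln (1 + u) - ln (1 + v) \<le> u - v" using uv by (simp add: ln_div)
    have "ln ((1 + v) / (1 + u)) \<le> (1 + v) / (1 + u) - 1" using uv by (intro ln_le_minus_one) auto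
    also have "\<dots> = - ((u - v) * (1 / (1 + u)))" using uv by (simp add: field_simps)
    finally have "(u - v) * (1 / (1 + u)) \<le> ln (1 + u) - ln (1 + v)" using uv by (simp add: ln_div)
    moreover have "(u - v) * (1 - u) \<le> (u - v) * (1 / (1 + u))"
      using uv by (intro mult_left_mono) (auto simp: field_simps)
    ultimately have "(u - v) * (1 - u) \<le> ln (1 + u) - ln (1 + v)" by linarith
    moreover have "(u - v) * (1 - u) = (u - v) - (u - v) * u" by (simp add: algebra_simps)
    moreover have "(u - v) * u \<le> (u - v) * (u + v)" using uv by (intro mult_left_mono) auto
    ultimately show ?thesis using 1 uv by (simp add: abs_if)
  qed
  show ?thesis
  proof (cases "v \<le> u")
    case True then show ?thesis using * assms by blast
  next
    case False
    then show ?thesis using * [of u v] assms by (simp add: abs_minus_commute add.commute)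
  qed
qed

text \<open>The limits \<open>x\<close> and \<open>z\<close> enter only through the main part
  \<open>T\<close>; every other part of the logarithm vanishes throughout the window. In
  \<open>T\<close> the powers of \<open>2\<close> cancel between the mass and the bridge ratio,
  which leaves \<open>ln (n / pi)\<close>.\<close>

theorem ln_leading_diagrams_ratio:
  assumes K: "near_typical K x" and M: "near_typical M z"
  shows "(\<lambda>n. ln (leading_diagrams n (K n)) - ln (leading_diagrams n (M n))) \<longlonglongrightarrow> (z\<^sup>2 - x\<^sup>2) / 2"
proof -
  define a where "a n = (real (K n) - typical_short n) / short_scale n" for n
  define b where "b n = (real (M n) - typical_short n) / short_scale n" for n
  have a: "a \<longlonglongrightarrow> x" and b: "b \<longlonglongrightarrow> z"
    using K M by (simp_all add: near_typical_def a_def [abs_def] b_def [abs_def])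
  let ?t = typical_short and ?s = short_scale
  let ?P = "\<lambda>K n. real n - (real (K n) - 1) / 2"
  have inv_s: "(\<lambda>n. 1 / ?s n) \<longlonglongrightarrow> 0"
    by (rule real_tendsto_divide_at_top [OF tendsto_const short_scale_at_top])
  note ev = typical_identities near_typical_range [OF K] near_typical_range [OF M]
  \<comment> \<open>The difference splits as \<open>T + D1 - D2 + D3 + D4\<close>. \<open>D1\<close>
    is the error of replacing the Gamma quotient by a power of \<open>n\<close>, and
    \<open>D2\<close> comes from \<open>1 / sqrt (K + 1)\<close>. \<open>D3\<close> and
    \<open>D4\<close> arise from \<open>(n - K / 2) * ln (1 + 1 / K)\<close> beyond its main part
    \<open>n / K\<close>.\<close>
  define D1 where "D1 n = ln (Gamma (?P K n)) - ln (Gamma (?P M n)) - (?P K n - ?P M n) * ln (real n)" for n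
  define D2 where "D2 n = ln (real (K n) + 1) / 2 - ln (real (M n) + 1) / 2" for n
  define D3 where "D3 n = real n * ((1 / real (K n) - ln (1 + 1 / real (K n))) - (1 / real (M n) - ln (1 + 1 / real (M n))))" for n
  define D4 where "D4 n = real (K n) / 2 * ln (1 + 1 / real (K n)) - real (M n) / 2 * ln (1 + 1 / real (M n))" for n
  define T where "T n = - (real (K n) - real (M n)) / 2 * ln (real n / pi) - real n / real (K n) + real n / real (M n)" for n
  have D1: "D1 \<longlonglongrightarrow> 0"
  proof (rule Lim_null_comparison)
    let ?B = "\<lambda>n. \<bar>a n - b n\<bar> / 2 * ((real (K n) / ?t n + real (M n) / ?t n) * (?s n * ?t n / real n) + 8 * (?s n / ?t n * (?t n / real n)))"
    show "eventually (\<lambda>n. norm (D1 n) \<le> ?B n) sequentially"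
      using ev
    proof eventually_elim
      case (elim n)
      have r: "4 * real (K n) + 8 < real n" "4 * real (M n) + 8 < real n" "0 < n" using elim by auto
      have nonneg: "0 \<le> real (K n)" "0 \<le> real (M n)" by simp_all
      have PM: "real n / 2 + 1 < ?P M n" using r(2) nonneg(2) by (simp add: field_simps)
      have PK: "real n / 2 + 1 < ?P K n" using r(1) nonneg(1) by (simp add: field_simps)
      have "norm (D1 n) \<le> \<bar>?P K n - ?P M n\<bar> * (2 * (\<bar>?P M n - real n\<bar> + \<bar>?P K n - real n\<bar> + 1) / real n)"
        unfolding D1_def real_norm_def by (rule ln_Gamma_diff_approx [OF PM PK r(3)])
      also have "\<dots> \<le> \<bar>?P K n - ?P M n\<bar> * ((real (K n) + real (M n) + 8) / real n)"
        using elim by (intro mult_left_mono divide_right_mono) (auto simp: abs_if field_simps)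
      also have "\<bar>?P K n - ?P M n\<bar> = ?s n * (\<bar>a n - b n\<bar> / 2)"
      proof -
        have "?P K n - ?P M n = - (?s n * ((a n - b n) / 2))"
          using elim by (simp add: a_def b_def field_simps)
        then show ?thesis using elim by (simp add: abs_mult)
      qed
      also have "?s n * (\<bar>a n - b n\<bar> / 2) * ((real (K n) + real (M n) + 8) / real n) = ?B n"
        using elim by (simp add: field_simps)
      finally show ?case .
    qed
    have "?B \<longlonglongrightarrow> \<bar>x - z\<bar> / 2 * ((1 + 1) * 0 + 8 * (0 * 0))"
      by (intro tendsto_intros a b near_typical_ratio [OF K] near_typical_ratio [OF M]
          short_scale_mult_typical short_scale_div_typical typical_short_div_n) auto
    then show "?B \<longlonglongrightarrow> 0" by simp
  qed
  have D2: "D2 \<longlonglongrightarrow> 0"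
  proof -
    have inv: "(\<lambda>n. 1 / real (M n)) \<longlonglongrightarrow> 0"
      by (rule real_tendsto_divide_at_top [OF tendsto_const near_typical_at_top [OF M]])
    have "(\<lambda>n. ln ((real (K n) / ?t n * (?t n / real (M n)) + 1 / real (M n)) / (1 + 1 / real (M n))) / 2) \<longlonglongrightarrow> ln ((1 * 1 + 0) / (1 + 0)) / 2"
      by (intro tendsto_intros near_typical_ratio [OF K] near_typical_inverse_ratio [OF M] inv) auto
    moreover have "eventually (\<lambda>n. ln ((real (K n) / ?t n * (?t n / real (M n)) + 1 / real (M n)) / (1 + 1 / real (M n))) / 2 = D2 n) sequentially"
      using ev
    proof eventually_elim
      case (elim n)
      then have "real (M n) > 0" by simp
      then have "(real (K n) / ?t n * (?t n / real (M n)) + 1 / real (M n)) / (1 + 1 / real (M n)) = (real (K n) + 1) / (real (M n) + 1)"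
        using elim by (simp add: divide_simps)
      then show ?case by (simp add: D2_def ln_div diff_divide_distrib)
    qed
    ultimately have "D2 \<longlonglongrightarrow> ln ((1 * 1 + 0) / (1 + 0)) / 2"
      by (rule Lim_transform_eventually)
    then show ?thesis by simp
  qed
  have D3: "D3 \<longlonglongrightarrow> 0"
  proof (rule Lim_null_comparison)
    \<comment> \<open>The order is \<open>n * (s / t^2) * (1 / t)\<close>, which is
      \<open>1 / s\<close> up to a constant because \<open>n = t ^ 3 / (2 * s^2)\<close>.\<close>
    let ?B = "\<lambda>n. \<bar>a n - b n\<bar> * (?t n / real (K n)) * (?t n / real (M n)) * (?t n / real (K n) + ?t n / real (M n)) * (1 / ?s n) / 2"
    show "eventually (\<lambda>n. norm (D3 n) \<le> ?B n) sequentially"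
      using ev
    proof eventually_elim
      case (elim n)
      define p q t s where "p = real (K n)" and "q = real (M n)" and "t = ?t n" and "s = ?s n"
      have pos: "p > 0" "q > 0" "t > 0" "s > 0" using elim by (auto simp: p_def q_def t_def s_def)
      have n: "real n = t ^ 3 / (2 * s\<^sup>2)" using elim by (simp add: t_def s_def)
      have "norm (D3 n) = real n * \<bar>(1 / p - ln (1 + 1 / p)) - (1 / q - ln (1 + 1 / q))\<bar>"
        by (simp add: D3_def p_def q_def abs_mult)
      also have "\<dots> \<le> real n * (\<bar>1 / p - 1 / q\<bar> * (1 / p + 1 / q))"
        using pos by (intro mult_left_mono diff_ln_one_plus_bound) auto
      also have "1 / p - 1 / q = - (s * (a n - b n)) / (p * q)"
        using pos by (simp add: a_def b_def p_def [symmetric] q_def [symmetric] t_def [symmetric] s_def [symmetric] field_simps)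
      also have "\<bar>- (s * (a n - b n)) / (p * q)\<bar> = s * \<bar>a n - b n\<bar> / (p * q)"
        using pos by (simp add: abs_mult)
      also have "real n * (s * \<bar>a n - b n\<bar> / (p * q) * (1 / p + 1 / q)) =
          \<bar>a n - b n\<bar> * (t / p) * (t / q) * (t / p + t / q) * (1 / s) / 2"
        unfolding n using pos by (simp add: field_simps power2_eq_square power3_eq_cube)
      finally show ?case by (simp only: p_def q_def t_def s_def)
    qed
    have "?B \<longlonglongrightarrow> \<bar>x - z\<bar> * 1 * 1 * (1 + 1) * 0 / 2"
      by (intro tendsto_intros a b near_typical_inverse_ratio [OF K] near_typical_inverse_ratio [OF M] inv_s) auto
    then show "?B \<longlonglongrightarrow> 0" by simp
  qed
  have D4: "D4 \<longlonglongrightarrow> 0"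
  proof -
    have lim: "((\<lambda>u::real. u / 2 * ln (1 + 1 / u)) \<longlongrightarrow> 1 / 2) at_top" by real_asymp
    have "D4 \<longlonglongrightarrow> 1 / 2 - 1 / 2"
      unfolding D4_def [abs_def]
      by (intro tendsto_diff filterlim_compose [OF lim near_typical_at_top [OF K]] filterlim_compose [OF lim near_typical_at_top [OF M]])
    then show ?thesis by simp
  qed
  have T: "T \<longlonglongrightarrow> (z\<^sup>2 - x\<^sup>2) / 2"
  proof -
    let ?B = "\<lambda>n. - (a n - b n) / 2 * ((?t n / real (K n)) * (?t n / real (M n)) * ((a n + b n) + a n * b n * (?s n / ?t n)))"
    have "?B \<longlonglongrightarrow> - (x - z) / 2 * (1 * 1 * ((x + z) + x * z * 0))"
      by (intro tendsto_intros a b near_typical_inverse_ratio [OF K] near_typical_inverse_ratio [OF M] short_scale_div_typical) auto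
    moreover have "eventually (\<lambda>n. ?B n = T n) sequentially"
      using ev
    proof eventually_elim
      case (elim n)
      define p q t s where "p = real (K n)" and "q = real (M n)" and "t = ?t n" and "s = ?s n"
      have pos: "p > 0" "q > 0" "t > 0" "s > 0" using elim by (auto simp: p_def q_def t_def s_def)
      have n: "real n = t ^ 3 / (2 * s\<^sup>2)" and l: "ln (real n / pi) = t / s\<^sup>2" using elim unfolding t_def s_def by blast+
      have ab: "p = t + s * a n" "q = t + s * b n"
        using pos by (simp_all add: a_def b_def p_def q_def t_def s_def)
      \<comment> \<open>The factor \<open>t\<^sup>2 - p * q\<close> vanishes at
        \<open>p = q = t\<close>, reflecting that \<open>t\<close> is the stationary point. In the
        window it has order \<open>s * t\<close>, which exactly balances the other factors.\<close>
      have "T n = (p - q) * t / (2 * s\<^sup>2) * ((t\<^sup>2 - p * q) / (p * q))"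
        unfolding T_def l p_def [symmetric] q_def [symmetric] unfolding n
        using pos by (simp add: field_simps power2_eq_square power3_eq_cube)
      also have "p - q = s * (a n - b n)" by (simp add: ab algebra_simps)
      also have "t\<^sup>2 - p * q = - (t * s * (a n + b n) + s\<^sup>2 * (a n * b n))"
        by (simp add: ab algebra_simps power2_eq_square)
      also have "s * (a n - b n) * t / (2 * s\<^sup>2) * (- (t * s * (a n + b n) + s\<^sup>2 * (a n * b n)) / (p * q)) =
          - (a n - b n) / 2 * ((t / p) * (t / q) * ((a n + b n) + a n * b n * (s / t)))"
        using pos by (simp add: divide_simps) (simp add: power2_eq_square algebra_simps)
      finally show ?case by (simp only: p_def q_def t_def s_def)
    qed
    ultimately have "T \<longlonglongrightarrow> - (x - z) / 2 * (1 * 1 * ((x + z) + x * z * 0))"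
      by (rule Lim_transform_eventually)
    then show ?thesis by (simp add: power2_eq_square algebra_simps)
  qed
  have "eventually (\<lambda>n. T n + D1 n - D2 n + D3 n + D4 n = ln (leading_diagrams n (K n)) - ln (leading_diagrams n (M n))) sequentially"
    using ev
  proof eventually_elim
    case (elim n)
    define p q where "p = real (K n)" and "q = real (M n)"
    have pos: "p > 0" "q > 0" "real n > 0" using elim by (auto simp: p_def q_def)
    have lnr: "ln (2 * (u / (u + 1))) = ln 2 - ln (1 + 1 / u)" if "u > 0" for u :: real
    proof -
      have "u / (u + 1) = 1 / (1 + 1 / u)" using that by (simp add: field_simps)
      moreover have "1 + 1 / u \<noteq> 0" "1 + 1 / u > 0" using that by (simp_all add: add_pos_pos add_nonneg_eq_0_iff)
      ultimately show ?thesis using that by (simp add: ln_mult ln_div)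
    qed
    have lK: "ln (leading_diagrams n (K n)) = p * (ln (2 * pi) / 2) - ln (p + 1) / 2
      + (2 * real n - p) / 2 * ln (2 * (p / (p + 1))) + ln (Gamma (real n - (p - 1) / 2)) - ln pi / 2"
      unfolding p_def by (rule ln_leading_diagrams) (use elim in auto)
    have lM: "ln (leading_diagrams n (M n)) = q * (ln (2 * pi) / 2) - ln (q + 1) / 2
      + (2 * real n - q) / 2 * ln (2 * (q / (q + 1))) + ln (Gamma (real n - (q - 1) / 2)) - ln pi / 2"
      unfolding q_def by (rule ln_leading_diagrams) (use elim in auto)
    have l2: "ln (2 * pi) = ln 2 + ln pi" by (simp add: ln_mult)
    have ln: "ln (real n / pi) = ln (real n) - ln pi" using pos by (simp add: ln_div)
    show ?case
      unfolding lK lM lnr [OF pos(1)] lnr [OF pos(2)] l2 T_def D1_def D2_def D3_def D4_def ln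
        p_def [symmetric] q_def [symmetric]
      using pos by (simp add: diff_divide_distrib add_divide_distrib algebra_simps)
  qed
  moreover have "(\<lambda>n. T n + D1 n - D2 n + D3 n + D4 n) \<longlonglongrightarrow> (z\<^sup>2 - x\<^sup>2) / 2 + 0 - 0 + 0 + 0"
    by (intro tendsto_intros T D1 D2 D3 D4)
  ultimately have "(\<lambda>n. ln (leading_diagrams n (K n)) - ln (leading_diagrams n (M n))) \<longlonglongrightarrow> (z\<^sup>2 - x\<^sup>2) / 2 + 0 - 0 + 0 + 0"
    by (rule Lim_transform_eventually [rotated])
  then show ?thesis by simp
qed

text \<open>About \<open>n - K / 2\<close> factors \<open>K / (K + 1)\<close> become
  \<open>(K - 1) / K\<close>, each smaller by the factor \<open>1 - 1 / K^2\<close>; this gives the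
  exponential. The Gamma arguments differ by \<open>1 / 2\<close>, which gives the square root. All
  remaining factors are at most \<open>1\<close>.\<close>

lemma leading_diagrams_predecessor_le:
  assumes "2 \<le> K" "4 * real K + 8 < real n"
  shows "leading_diagrams (n - 1) (K - 1) / leading_diagrams n K \<le>
    exp (- ((2 * real n - real K - 1) / (2 * (real K)\<^sup>2))) / sqrt (real n - real K / 2 - 1)"
proof -
  define p where "p = real K"
  have p: "p \<ge> 2" "4 * p + 8 < real n" using assms by (auto simp: p_def)
  have Kn: "K < n"
  proof -
    have "real K < real n" using p unfolding p_def by linarith
    then show ?thesis by simp
  qed
  have cast: "real (K - 1) = p - 1" "real (n - 1) = real n - 1" using assms Kn by (auto simp: p_def of_nat_diff)
  have l1: "ln (leading_diagrams (n - 1) (K - 1)) = (p - 1) * (ln (2 * pi) / 2) - ln p / 2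
      + (2 * real n - p - 1) / 2 * ln (2 * ((p - 1) / p)) + ln (Gamma (real n - p / 2)) - ln pi / 2"
    using ln_leading_diagrams [of "K - 1" "n - 1"] assms Kn unfolding cast
    by (simp add: field_simps)
  have l2: "ln (leading_diagrams n K) = p * (ln (2 * pi) / 2) - ln (p + 1) / 2
      + (2 * real n - p) / 2 * ln (2 * (p / (p + 1))) + ln (Gamma (real n - p / 2 + 1 / 2)) - ln pi / 2"
  proof -
    have eq: "real n - (p - 1) / 2 = real n - p / 2 + 1 / 2" by (simp add: field_simps)
    show ?thesis using ln_leading_diagrams [of K n] assms Kn unfolding p_def [symmetric] eq by simp
  qed
  define A B where "A = ln (2 * ((p - 1) / p))" and "B = ln (2 * (p / (p + 1)))"
  have B: "B \<ge> 0" unfolding B_def using p by (intro ln_ge_zero) (simp add: field_simps)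
  have AB: "A - B \<le> - (1 / p\<^sup>2)"
  proof -
    have "A - B = ln ((2 * ((p - 1) / p)) / (2 * (p / (p + 1))))"
      unfolding A_def B_def using p by (subst ln_div) auto
    also have "(2 * ((p - 1) / p)) / (2 * (p / (p + 1))) = 1 - 1 / p\<^sup>2"
      using p by (simp add: field_simps power2_eq_square)
    also have "ln (1 - 1 / p\<^sup>2) \<le> (1 - 1 / p\<^sup>2) - 1"
    proof (rule ln_le_minus_one)
      have "1 < p\<^sup>2" using p by (simp add: one_less_power)
      then show "0 < 1 - 1 / p\<^sup>2" using p by (simp add: divide_less_eq_1)
    qed
    finally show ?thesis by simp
  qed
  have gam: "ln (real n - p / 2 - 1) / 2 \<le> ln (Gamma (real n - p / 2 + 1 / 2)) - ln (Gamma (real n - p / 2))"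
    using ln_Gamma_diff_bounds(1) [of "real n - p / 2" "real n - p / 2 + 1 / 2"] p by simp
  have two: "ln (p + 1) - ln p \<le> ln (2 * pi)"
  proof -
    have "ln (p + 1) - ln p = ln ((p + 1) / p)" using p by (simp add: ln_div)
    also have "\<dots> \<le> ln (2 * pi)"
    proof -
      have "(p + 1) / p \<le> 2" using p by (simp add: field_simps)
      also have "2 \<le> 2 * pi" using pi_gt3 by simp
      finally show ?thesis using p by (intro ln_mono) auto
    qed
    finally show ?thesis .
  qed
  have "ln (leading_diagrams (n - 1) (K - 1)) - ln (leading_diagrams n K) =
      (ln (p + 1) - ln p - ln (2 * pi)) / 2 + (2 * real n - p - 1) / 2 * (A - B) - B / 2
      - (ln (Gamma (real n - p / 2 + 1 / 2)) - ln (Gamma (real n - p / 2)))"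
    unfolding l1 l2 A_def [symmetric] B_def [symmetric] by (simp add: field_simps)
  also have "\<dots> \<le> (2 * real n - p - 1) / 2 * (A - B) - ln (real n - p / 2 - 1) / 2"
  proof -
    have "(u - v - w) / 2 + X - B / 2 - (G - H) \<le> X - h / 2"
      if "u - v \<le> w" "0 \<le> B" "h / 2 \<le> G - H" for u v w X B G H h :: real
      using that by (simp add: field_simps)
    from this [OF two B gam] show ?thesis .
  qed
  also have "(2 * real n - p - 1) / 2 * (A - B) \<le> (2 * real n - p - 1) / 2 * (- (1 / p\<^sup>2))"
    using AB p by (intro mult_left_mono) auto
  finally have *: "ln (leading_diagrams (n - 1) (K - 1)) - ln (leading_diagrams n K) \<le>
      - ((2 * real n - p - 1) / (2 * p\<^sup>2)) - ln (sqrt (real n - p / 2 - 1))"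
    using p by (simp add: ln_sqrt)
  have "leading_diagrams (n - 1) (K - 1) / leading_diagrams n K =
      exp (ln (leading_diagrams (n - 1) (K - 1)) - ln (leading_diagrams n K))"
    by (simp add: exp_diff leading_diagrams_pos)
  also have "\<dots> \<le> exp (- ((2 * real n - p - 1) / (2 * p\<^sup>2)) - ln (sqrt (real n - p / 2 - 1)))"
    using * by simp
  also have "\<dots> = exp (- ((2 * real n - p - 1) / (2 * p\<^sup>2))) / sqrt (real n - p / 2 - 1)"
    using p by (simp add: exp_diff)
  finally show ?thesis by (simp only: p_def)
qed

context
  fixes K :: "nat \<Rightarrow> nat" and x :: real
  assumes near: "near_typical K x"
begin

text \<open>At \<open>K = t\<close> the exponential in the preceding bound is close to
  \<open>sqrt (pi / n)\<close>. Together with the square root the whole bound is about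
  \<open>sqrt pi * K^2 / n\<close>, which decays only like \<open>1 / ln n\<close>.\<close>

lemma leading_diagrams_predecessor_tendsto_0:
  "(\<lambda>n. (real (K n))\<^sup>2 * (leading_diagrams (n - 1) (K n - 1) / leading_diagrams n (K n))) \<longlonglongrightarrow> 0"
proof -
  let ?t = typical_short and ?s = short_scale
  define a where "a n = (real (K n) - typical_short n) / short_scale n" for n
  have a: "a \<longlonglongrightarrow> x" using near by (simp add: near_typical_def a_def [abs_def])
  have inv_s: "(\<lambda>n. 1 / ?s n) \<longlonglongrightarrow> 0"
    by (rule real_tendsto_divide_at_top [OF tendsto_const short_scale_at_top])
  \<comment> \<open>Equal to \<open>t / (2 * s^2) - n / K^2\<close>, the change of the exponent when
    \<open>t\<close> is replaced by \<open>K n\<close>; the factor \<open>1 / s\<close> shows that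
    it vanishes in the window.\<close>
  define E where "E n = a n / 2 * (1 / ?s n) * (?t n / real (K n)) * (1 + ?t n / real (K n))" for n
  define R where "R n = real n - real (K n) / 2 - 1" for n
  let ?B = "\<lambda>n. ((real (K n) / ?t n)\<^sup>2 * ((?t n)\<^sup>2 / real n)) * sqrt pi * exp (E n) * exp ((1 / real (K n) + (1 / real (K n))\<^sup>2) / 2) / sqrt (1 - (real (K n) / real n) / 2 - 1 / real n)"
  have upper: "eventually (\<lambda>n. (real (K n))\<^sup>2 * (leading_diagrams (n - 1) (K n - 1) / leading_diagrams n (K n)) \<le> ?B n) sequentially"
    using typical_identities near_typical_range [OF near]
  proof eventually_elim
    case (elim n)
    define p t s where "p = real (K n)" and "t = ?t n" and "s = ?s n"
    have pos: "p > 0" "t > 0" "s > 0" "real n > 0" using elim by (auto simp: p_def t_def s_def)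
    have n: "real n = t ^ 3 / (2 * s\<^sup>2)" and l: "ln (real n / pi) = t / s\<^sup>2" using elim unfolding t_def s_def by blast+
    have Rn: "R n = real n * (1 - (p / real n) / 2 - 1 / real n)" using pos by (simp add: R_def p_def [symmetric] field_simps)
    have pa: "p = t + s * a n" using pos by (simp add: a_def p_def t_def s_def)
    have E: "E n = t / (2 * s\<^sup>2) - real n / p\<^sup>2"
    proof -
      have "t / (2 * s\<^sup>2) - real n / p\<^sup>2 = t * (p - t) * (p + t) / (2 * s\<^sup>2 * p\<^sup>2)"
        unfolding n using pos by (simp add: divide_simps) (simp add: power2_eq_square power3_eq_cube algebra_simps)
      also have "p - t = s * a n" by (simp add: pa)
      also have "t * (s * a n) * (p + t) / (2 * s\<^sup>2 * p\<^sup>2) = a n / 2 * (1 / s) * (t / p) * (1 + t / p)"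
        using pos by (simp add: field_simps power2_eq_square)
      finally show ?thesis by (simp add: E_def p_def t_def s_def)
    qed
    have sq: "exp (- (t / (2 * s\<^sup>2))) = sqrt pi / sqrt (real n)"
    proof -
      have "t / (2 * s\<^sup>2) = ln (real n / pi) / 2" unfolding l by simp
      also have "\<dots> = ln (sqrt (real n / pi))" using pos by (simp add: ln_sqrt)
      finally show ?thesis using pos by (simp add: exp_minus real_sqrt_divide)
    qed
    have "p\<^sup>2 * (leading_diagrams (n - 1) (K n - 1) / leading_diagrams n (K n)) \<le>
        p\<^sup>2 * (exp (- ((2 * real n - p - 1) / (2 * p\<^sup>2))) / sqrt (R n))"
      unfolding p_def R_def using elim by (intro mult_left_mono leading_diagrams_predecessor_le) auto
    also have "- ((2 * real n - p - 1) / (2 * p\<^sup>2)) = E n + - (t / (2 * s\<^sup>2)) + (1 / p + (1 / p)\<^sup>2) / 2"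
      unfolding E using pos by (simp add: field_simps power2_eq_square)
    also have "exp (E n + - (t / (2 * s\<^sup>2)) + (1 / p + (1 / p)\<^sup>2) / 2) =
        exp (E n) * (sqrt pi / sqrt (real n)) * exp ((1 / p + (1 / p)\<^sup>2) / 2)"
      by (simp only: exp_add sq)
    also have "sqrt (R n) = sqrt (real n) * sqrt (1 - (p / real n) / 2 - 1 / real n)"
      unfolding Rn by (rule real_sqrt_mult)
    also have "p\<^sup>2 * (exp (E n) * (sqrt pi / sqrt (real n)) * exp ((1 / p + (1 / p)\<^sup>2) / 2) / (sqrt (real n) * sqrt (1 - (p / real n) / 2 - 1 / real n))) =
        (p\<^sup>2 / (sqrt (real n) * sqrt (real n))) * sqrt pi * exp (E n) * exp ((1 / p + (1 / p)\<^sup>2) / 2) / sqrt (1 - (p / real n) / 2 - 1 / real n)"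
    proof -
      have "c * (e * (r / S) * g / (S * W)) = c / (S * S) * r * e * g / W" for c e r S g W :: real
        by (simp add: mult_ac)
      then show ?thesis .
    qed
    also have "p\<^sup>2 / (sqrt (real n) * sqrt (real n)) = (p / t)\<^sup>2 * (t\<^sup>2 / real n)"
      using pos by (simp add: power_divide)
    finally show ?case by (simp only: p_def t_def)
  qed
  have inv_K: "(\<lambda>n. 1 / real (K n)) \<longlonglongrightarrow> 0"
    by (rule real_tendsto_divide_at_top [OF tendsto_const near_typical_at_top [OF near]])
  have inv_n: "(\<lambda>n. 1 / real n) \<longlonglongrightarrow> 0" by real_asymp
  have "E \<longlonglongrightarrow> x / 2 * 0 * 1 * (1 + 1)"
    unfolding E_def [abs_def] by (intro tendsto_intros a inv_s near_typical_inverse_ratio [OF near]) auto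
  then have E: "E \<longlonglongrightarrow> 0" by simp
  have "?B \<longlonglongrightarrow> (1\<^sup>2 * 0) * sqrt pi * exp 0 * exp ((0 + 0\<^sup>2) / 2) / sqrt (1 - 0 / 2 - 0)"
    by (intro tendsto_intros E inv_K inv_n near_typical_ratio [OF near] near_typical_div_n [OF near] typical_short_sq_div_n) auto
  then have lim: "?B \<longlonglongrightarrow> 0" by simp
  have "eventually (\<lambda>n. 0 \<le> (real (K n))\<^sup>2 * (leading_diagrams (n - 1) (K n - 1) / leading_diagrams n (K n))) sequentially"
    by (intro always_eventually allI mult_nonneg_nonneg divide_nonneg_nonneg) (auto simp: leading_diagrams_pos less_imp_le)
  then show ?thesis by (rule tendsto_sandwich [OF _ upper tendsto_const lim])
qed

lemma crystal_count_div_leading: "(\<lambda>n. crystal_count n (int (K n)) / leading_diagrams n (K n)) \<longlonglongrightarrow> 1"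
proof (rule tendsto_sandwich)
  let ?r = "\<lambda>n. (real (K n))\<^sup>2 * (leading_diagrams (n - 1) (K n - 1) / leading_diagrams n (K n))"
  show "eventually (\<lambda>n. 1 - ?r n \<le> crystal_count n (int (K n)) / leading_diagrams n (K n)) sequentially"
    using near_typical_range [OF near]
  proof eventually_elim
    case (elim n)
    have "(leading_diagrams n (K n) - (real (K n))\<^sup>2 * leading_diagrams (n - 1) (K n - 1)) / leading_diagrams n (K n)
        \<le> crystal_count n (int (K n)) / leading_diagrams n (K n)"
      using elim leading_diagrams_pos by (intro divide_right_mono crystal_count_bounds(2)) (auto simp: less_imp_le)
    then show ?case using leading_diagrams_pos [of n "K n"] by (simp add: diff_divide_distrib)
  qed
  show "eventually (\<lambda>n. crystal_count n (int (K n)) / leading_diagrams n (K n) \<le> 1) sequentially"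
    using near_typical_range [OF near]
  proof eventually_elim
    case (elim n)
    then show ?case using crystal_count_bounds(1) [of "K n" n] leading_diagrams_pos [of n "K n"]
      by (simp add: divide_le_eq)
  qed
  have "(\<lambda>n. 1 - ?r n) \<longlonglongrightarrow> 1 - 0"
    by (intro tendsto_intros leading_diagrams_predecessor_tendsto_0)
  then show "(\<lambda>n. 1 - ?r n) \<longlonglongrightarrow> 1" by simp
qed simp

end

theorem crystal_count_ratio:
  assumes K: "near_typical K x" and M: "near_typical M z"
  shows "(\<lambda>n. crystal_count n (int (K n)) / crystal_count n (int (M n))) \<longlonglongrightarrow> exp ((z\<^sup>2 - x\<^sup>2) / 2)"
proof -
  let ?q = "\<lambda>K n. crystal_count n (int (K n)) / leading_diagrams n (K n)"
  have "(\<lambda>n. exp (ln (leading_diagrams n (K n)) - ln (leading_diagrams n (M n))) * (?q K n / ?q M n)) \<longlonglongrightarrow>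
      exp ((z\<^sup>2 - x\<^sup>2) / 2) * (1 / 1)"
    by (intro tendsto_intros ln_leading_diagrams_ratio [OF K M] crystal_count_div_leading [OF K] crystal_count_div_leading [OF M]) auto
  moreover have "exp (ln (leading_diagrams n (K n)) - ln (leading_diagrams n (M n))) * (?q K n / ?q M n) =
      crystal_count n (int (K n)) / crystal_count n (int (M n))" for n
  proof -
    have "leading_diagrams n (K n) \<noteq> 0" "leading_diagrams n (M n) \<noteq> 0"
      using leading_diagrams_pos less_irrefl by metis+
    then show ?thesis by (simp add: exp_diff leading_diagrams_pos)
  qed
  ultimately show ?thesis by simp
qed

section \<open>Domination by log-concavity\<close>

lemma log_concave_int_nonneg: "log_concave_int f \<Longrightarrow> f i \<ge> 0"
  by (simp add: log_concave_int_def)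

lemma log_concave_int_spread:
  assumes "log_concave_int f" "i \<le> j"
  shows "f (i - int r) * f (j + int r) \<le> f i * f j"
proof (induction r)
  case (Suc r)
  have "i - int r \<le> j + int r" using assms(2) by simp
  then have "f (i - int r - 1) * f (j + int r + 1) \<le> f (i - int r) * f (j + int r)"
    using assms(1) unfolding log_concave_int_def by blast
  then show ?case using Suc by (simp add: algebra_simps)
qed simp

text \<open>Where the quotients exist, this says that \<open>f (i + r) / f i\<close> decreases in
  \<open>i\<close>. The pair \<open>b, a + r\<close> has the same sum as \<open>a, b + r\<close> and
  is nested in it, so \<open>log_concave_int_spread\<close> applies.\<close>

lemma log_concave_int_shift:
  assumes "log_concave_int f" "a \<le> b"
  shows "f a * f (b + int r) \<le> f b * f (a + int r)"
proof (cases "a + int r \<le> b")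
  case True
  then show ?thesis using log_concave_int_spread [OF assms(1) True, of r] by (simp add: mult.commute)
next
  case False
  then have "b \<le> a + int r" "int (nat (b - a)) = b - a" using assms(2) by auto
  then show ?thesis using log_concave_int_spread [OF assms(1), of b "a + int r" "nat (b - a)"] by (simp add: add_ac)
qed

text \<open>Three values suffice. Each block of length \<open>d\<close> to the right of
  \<open>m\<close> loses at least the factor \<open>\<theta>\<close>. Inside a block the values may
  first rise, as \<open>m\<close> need not be the maximum, but never above
  \<open>2 * f m\<close>.\<close>

lemma log_concave_int_dominated_right:
  assumes f: "log_concave_int f" and pos: "f m > 0" and d: "d \<ge> (1::nat)"
    and left: "f m \<le> 2 * f (m - int d)" and right: "f (m + int d) \<le> \<theta> * f m" and \<theta>: "0 \<le> \<theta>"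
  shows "f (m + int s) \<le> 2 * \<theta> ^ (s div d) * f m"
proof -
  define t where "t = f (m + 1) / f m"
  have t: "t \<ge> 0" using pos log_concave_int_nonneg [OF f] by (simp add: t_def)
  have t_upper: "f (m + int r) \<le> t ^ r * f m" for r
  proof (induction r)
    case (Suc r)
    have "f m * f (m + int r + 1) \<le> f (m + int r) * f (m + 1)"
      using log_concave_int_shift [OF f, of m "m + int r" 1] by simp
    also have "\<dots> \<le> t ^ r * f m * f (m + 1)"
      using Suc log_concave_int_nonneg [OF f] by (intro mult_right_mono)
    finally have "f (m + int r + 1) \<le> t ^ r * f (m + 1)"
      using pos by simp
    then show ?case using pos by (simp add: t_def add_ac mult_ac)
  qed simp
  have t_lower: "t ^ r * f (m - int r) \<le> f m" for r
  proof (induction r)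
    case (Suc r)
    have "f (m - int (Suc r)) * f (m + 1) \<le> f m * f (m - int r)"
      using log_concave_int_shift [OF f, of "m - int (Suc r)" m 1] by simp
    then have "t * f (m - int (Suc r)) \<le> f (m - int r)"
      using pos by (simp add: t_def field_simps)
    then have "t ^ r * (t * f (m - int (Suc r))) \<le> t ^ r * f (m - int r)"
      using t by (intro mult_left_mono) auto
    then show ?case using Suc by (simp add: mult_ac)
  qed simp
  \<comment> \<open>If the ratio \<open>t\<close> at \<open>m\<close> exceeds \<open>1\<close>,
    log-concavity forces growth by at least \<open>t ^ d\<close> from \<open>m - d\<close> to
    \<open>m\<close>, and \<open>left\<close> limits this growth to \<open>2\<close>.\<close>
  have small: "f (m + int r) \<le> 2 * f m" if "r \<le> d" for r
  proof (cases "t \<le> 1")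
    case True
    then have "t ^ r * f m \<le> 1 * f m" using t pos by (intro mult_right_mono power_le_one) auto
    then show ?thesis using t_upper [of r] pos by linarith
  next
    case False
    have "t ^ d * f m \<le> t ^ d * (2 * f (m - int d))" using t left by (intro mult_left_mono) auto
    also have "\<dots> \<le> 2 * f m" using t_lower [of d] by simp
    finally have "t ^ d * f m \<le> 2 * f m" .
    moreover have "t ^ r * f m \<le> t ^ d * f m"
      using False that pos by (intro mult_right_mono power_increasing) auto
    ultimately show ?thesis using t_upper [of r] by linarith
  qed
  have blocks: "f (m + int (q * d)) \<le> \<theta> ^ q * f m" for q
  proof (induction q)
    case (Suc q)
    have "f m * f (m + int (q * d) + int d) \<le> f (m + int (q * d)) * f (m + int d)"
      by (rule log_concave_int_shift [OF f]) simp
    also have "\<dots> \<le> (\<theta> ^ q * f m) * (\<theta> * f m)"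
      using Suc right \<theta> pos log_concave_int_nonneg [OF f] by (intro mult_mono) auto
    finally have "f (m + int (q * d) + int d) \<le> \<theta> ^ Suc q * f m" using pos by (simp add: mult_ac)
    then show ?case by (simp add: algebra_simps)
  qed simp
  have "f m * f (m + int (s div d * d) + int (s mod d)) \<le> f (m + int (s div d * d)) * f (m + int (s mod d))"
    by (rule log_concave_int_shift [OF f]) simp
  also have "\<dots> \<le> (\<theta> ^ (s div d) * f m) * (2 * f m)"
    using d \<theta> pos log_concave_int_nonneg [OF f] by (intro mult_mono blocks small) auto
  finally have "f (m + int (s div d * d) + int (s mod d)) \<le> 2 * \<theta> ^ (s div d) * f m" using pos by simp
  moreover have "m + int (s div d * d) + int (s mod d) = m + int s"
    by (metis add.assoc div_mult_mod_eq of_nat_add)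
  ultimately show ?thesis by (simp only:)
qed

lemma log_concave_int_reflect:
  assumes "log_concave_int f" shows "log_concave_int (\<lambda>i. f (- i))"
proof -
  have "f (- (i - 1)) * f (- (j + 1)) \<le> f (- i) * f (- j)" if "i \<le> j" for i j
  proof -
    have "- j \<le> - i" using that by simp
    then have "f (- j - 1) * f (- i + 1) \<le> f (- j) * f (- i)"
      using assms unfolding log_concave_int_def by blast
    moreover have "- (i - 1) = - i + 1" "- (j + 1) = - j - 1" by simp_all
    ultimately show ?thesis by (simp only: mult.commute)
  qed
  then show ?thesis using assms by (simp add: log_concave_int_def)
qed

lemma log_concave_int_dominated:
  assumes f: "log_concave_int f" and pos: "f m > 0" and d: "d \<ge> (1::nat)"
    and half: "f m \<le> 2 * f (m - int d)" "f m \<le> 2 * f (m + int d)"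
    and decay: "f (m + int d) \<le> \<theta> * f m" "f (m - int d) \<le> \<theta> * f m" and \<theta>: "0 \<le> \<theta>"
  shows "f i \<le> 2 * \<theta> ^ (nat \<bar>i - m\<bar> div d) * f m"
proof (cases "i \<ge> m")
  case True
  then show ?thesis
    using log_concave_int_dominated_right [OF f pos d half(1) decay(1) \<theta>, of "nat (i - m)"] by simp
next
  case False
  have "f (- (- m + int (nat (m - i)))) \<le> 2 * \<theta> ^ (nat (m - i) div d) * f (- (- m))"
    by (rule log_concave_int_dominated_right [OF log_concave_int_reflect [OF f]]) (use pos d half decay \<theta> in \<open>simp_all add: add.commute\<close>)
  then show ?thesis using False by simp
qed

lemma near_typicalI:
  assumes "eventually (\<lambda>n. \<bar>real (K n) - (typical_short n + short_scale n * x)\<bar> \<le> 2) sequentially"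
  shows "near_typical K x"
proof -
  have "(\<lambda>n. (real (K n) - typical_short n) / short_scale n - x) \<longlonglongrightarrow> 0"
  proof (rule Lim_null_comparison)
    show "(\<lambda>n. 2 / short_scale n) \<longlonglongrightarrow> 0"
      by (rule real_tendsto_divide_at_top [OF tendsto_const short_scale_at_top])
    show "eventually (\<lambda>n. norm ((real (K n) - typical_short n) / short_scale n - x) \<le> 2 / short_scale n) sequentially"
      using assms typical_identities
    proof eventually_elim
      case (elim n)
      have "(real (K n) - typical_short n) / short_scale n - x = (real (K n) - (typical_short n + short_scale n * x)) / short_scale n"
        using elim by (simp add: field_simps)
      then show ?case using elim by (simp add: divide_right_mono)
    qed
  qed
  then show ?thesis unfolding near_typical_def by (simp add: LIM_zero_iff)
qed

definition window_index :: "nat \<Rightarrow> real \<Rightarrow> int" where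
  "window_index n x = \<lfloor>typical_short n + short_scale n * x\<rfloor>"

lemma window_index_bounds:
  "real_of_int (window_index n x) \<le> typical_short n + short_scale n * x"
  "typical_short n + short_scale n * x < real_of_int (window_index n x) + 1"
  unfolding window_index_def by linarith+

lemma eventually_window_large: "eventually (\<lambda>n. typical_short n + short_scale n * x \<ge> 3) sequentially"
proof -
  have "(\<lambda>n. 1 + x * (short_scale n / typical_short n)) \<longlonglongrightarrow> 1 + x * 0"
    by (intro tendsto_intros short_scale_div_typical)
  then have "filterlim (\<lambda>n. (1 + x * (short_scale n / typical_short n)) * typical_short n) at_top sequentially"
    by (rule filterlim_tendsto_pos_mult_at_top) (simp_all add: typical_short_at_top)
  then have "eventually (\<lambda>n. (1 + x * (short_scale n / typical_short n)) * typical_short n \<ge> 3) sequentially"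
    unfolding filterlim_at_top by blast
  then show ?thesis
    using typical_identities
  proof eventually_elim
    case (elim n)
    have "(1 + x * (short_scale n / typical_short n)) * typical_short n = typical_short n + short_scale n * x"
      using elim(2) by (simp add: distrib_right)
    then show ?case using elim(1) by simp
  qed
qed

text \<open>The shift \<open>e\<close> covers the points one rounded scale away from the centre,
  which the domination needs. The floor and the rounding in \<open>e\<close> cost \<open>1\<close>
  each, hence the \<open>2\<close> in \<open>near_typicalI\<close>.\<close>

lemma near_typical_shifted_index:
  fixes e :: "nat \<Rightarrow> int"
  assumes "eventually (\<lambda>n. \<bar>real_of_int (e n) - short_scale n * y\<bar> \<le> 1) sequentially"
  shows "near_typical (\<lambda>n. nat (window_index n x + e n)) (x + y)"
    and "eventually (\<lambda>n. int (nat (window_index n x + e n)) = window_index n x + e n) sequentially"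
proof -
  have *: "eventually (\<lambda>n. \<bar>real_of_int (window_index n x + e n) - (typical_short n + short_scale n * (x + y))\<bar> \<le> 2
      \<and> window_index n x + e n \<ge> 0) sequentially"
    using assms eventually_window_large [of "x + y"]
  proof eventually_elim
    case (elim n)
    have "\<bar>real_of_int (window_index n x + e n) - (typical_short n + short_scale n * (x + y))\<bar> \<le> 2"
      using elim(1) window_index_bounds [of n x] by (simp add: distrib_left)
    moreover from this have "real_of_int (window_index n x + e n) \<ge> 0" using elim(2) by linarith
    ultimately show ?case by linarith
  qed
  show "near_typical (\<lambda>n. nat (window_index n x + e n)) (x + y)"
    by (rule near_typicalI) (use * in eventually_elim, simp)
  show "eventually (\<lambda>n. int (nat (window_index n x + e n)) = window_index n x + e n) sequentially"
    using * by eventually_elim simp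
qed

lemma window_count_ratio:
  fixes e :: "nat \<Rightarrow> int"
  assumes "eventually (\<lambda>n. \<bar>real_of_int (e n) - short_scale n * y\<bar> \<le> 1) sequentially"
  shows "(\<lambda>n. crystal_count n (window_index n x + e n) / crystal_count n (window_index n 0)) \<longlonglongrightarrow> exp (- (x + y)\<^sup>2 / 2)"
proof -
  have z: "eventually (\<lambda>n. \<bar>real_of_int 0 - short_scale n * 0\<bar> \<le> 1) sequentially" by simp
  have "(\<lambda>n. crystal_count n (int (nat (window_index n x + e n))) / crystal_count n (int (nat (window_index n 0 + 0)))) \<longlonglongrightarrow>
      exp (((0 + 0)\<^sup>2 - (x + y)\<^sup>2) / 2)"
    by (rule crystal_count_ratio [OF near_typical_shifted_index(1) [OF assms] near_typical_shifted_index(1) [OF z]])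
  moreover have "eventually (\<lambda>n. crystal_count n (int (nat (window_index n x + e n))) / crystal_count n (int (nat (window_index n 0 + 0)))
      = crystal_count n (window_index n x + e n) / crystal_count n (window_index n 0)) sequentially"
    using near_typical_shifted_index(2) [OF assms, of x] near_typical_shifted_index(2) [OF z, of 0]
    by eventually_elim simp
  ultimately have "(\<lambda>n. crystal_count n (window_index n x + e n) / crystal_count n (window_index n 0)) \<longlonglongrightarrow>
      exp (((0 + 0)\<^sup>2 - (x + y)\<^sup>2) / 2)"
    by (rule Lim_transform_eventually)
  then show ?thesis by simp
qed

lemma eventually_center_count_pos: "eventually (\<lambda>n. crystal_count n (window_index n 0) > 0) sequentially"
proof -
  have "(\<lambda>n. crystal_count n (window_index n 0 + 0) / crystal_count n (window_index n 0)) \<longlonglongrightarrow> exp (- (0 + 0)\<^sup>2 / 2)"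
    by (rule window_count_ratio) simp
  then have "eventually (\<lambda>n. crystal_count n (window_index n 0 + 0) / crystal_count n (window_index n 0) > 0) sequentially"
    by (rule order_tendstoD(1)) simp
  then show ?thesis
  proof eventually_elim
    case (elim n)
    \<comment> \<open>Division by zero yields \<open>0\<close>, so a positive quotient forces a
      nonzero denominator.\<close>
    then have "crystal_count n (window_index n 0) \<noteq> 0" by auto
    then show ?case using crystal_count_nonneg [of n "window_index n 0"] by linarith
  qed
qed

text \<open>Originates in \<open>(3 / 4) ^ q\<close> with \<open>q\<close> at least
  \<open>\<bar>x\<bar> / 2 - 2\<close>. The \<open>- 2\<close> costs the constant
  \<open>16 / 9\<close>, and \<open>2 * (16 / 9)\<close> is below the \<open>4\<close> of the bound
  that follows.\<close>

definition tail_rate :: real where "tail_rate = ln (4 / 3) / 2"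

lemma tail_rate_pos: "tail_rate > 0"
  by (simp add: tail_rate_def)

text \<open>The three-point bound is applied at the centre with \<open>d\<close> the rounded scale
  and \<open>3 / 4\<close> for \<open>\<theta>\<close>: the ratios at distance \<open>d\<close> tend
  to \<open>exp (- 1 / 2)\<close>, which lies strictly between \<open>1 / 2\<close> and
  \<open>3 / 4\<close>.\<close>

lemma eventually_window_count_dominated:
  "eventually (\<lambda>n. \<forall>x. crystal_count n (window_index n x) \<le> 4 * exp (- tail_rate * \<bar>x\<bar>) * crystal_count n (window_index n 0)) sequentially"
proof -
  define d where "d n = nat \<lceil>short_scale n\<rceil>" for n
  let ?c = crystal_count and ?m = "\<lambda>n. window_index n 0"
  \<comment> \<open>From \<open>4\<close> on, rounding is harmless: \<open>d n\<close> is at most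
    \<open>5 / 4 * short_scale n\<close>, and an additive error \<open>1\<close> is at most
    \<open>short_scale n / 4\<close>.\<close>
  have s1: "eventually (\<lambda>n. short_scale n \<ge> 4) sequentially"
    using short_scale_at_top unfolding filterlim_at_top by blast
  have half: "(1/2::real) < exp (- (0 + 1)\<^sup>2 / 2)" "(1/2::real) < exp (- (0 + (-1))\<^sup>2 / 2)"
    and three: "exp (- (0 + 1)\<^sup>2 / 2) < (3/4::real)" "exp (- (0 + (-1))\<^sup>2 / 2) < (3/4::real)"
  proof -
    have e: "exp (1 / 2 :: real) < 2"
    proof (rule power2_less_imp_less)
      have "(exp (1 / 2 :: real))\<^sup>2 = exp 1" by (simp add: power2_eq_square flip: exp_add)
      also have "\<dots> < 2\<^sup>2" using exp_le by simp
      finally show "(exp (1 / 2 :: real))\<^sup>2 < 2\<^sup>2" .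
    qed simp
    have e': "exp (1 / 2 :: real) \<ge> 3 / 2" using exp_ge_add_one_self [of "1 / 2 :: real"] by simp
    have "exp (- 1 / 2 :: real) = 1 / exp (1 / 2)" by (simp add: exp_minus field_simps)
    moreover have "1 / 2 < 1 / exp (1 / 2 :: real)" using e by (intro divide_strict_left_mono) auto
    moreover have "1 / exp (1 / 2 :: real) \<le> 1 / (3 / 2)" using e' by (intro divide_left_mono) auto
    ultimately have "1 / 2 < exp (- 1 / 2 :: real)" "exp (- 1 / 2 :: real) < 3 / 4" by simp_all
    then show "(1/2::real) < exp (- (0 + 1)\<^sup>2 / 2)" "(1/2::real) < exp (- (0 + (-1))\<^sup>2 / 2)"
      "exp (- (0 + 1)\<^sup>2 / 2) < (3/4::real)" "exp (- (0 + (-1))\<^sup>2 / 2) < (3/4::real)" by simp_all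
  qed
  have dd: "eventually (\<lambda>n. \<bar>real_of_int (int (d n)) - short_scale n * 1\<bar> \<le> 1) sequentially"
    using s1 by eventually_elim (simp add: d_def, linarith)
  have dm: "eventually (\<lambda>n. \<bar>real_of_int (- int (d n)) - short_scale n * (- 1)\<bar> \<le> 1) sequentially"
    using dd by eventually_elim (simp add: abs_minus_commute)
  note R = window_count_ratio [OF dd, of 0] and Lf = window_count_ratio [OF dm, of 0]
  show ?thesis
    using eventually_center_count_pos s1 dd
      order_tendstoD(1) [OF R half(1)] order_tendstoD(1) [OF Lf half(2)]
      order_tendstoD(2) [OF R three(1)] order_tendstoD(2) [OF Lf three(2)]
  proof eventually_elim
    case (elim n)
    show ?case
    proof
      fix x :: real
      let ?q = "nat \<bar>window_index n x - ?m n\<bar> div d n"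
      have s: "short_scale n \<ge> 4" by (rule elim(2))
      have d1: "d n \<ge> 1" "real (d n) \<le> 5 / 4 * short_scale n" using elim(3) s by auto
      have "?c n (window_index n x) \<le> 2 * (3 / 4) ^ ?q * ?c n (?m n)"
        by (rule log_concave_int_dominated [OF log_concave_crystal_count])
           (use elim d1 in \<open>auto simp: field_simps\<close>)
      also have "2 * (3 / 4) ^ ?q * ?c n (?m n) \<le> 4 * exp (- tail_rate * \<bar>x\<bar>) * ?c n (?m n)"
      proof (rule mult_right_mono)
        have "\<bar>real_of_int (window_index n x - ?m n) - short_scale n * x\<bar> \<le> 1"
          using window_index_bounds [of n x] window_index_bounds [of n 0] by simp
        moreover have "\<bar>short_scale n * x\<bar> = short_scale n * \<bar>x\<bar>" using s by (simp add: abs_mult)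
        ultimately have 1: "short_scale n * \<bar>x\<bar> - 1 \<le> \<bar>real_of_int (window_index n x - ?m n)\<bar>" by linarith
        have "nat \<bar>window_index n x - ?m n\<bar> < d n + ?q * d n"
          using d1(1) by (intro dividend_less_div_times) simp
        then have "real (nat \<bar>window_index n x - ?m n\<bar>) < real (d n + ?q * d n)" by (simp only: of_nat_less_iff)
        then have "\<bar>real_of_int (window_index n x - ?m n)\<bar> < (real ?q + 1) * real (d n)"
          by (simp add: algebra_simps)
        also have "\<dots> \<le> (real ?q + 1) * (5 / 4 * short_scale n)"
          using d1(2) by (intro mult_left_mono) auto
        finally have "short_scale n * \<bar>x\<bar> < (real ?q + 1) * (5 / 4 * short_scale n) + 1" using 1 by linarith
        also have "\<dots> \<le> short_scale n * ((real ?q + 1) * (5 / 4) + 1 / 4)"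
          using s by (simp add: algebra_simps)
        finally have "\<bar>x\<bar> < (real ?q + 1) * (5 / 4) + 1 / 4" using s by simp
        then have 2: "\<bar>x\<bar> / 2 - 2 \<le> real ?q" by (simp add: algebra_simps)
        have ln43: "ln (4 / 3 :: real) \<ge> 0" "exp (ln (4 / 3 :: real)) = 4 / 3" by simp_all
        have "(3 / 4 :: real) ^ ?q = exp (- ln (4 / 3)) ^ ?q" by (simp add: exp_minus)
        also have "\<dots> = exp (- (ln (4 / 3) * real ?q))" by (simp add: exp_of_nat_mult [symmetric] mult.commute)
        also have "\<dots> \<le> exp (- (ln (4 / 3) * (\<bar>x\<bar> / 2 - 2)))"
          using mult_left_mono [OF 2 ln43(1)] by simp
        also have "- (ln (4 / 3) * (\<bar>x\<bar> / 2 - 2)) = - tail_rate * \<bar>x\<bar> + (ln (4 / 3) + ln (4 / 3))"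
          by (simp add: tail_rate_def algebra_simps)
        also have "exp \<dots> = exp (- tail_rate * \<bar>x\<bar>) * (4 / 3 * (4 / 3))"
          by (simp only: exp_add ln43(2))
        finally have "2 * (3 / 4 :: real) ^ ?q \<le> 4 * exp (- tail_rate * \<bar>x\<bar>)"
          using exp_ge_zero [of "- tail_rate * \<bar>x\<bar>"] by linarith
        then show "2 * (3 / 4 :: real) ^ ?q \<le> 4 * exp (- tail_rate * \<bar>x\<bar>)" .
      qed (rule crystal_count_nonneg)
      finally show "?c n (window_index n x) \<le> 4 * exp (- tail_rate * \<bar>x\<bar>) * ?c n (?m n)" .
    qed
  qed
qed

section \<open>Convergence of moments and distribution\<close>

text \<open>The majorant for test functions of quadratic growth, which the variance requires. By
  evenness only the half-line matters, where \<open>?F\<close> is an antiderivative.\<close>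

lemma integrable_quadratic_exp_decay:
  assumes "c > (0::real)"
  shows "integrable lborel (\<lambda>x. (\<bar>x\<bar> + 1)\<^sup>2 * exp (- c * \<bar>x\<bar>))"
proof -
  let ?F = "\<lambda>x::real. - (exp (- c * x) * ((x + 1)\<^sup>2 / c + 2 * (x + 1) / c\<^sup>2 + 2 / c ^ 3))"
  have "(\<integral>\<^sup>+x. ennreal ((x + 1)\<^sup>2 * exp (- c * x)) * indicator {0..} x \<partial>lborel) = ennreal (0 - ?F 0)"
  proof (rule nn_integral_FTC_atLeast)
    show "(?F has_real_derivative (x + 1)\<^sup>2 * exp (- c * x)) (at x)" for x
      using assms by (auto intro!: derivative_eq_intros simp: field_simps power2_eq_square power3_eq_cube)
    show "(?F \<longlongrightarrow> 0) at_top" using assms by real_asymp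
  qed (auto intro!: mult_nonneg_nonneg)
  moreover have "ennreal ((x + 1)\<^sup>2 * exp (- c * x)) * indicator {0..} x =
      ennreal (indicator {0..} x *\<^sub>R ((\<bar>x\<bar> + 1)\<^sup>2 * exp (- c * \<bar>x\<bar>)))" for x :: real
    by (auto split: split_indicator)
  ultimately have "(\<integral>\<^sup>+x. ennreal (indicator {0..} x *\<^sub>R ((\<bar>x\<bar> + 1)\<^sup>2 * exp (- c * \<bar>x\<bar>))) \<partial>lborel) = ennreal (0 - ?F 0)"
    by simp
  note nn = this
  have "has_bochner_integral lborel (\<lambda>x::real. indicator {0..} x *\<^sub>R ((\<bar>x\<bar> + 1)\<^sup>2 * exp (- c * \<bar>x\<bar>))) (0 - ?F 0)"
  proof -
    have "0 < 1 / c" "0 < 2 / c\<^sup>2" "0 < 2 / c ^ 3" using assms by auto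
    then have "- (1 / c) - 2 / c\<^sup>2 \<le> 2 / c ^ 3" by linarith
    with nn show ?thesis by (intro has_bochner_integral_nn_integral) auto
  qed
  from has_bochner_integral_even_function [OF this] show ?thesis
    by (simp add: has_bochner_integral_iff)
qed

text \<open>Each integer is the floor on a cell of length \<open>1 / s\<close>. A sum over integers
  is thus exactly an integral over a fixed space, and dominated convergence becomes available for
  sums.\<close>

lemma has_bochner_integral_floor_steps:
  fixes G :: "int \<Rightarrow> real"
  assumes s: "s > 0" and I: "finite I" "\<And>i. i \<notin> I \<Longrightarrow> G i = 0"
  shows "has_bochner_integral lborel (\<lambda>x. G \<lfloor>t + s * x\<rfloor>) ((\<Sum>i\<in>I. G i) / s)"
proof -
  have cell: "\<lfloor>t + s * x\<rfloor> = i \<longleftrightarrow> x \<in> {(real_of_int i - t) / s..<(real_of_int i + 1 - t) / s}" for x i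
    using s by (auto simp: floor_eq_iff field_simps)
  have eq: "(\<lambda>x. G \<lfloor>t + s * x\<rfloor>) = (\<lambda>x. \<Sum>i\<in>I. G i * indicator {(real_of_int i - t) / s..<(real_of_int i + 1 - t) / s} x)"
  proof
    fix x
    have "(\<Sum>i\<in>I. G i * indicator {(real_of_int i - t) / s..<(real_of_int i + 1 - t) / s} x) =
        (\<Sum>i\<in>I. if i = \<lfloor>t + s * x\<rfloor> then G i else 0)"
      by (rule sum.cong) (auto simp: indicator_def cell [symmetric] simp del: atLeastLessThan_iff)
    also have "\<dots> = G \<lfloor>t + s * x\<rfloor>" using I by (simp add: sum.delta')
    finally show "G \<lfloor>t + s * x\<rfloor> = (\<Sum>i\<in>I. G i * indicator {(real_of_int i - t) / s..<(real_of_int i + 1 - t) / s} x)" ..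
  qed
  have "has_bochner_integral lborel (\<lambda>x. \<Sum>i\<in>I. G i * indicator {(real_of_int i - t) / s..<(real_of_int i + 1 - t) / s} x)
      (\<Sum>i\<in>I. G i * (1 / s))"
  proof (rule has_bochner_integral_sum)
    fix i
    have le: "(real_of_int i - t) / s \<le> (real_of_int i + 1 - t) / s" using s by (intro divide_right_mono) auto
    have "has_bochner_integral lborel (indicator {(real_of_int i - t) / s..<(real_of_int i + 1 - t) / s} :: real \<Rightarrow> real)
        (measure lborel {(real_of_int i - t) / s..<(real_of_int i + 1 - t) / s})"
      using le by (intro has_bochner_integral_real_indicator) auto
    also have "measure lborel {(real_of_int i - t) / s..<(real_of_int i + 1 - t) / s} = 1 / s"
      using le by (simp add: measure_def diff_divide_distrib add_divide_distrib)
    finally show "has_bochner_integral lborel (\<lambda>x. G i * indicator {(real_of_int i - t) / s..<(real_of_int i + 1 - t) / s} x) (G i * (1 / s))"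
      by (rule has_bochner_integral_mult_right)
  qed
  then show ?thesis unfolding eq by (simp add: sum_divide_distrib)
qed

definition window_position :: "nat \<Rightarrow> int \<Rightarrow> real" where
  "window_position n i = (real_of_int i - typical_short n) / short_scale n"

definition count_sum :: "nat \<Rightarrow> (real \<Rightarrow> real) \<Rightarrow> real" where
  "count_sum n F = (\<Sum>i\<in>{0..int n}. F (window_position n i) * crystal_count n i)"

definition window_ratio :: "nat \<Rightarrow> real \<Rightarrow> real" where
  "window_ratio n x = crystal_count n (window_index n x) / crystal_count n (window_index n 0)"

lemma window_ratio_tendsto: "(\<lambda>n. window_ratio n x) \<longlonglongrightarrow> exp (- x\<^sup>2 / 2)"
  using window_count_ratio [of "\<lambda>_. 0" 0 x] by (simp add: window_ratio_def)

lemma window_position_index_bound: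
  assumes "short_scale n \<ge> 1"
  shows "\<bar>window_position n (window_index n x) - x\<bar> \<le> 1 / short_scale n"
proof -
  have "window_position n (window_index n x) - x = (real_of_int (window_index n x) - (typical_short n + short_scale n * x)) / short_scale n"
    using assms by (simp add: window_position_def field_simps)
  moreover have "\<bar>real_of_int (window_index n x) - (typical_short n + short_scale n * x)\<bar> \<le> 1"
    using window_index_bounds [of n x] by linarith
  ultimately show ?thesis using assms by (simp add: divide_right_mono)
qed

lemma eventually_short_scale_ge: "eventually (\<lambda>n. short_scale n \<ge> C) sequentially"
  using short_scale_at_top unfolding filterlim_at_top by blast

lemma window_position_index_tendsto: "(\<lambda>n. window_position n (window_index n x)) \<longlonglongrightarrow> x"
proof -
  have "(\<lambda>n. window_position n (window_index n x) - x) \<longlonglongrightarrow> 0"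
  proof (rule Lim_null_comparison)
    show "(\<lambda>n. 1 / short_scale n) \<longlonglongrightarrow> 0"
      by (rule real_tendsto_divide_at_top [OF tendsto_const short_scale_at_top])
    show "eventually (\<lambda>n. norm (window_position n (window_index n x) - x) \<le> 1 / short_scale n) sequentially"
      using eventually_short_scale_ge [of 1] by eventually_elim (simp add: window_position_index_bound)
  qed
  then show ?thesis by (simp add: LIM_zero_iff)
qed

lemma count_sum_integral:
  assumes "short_scale n > 0" "crystal_count n (window_index n 0) > 0"
  shows "has_bochner_integral lborel (\<lambda>x. F (window_position n (window_index n x)) * window_ratio n x)
    (count_sum n F / (short_scale n * crystal_count n (window_index n 0)))"
proof -
  have "has_bochner_integral lborel (\<lambda>x. (\<lambda>i. F (window_position n i) * (crystal_count n i / crystal_count n (window_index n 0))) \<lfloor>typical_short n + short_scale n * x\<rfloor>)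
      ((\<Sum>i\<in>{0..int n}. F (window_position n i) * (crystal_count n i / crystal_count n (window_index n 0))) / short_scale n)"
    by (rule has_bochner_integral_floor_steps) (use assms in \<open>auto simp: crystal_count_eq_0\<close>)
  moreover have "(\<Sum>i\<in>{0..int n}. F (window_position n i) * (crystal_count n i / crystal_count n (window_index n 0))) =
      count_sum n F / crystal_count n (window_index n 0)"
    by (simp add: count_sum_def sum_divide_distrib)
  ultimately show ?thesis
    by (simp add: window_index_def window_ratio_def mult.commute divide_divide_eq_left)
qed

text \<open>The later test functions dictate this form. The variance needs \<open>F\<close> to
  depend on \<open>n\<close> and to grow quadratically, the distribution function needs a jump and
  hence the exceptional set \<open>N\<close>. Convergence along sequences is asked for because
  \<open>F n\<close> is evaluated at rounded positions.\<close>

lemma count_sum_limit: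
  assumes bound: "eventually (\<lambda>n. \<forall>y. \<bar>F n y\<bar> \<le> C * (\<bar>y\<bar> + 1)\<^sup>2) sequentially"
    and lim: "\<And>x y. x \<notin> N \<Longrightarrow> y \<longlonglongrightarrow> x \<Longrightarrow> (\<lambda>n. F n (y n)) \<longlonglongrightarrow> \<phi> x" and N: "finite N"
    and \<phi>: "\<phi> \<in> borel_measurable borel"
  shows "(\<lambda>n. count_sum n (F n) / (short_scale n * crystal_count n (window_index n 0))) \<longlonglongrightarrow>
    (\<integral>x. \<phi> x * exp (- x\<^sup>2 / 2) \<partial>lborel)"
proof -
  let ?f = "\<lambda>n x. F n (window_position n (window_index n x)) * window_ratio n x"
  \<comment> \<open>Rounding at most doubles \<open>\<bar>x\<bar> + 1\<close>, which gives
    \<open>4\<close> after squaring; the domination of the counts contributes the other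
    \<open>4\<close>.\<close>
  let ?w = "\<lambda>x. 16 * \<bar>C\<bar> * ((\<bar>x\<bar> + 1)\<^sup>2 * exp (- tail_rate * \<bar>x\<bar>))"
  have ev: "eventually (\<lambda>n. (\<forall>y. \<bar>F n y\<bar> \<le> C * (\<bar>y\<bar> + 1)\<^sup>2) \<and> short_scale n \<ge> 1 \<and> crystal_count n (window_index n 0) > 0 \<and>
      (\<forall>x. crystal_count n (window_index n x) \<le> 4 * exp (- tail_rate * \<bar>x\<bar>) * crystal_count n (window_index n 0))) sequentially"
    using bound eventually_short_scale_ge [of 1] eventually_center_count_pos eventually_window_count_dominated
    by eventually_elim simp
  then obtain M where M: "\<And>n. n \<ge> M \<Longrightarrow> (\<forall>y. \<bar>F n y\<bar> \<le> C * (\<bar>y\<bar> + 1)\<^sup>2) \<and> short_scale n \<ge> 1 \<and> crystal_count n (window_index n 0) > 0 \<and>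
      (\<forall>x. crystal_count n (window_index n x) \<le> 4 * exp (- tail_rate * \<bar>x\<bar>) * crystal_count n (window_index n 0))"
    unfolding eventually_sequentially by blast
  have int: "has_bochner_integral lborel (?f n) (count_sum n (F n) / (short_scale n * crystal_count n (window_index n 0)))" if "n \<ge> M" for n
    using M [OF that] by (intro count_sum_integral) auto
  have "(\<lambda>n. \<integral>x. ?f (n + M) x \<partial>lborel) \<longlonglongrightarrow> (\<integral>x. \<phi> x * exp (- x\<^sup>2 / 2) \<partial>lborel)"
  proof (rule integral_dominated_convergence)
    show "(\<lambda>x. \<phi> x * exp (- x\<^sup>2 / 2)) \<in> borel_measurable lborel" using \<phi> by measurable
    show "?f (n + M) \<in> borel_measurable lborel" for n
      using int [of "n + M"] by (auto simp: has_bochner_integral_iff)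
    show "integrable lborel ?w"
      by (intro integrable_mult_right integrable_quadratic_exp_decay tail_rate_pos)
    show "AE x in lborel. (\<lambda>n. ?f (n + M) x) \<longlonglongrightarrow> \<phi> x * exp (- x\<^sup>2 / 2)"
    proof -
      have "AE x in lborel. x \<notin> N"
        using N by (intro AE_not_in) (simp add: finite_imp_null_set_lborel)
      then show ?thesis
      proof eventually_elim
        case (elim x)
        have "(\<lambda>n. ?f n x) \<longlonglongrightarrow> \<phi> x * exp (- x\<^sup>2 / 2)"
          by (intro tendsto_mult lim [OF elim] window_position_index_tendsto window_ratio_tendsto)
        then show ?case by (rule LIMSEQ_ignore_initial_segment)
      qed
    qed
    show "AE x in lborel. norm (?f (n + M) x) \<le> ?w x" for n
    proof (rule AE_I2)
      fix x :: real
      define m where "m = n + M"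
      have m: "\<And>y. \<bar>F m y\<bar> \<le> C * (\<bar>y\<bar> + 1)\<^sup>2" "short_scale m \<ge> 1" "crystal_count m (window_index m 0) > 0"
        "crystal_count m (window_index m x) \<le> 4 * exp (- tail_rate * \<bar>x\<bar>) * crystal_count m (window_index m 0)"
        using M [of m] by (auto simp: m_def)
      let ?p = "window_position m (window_index m x)"
      have "1 / short_scale m \<le> 1" using m(2) by simp
      then have p: "\<bar>?p\<bar> + 1 \<le> 2 * (\<bar>x\<bar> + 1)" 
        using window_position_index_bound [OF m(2), of x] abs_triangle_ineq [of x "?p - x"] abs_ge_zero [of x]
        by (simp add: algebra_simps)
      have "\<bar>F m ?p\<bar> \<le> C * (\<bar>?p\<bar> + 1)\<^sup>2" by (rule m(1))
      also have "\<dots> \<le> \<bar>C\<bar> * (\<bar>?p\<bar> + 1)\<^sup>2" by (intro mult_right_mono) auto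
      also have "\<dots> \<le> \<bar>C\<bar> * (2 * (\<bar>x\<bar> + 1))\<^sup>2" using p by (intro mult_left_mono power_mono) auto
      also have "\<dots> = 4 * \<bar>C\<bar> * (\<bar>x\<bar> + 1)\<^sup>2" by (simp only: power_mult_distrib) simp
      finally have 1: "\<bar>F m ?p\<bar> \<le> 4 * \<bar>C\<bar> * (\<bar>x\<bar> + 1)\<^sup>2" .
      have 2: "\<bar>window_ratio m x\<bar> \<le> 4 * exp (- tail_rate * \<bar>x\<bar>)"
        using m(3,4) crystal_count_nonneg [of m "window_index m x"] by (simp add: window_ratio_def divide_le_eq)
      have "norm (?f m x) \<le> (4 * \<bar>C\<bar> * (\<bar>x\<bar> + 1)\<^sup>2) * (4 * exp (- tail_rate * \<bar>x\<bar>))"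
        unfolding real_norm_def abs_mult by (intro mult_mono 1 2) auto
      then show "norm (?f (n + M) x) \<le> ?w x" by (simp add: m_def mult_ac)
    qed
  qed
  moreover have "(\<integral>x. ?f (n + M) x \<partial>lborel) = count_sum (n + M) (F (n + M)) / (short_scale (n + M) * crystal_count (n + M) (window_index (n + M) 0))" for n
    using int [of "n + M"] by (auto simp: has_bochner_integral_iff)
  ultimately have "(\<lambda>n. count_sum (n + M) (F (n + M)) / (short_scale (n + M) * crystal_count (n + M) (window_index (n + M) 0))) \<longlonglongrightarrow>
      (\<integral>x. \<phi> x * exp (- x\<^sup>2 / 2) \<partial>lborel)" by simp
  then show ?thesis by (rule LIMSEQ_offset)
qed

lemma integral_exp_square: "(\<integral>x. \<phi> x * exp (- x\<^sup>2 / 2) \<partial>lborel) = sqrt (2 * pi) * (\<integral>x. \<phi> x * std_normal_density x \<partial>lborel)"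
proof -
  have "\<phi> x * exp (- x\<^sup>2 / 2) = sqrt (2 * pi) * (\<phi> x * std_normal_density x)" for x
    by (simp add: std_normal_density_def)
  then show ?thesis by (simp only: integral_mult_right_zero)
qed

section \<open>Mean, variance and distribution function of the random diagram\<close>

lemma expectation_random_crystallized:
  "measure_pmf.expectation (random_crystallized n) (\<lambda>D. f (num_short D)) =
     (\<Sum>i\<in>{0..int n}. f (real_of_int i) * crystal_count n i) / (\<Sum>i\<in>{0..int n}. crystal_count n i)"
proof -
  let ?S = "crystallized_diagrams n"
  have fin: "finite ?S" and ne: "?S \<noteq> {}"
    by (rule finite_crystallized_diagrams, rule crystallized_diagrams_nonempty)
  have group: "(\<Sum>D\<in>?S. g (num_short D)) = (\<Sum>i\<in>{0..int n}. g (real_of_int i) * crystal_count n i)" for g :: "real \<Rightarrow> real"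
  proof -
    have range: "card (short_chords D) \<in> {..n}" if "D \<in> ?S" for D
    proof (rule ccontr)
      assume "card (short_chords D) \<notin> {..n}"
      then have "crystal_count n (int (card (short_chords D))) = 0" by (intro crystal_count_eq_0) auto
      then have "card {E\<in>?S. card (short_chords E) = card (short_chords D)} = 0"
        using card_crystallized_eq_crystal_count [of n "card (short_chords D)"] by simp
      then have "{E\<in>?S. card (short_chords E) = card (short_chords D)} = {}"
        by (subst (asm) card_0_eq) (use fin in auto)
      then show False using that by blast
    qed
    have "(\<Sum>D\<in>?S. g (num_short D)) = (\<Sum>k\<le>n. \<Sum>D\<in>{D\<in>?S. card (short_chords D) = k}. g (num_short D))"
      by (rule sum.group [symmetric]) (use fin range in auto)
    also have "\<dots> = (\<Sum>k\<le>n. g (real k) * crystal_count n (int k))"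
    proof (rule sum.cong [OF refl])
      fix k
      have "(\<Sum>D\<in>{D\<in>?S. card (short_chords D) = k}. g (num_short D)) = (\<Sum>D\<in>{D\<in>?S. card (short_chords D) = k}. g (real k))"
        by (rule sum.cong) (auto simp: num_short_def)
      then show "(\<Sum>D\<in>{D\<in>?S. card (short_chords D) = k}. g (num_short D)) = g (real k) * crystal_count n (int k)"
        by (simp add: card_crystallized_eq_crystal_count [symmetric])
    qed
    also have "\<dots> = (\<Sum>i\<in>{0..int n}. g (real_of_int i) * crystal_count n i)"
      by (rule sum.reindex_bij_witness [where i = nat and j = int]) auto
    finally show ?thesis .
  qed
  have "real (card ?S) = (\<Sum>i\<in>{0..int n}. crystal_count n i)"
    using group [of "\<lambda>_. 1"] by simp
  then show ?thesis
    unfolding random_crystallized_def using group [of f] by (simp add: integral_pmf_of_set fin ne)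
qed

definition scaled_expectation :: "nat \<Rightarrow> (real \<Rightarrow> real) \<Rightarrow> real" where
  "scaled_expectation n F = measure_pmf.expectation (random_crystallized n)
     (\<lambda>D. F ((num_short D - typical_short n) / short_scale n))"

text \<open>The total number of diagrams is the case \<open>F = 1\<close>, so in the quotient the
  normalisation and the constant \<open>sqrt (2 * pi)\<close> cancel.\<close>

lemma scaled_expectation_limit:
  assumes "eventually (\<lambda>n. \<forall>y. \<bar>F n y\<bar> \<le> C * (\<bar>y\<bar> + 1)\<^sup>2) sequentially"
    and "\<And>x y. x \<notin> N \<Longrightarrow> y \<longlonglongrightarrow> x \<Longrightarrow> (\<lambda>n. F n (y n)) \<longlonglongrightarrow> \<phi> x" and "finite N"
    and "\<phi> \<in> borel_measurable borel"
  shows "(\<lambda>n. scaled_expectation n (F n)) \<longlonglongrightarrow> (\<integral>x. \<phi> x * std_normal_density x \<partial>lborel)"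
proof -
  let ?z = "\<lambda>n. short_scale n * crystal_count n (window_index n 0)"
  have num: "(\<lambda>n. count_sum n (F n) / ?z n) \<longlonglongrightarrow> sqrt (2 * pi) * (\<integral>x. \<phi> x * std_normal_density x \<partial>lborel)"
    using count_sum_limit [OF assms] unfolding integral_exp_square .
  have "(\<lambda>n. count_sum n (\<lambda>_. 1) / ?z n) \<longlonglongrightarrow> (\<integral>x. 1 * exp (- x\<^sup>2 / 2) \<partial>lborel)"
  proof (rule count_sum_limit [where C = 1 and N = "{}"])
    show "eventually (\<lambda>n. \<forall>y::real. \<bar>1::real\<bar> \<le> 1 * (\<bar>y\<bar> + 1)\<^sup>2) sequentially"
      by (intro always_eventually allI) (simp add: one_le_power)
  qed auto
  then have den: "(\<lambda>n. count_sum n (\<lambda>_. 1) / ?z n) \<longlonglongrightarrow> sqrt (2 * pi)"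
    unfolding integral_exp_square by simp
  have "(\<lambda>n. (count_sum n (F n) / ?z n) / (count_sum n (\<lambda>_. 1) / ?z n)) \<longlonglongrightarrow>
      (sqrt (2 * pi) * (\<integral>x. \<phi> x * std_normal_density x \<partial>lborel)) / sqrt (2 * pi)"
    by (intro tendsto_divide num den) simp
  moreover have "eventually (\<lambda>n. (count_sum n (F n) / ?z n) / (count_sum n (\<lambda>_. 1) / ?z n) = scaled_expectation n (F n)) sequentially"
    using eventually_center_count_pos typical_identities
  proof eventually_elim
    case (elim n)
    then have "?z n \<noteq> 0" by auto
    then have "(count_sum n (F n) / ?z n) / (count_sum n (\<lambda>_. 1) / ?z n) = count_sum n (F n) / count_sum n (\<lambda>_. 1)" by simp
    also have "\<dots> = scaled_expectation n (F n)"
      unfolding scaled_expectation_def count_sum_def window_position_def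
      using expectation_random_crystallized [of n "\<lambda>k. F n ((k - typical_short n) / short_scale n)"] by simp
    finally show ?case .
  qed
  ultimately have "(\<lambda>n. scaled_expectation n (F n)) \<longlonglongrightarrow> (sqrt (2 * pi) * (\<integral>x. \<phi> x * std_normal_density x \<partial>lborel)) / sqrt (2 * pi)"
    by (rule Lim_transform_eventually)
  then show ?thesis by simp
qed

definition scaled_mean :: "nat \<Rightarrow> real" where
  "scaled_mean n = scaled_expectation n (\<lambda>y. y)"

definition scaled_variance :: "nat \<Rightarrow> real" where
  "scaled_variance n = scaled_expectation n (\<lambda>y. (y - scaled_mean n)\<^sup>2)"

lemma scaled_mean_tendsto: "scaled_mean \<longlonglongrightarrow> 0"
proof -
  have "(\<lambda>n. scaled_expectation n (\<lambda>y. y)) \<longlonglongrightarrow> (\<integral>x. x * std_normal_density x \<partial>lborel)"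
  proof (rule scaled_expectation_limit [where C = 1 and N = "{}"])
    have "\<bar>y\<bar> \<le> (\<bar>y\<bar> + 1)\<^sup>2" for y :: real
      by (simp add: power2_eq_square algebra_simps)
    then show "eventually (\<lambda>n. \<forall>y::real. \<bar>y\<bar> \<le> 1 * (\<bar>y\<bar> + 1)\<^sup>2) sequentially" by simp
  qed auto
  moreover have "(\<integral>x. x * std_normal_density x \<partial>lborel) = 0"
    using integral_std_normal_moment_odd [of 0] by (simp add: mult.commute)
  ultimately show ?thesis by (simp add: scaled_mean_def [abs_def])
qed

lemma scaled_variance_tendsto: "scaled_variance \<longlonglongrightarrow> 1"
proof -
  have "(\<lambda>n. scaled_expectation n (\<lambda>y. (y - scaled_mean n)\<^sup>2)) \<longlonglongrightarrow> (\<integral>x. x\<^sup>2 * std_normal_density x \<partial>lborel)"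
  proof (rule scaled_expectation_limit [where C = 1 and N = "{}"])
    \<comment> \<open>The test function moves with \<open>n\<close> through
      \<open>scaled_mean n\<close>; once this is below \<open>1\<close> in absolute value, the
      quadratic bound holds with constant \<open>1\<close>.\<close>
    have "eventually (\<lambda>n. \<bar>scaled_mean n\<bar> < 1) sequentially"
      by (rule order_tendstoD(2) [OF tendsto_rabs [OF scaled_mean_tendsto]]) simp
    then show "eventually (\<lambda>n. \<forall>y::real. \<bar>(y - scaled_mean n)\<^sup>2\<bar> \<le> 1 * (\<bar>y\<bar> + 1)\<^sup>2) sequentially"
    proof eventually_elim
      case (elim n)
      have "\<bar>(y - scaled_mean n)\<^sup>2\<bar> \<le> (\<bar>y\<bar> + 1)\<^sup>2" for y
      proof -
        have "\<bar>y - scaled_mean n\<bar> \<le> \<bar>y\<bar> + 1" using elim by linarith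
        then have "\<bar>y - scaled_mean n\<bar>\<^sup>2 \<le> (\<bar>y\<bar> + 1)\<^sup>2" by (intro power_mono) auto
        then show ?thesis by simp
      qed
      then show ?case by simp
    qed
    show "(\<lambda>n. (y n - scaled_mean n)\<^sup>2) \<longlonglongrightarrow> x\<^sup>2" if "y \<longlonglongrightarrow> x" for x y
      using tendsto_power [OF tendsto_diff [OF that scaled_mean_tendsto], of 2] by simp
  qed auto
  moreover have "(\<integral>x. x\<^sup>2 * std_normal_density x \<partial>lborel) = 1"
    using integral_std_normal_moment_even [of 1] by (simp add: mult.commute)
  ultimately show ?thesis by (simp add: scaled_variance_def [abs_def])
qed

lemma mean_short_eq:
  assumes "short_scale n > 0"
  shows "mean_short n = typical_short n + short_scale n * scaled_mean n"
proof -
  have fin: "finite (set_pmf (random_crystallized n))"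
    unfolding random_crystallized_def
    by (simp add: finite_crystallized_diagrams crystallized_diagrams_nonempty)
  have "scaled_mean n = (mean_short n - typical_short n) / short_scale n"
    unfolding scaled_mean_def scaled_expectation_def mean_short_def
    by (simp add: integrable_measure_pmf_finite [OF fin])
  then show ?thesis using assms by simp
qed

lemma var_short_eq:
  assumes "short_scale n > 0"
  shows "var_short n = (short_scale n)\<^sup>2 * scaled_variance n"
proof -
  have "(num_short D - mean_short n)\<^sup>2 =
      (short_scale n)\<^sup>2 * ((num_short D - typical_short n) / short_scale n - scaled_mean n)\<^sup>2" for D
  proof -
    have "num_short D - mean_short n = short_scale n * ((num_short D - typical_short n) / short_scale n - scaled_mean n)"
      unfolding mean_short_eq [OF assms] using assms by (simp add: field_simps)
    then show ?thesis by (simp only: power_mult_distrib)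
  qed
  then show ?thesis
    unfolding var_short_def scaled_variance_def scaled_expectation_def mean_short_def [symmetric]
    by (simp only: integral_mult_right_zero)
qed

lemma mean_short_asymp_equiv: "mean_short \<sim>[at_top] typical_short"
proof (rule asymp_equivI')
  have "(\<lambda>n. 1 + short_scale n / typical_short n * scaled_mean n) \<longlonglongrightarrow> 1 + 0 * 0"
    by (intro tendsto_intros short_scale_div_typical scaled_mean_tendsto)
  moreover have "eventually (\<lambda>n. 1 + short_scale n / typical_short n * scaled_mean n = mean_short n / typical_short n) sequentially"
    using typical_identities by eventually_elim (simp add: mean_short_eq add_divide_distrib)
  ultimately have "(\<lambda>n. mean_short n / typical_short n) \<longlonglongrightarrow> 1 + 0 * 0"
    by (rule Lim_transform_eventually)
  then show "(\<lambda>n. mean_short n / typical_short n) \<longlonglongrightarrow> 1" by simp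
qed

text \<open>Standardising by the exact mean and variance is absorbed into a test function that
  depends on \<open>n\<close>, whose parameters tend to \<open>0\<close> and \<open>1\<close>. Its
  limit jumps at \<open>z\<close> only, a single point without mass.\<close>

lemma cdf_standardized_short_law_tendsto:
  "(\<lambda>n. cdf (standardized_short_law n) z) \<longlonglongrightarrow> cdf std_normal_distribution z"
proof -
  let ?F = "\<lambda>n y. if (y - scaled_mean n) / sqrt (scaled_variance n) \<le> z then 1 else 0 :: real"
  have "(\<lambda>n. scaled_expectation n (?F n)) \<longlonglongrightarrow> (\<integral>x. indicator {..z} x * std_normal_density x \<partial>lborel)"
  proof (rule scaled_expectation_limit [where C = 1 and N = "{z}"])
    show "eventually (\<lambda>n. \<forall>y. \<bar>?F n y\<bar> \<le> 1 * (\<bar>y\<bar> + 1)\<^sup>2) sequentially"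
      by (intro always_eventually allI) (simp add: one_le_power)
    show "(\<lambda>n. ?F n (y n)) \<longlonglongrightarrow> indicator {..z} x" if x: "x \<notin> {z}" and y: "y \<longlonglongrightarrow> x" for x y
    proof -
      have lim: "(\<lambda>n. (y n - scaled_mean n) / sqrt (scaled_variance n)) \<longlonglongrightarrow> (x - 0) / sqrt 1"
        by (intro tendsto_intros y scaled_mean_tendsto scaled_variance_tendsto) simp
      consider "x < z" | "x > z" using x by fastforce
      then have "eventually (\<lambda>n. ?F n (y n) = indicator {..z} x) sequentially"
      proof cases
        case 1
        then have "eventually (\<lambda>n. (y n - scaled_mean n) / sqrt (scaled_variance n) < z) sequentially"
          by (intro order_tendstoD(2) [OF lim]) simp
        then show ?thesis by eventually_elim (use 1 in \<open>simp add: less_imp_le\<close>)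
      next
        case 2
        then have "eventually (\<lambda>n. (y n - scaled_mean n) / sqrt (scaled_variance n) > z) sequentially"
          by (intro order_tendstoD(1) [OF lim]) simp
        then show ?thesis by eventually_elim (use 2 in simp)
      qed
      then show ?thesis by (rule tendsto_eventually)
    qed
  qed auto
  moreover have "(\<integral>x. indicator {..z} x * std_normal_density x \<partial>lborel) = cdf std_normal_distribution z"
  proof -
    have "emeasure std_normal_distribution {..z} = (\<integral>\<^sup>+x. ennreal (indicator {..z} x * std_normal_density x) \<partial>lborel)"
      by (subst emeasure_density) (auto intro!: nn_integral_cong split: split_indicator)
    also have "\<dots> = ennreal (\<integral>x. indicator {..z} x * std_normal_density x \<partial>lborel)"
      by (rule nn_integral_eq_integral) (auto intro!: integrable_real_mult_indicator simp: mult.commute)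
    finally show ?thesis
      by (simp add: cdf_def measure_def integral_nonneg_AE)
  qed
  moreover have "eventually (\<lambda>n. scaled_expectation n (?F n) = cdf (standardized_short_law n) z) sequentially"
    using typical_identities
  proof eventually_elim
    case (elim n)
    then have s: "short_scale n > 0" by simp
    let ?X = "\<lambda>D. (num_short D - mean_short n) / sqrt (var_short n)"
    have "cdf (standardized_short_law n) z = measure (measure_pmf (random_crystallized n)) {D. ?X D \<le> z}"
      unfolding cdf_def standardized_short_law_def
      by (subst measure_distr) (auto simp: vimage_def)
    also have "\<dots> = measure_pmf.expectation (random_crystallized n) (indicator {D. ?X D \<le> z})"
      by simp
    also have "\<dots> = scaled_expectation n (?F n)"
      unfolding scaled_expectation_def
    proof (rule Bochner_Integration.integral_cong [OF refl])
      fix D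
      have "?X D = ((num_short D - typical_short n) / short_scale n - scaled_mean n) / sqrt (scaled_variance n)"
        unfolding mean_short_eq [OF s] var_short_eq [OF s] using s
        by (simp add: real_sqrt_mult diff_divide_distrib add_divide_distrib)
      then show "indicator {D. ?X D \<le> z} D = ?F n ((num_short D - typical_short n) / short_scale n)"
        by (simp add: indicator_def)
    qed
    finally show ?case ..
  qed
  ultimately show ?thesis using Lim_transform_eventually by fastforce
qed

theorem theorem12:
  shows "weak_conv_m standardized_short_law std_normal_distribution
       \<and> mean_short \<sim>[at_top] (\<lambda>n. sqrt (2 * real n / ln (real n)))"
proof
  show "weak_conv_m standardized_short_law std_normal_distribution"
    unfolding weak_conv_m_def weak_conv_def using cdf_standardized_short_law_tendsto by blast
  show "mean_short \<sim>[at_top] (\<lambda>n. sqrt (2 * real n / ln (real n)))"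
    by (rule asymp_equiv_trans [OF mean_short_asymp_equiv typical_short_asymp_equiv])
qed

end
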